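(* Let $f,g:\mathbb{R}\to\mathbb{R}$ satisfy: $f,g\in C^\infty(\mathbb{R})$; $f(0)=0$ and $f''(x)\ge 0$ for all $x\in\mathbb{R}$; $g(x)\ge 0$ for all $x\in\mathbb{R}$, and $g(x)=0$ if and only if $x=0$. Let $T>0$, $s>3/2$, and let $u\in C^0([0,T];H^s(\mathbb{R}))$ be a solution of $$u_t+f'(u)u_x+\partial_x\Lambda^{-2}\Big(g(u)+\frac{f''(u)}{2}u_x^2\Big)=0$$ with $u(0,x)=u_0(x)$. If $\phi$ is an admissible weight function (with associated $A$, $v$, $c_0$ as in the context), and the initial datum satisfies $$\phi u_0,\ \phi u_0'\in L^p(\mathbb{R}),\qquad 2\le p\le\infty,$$ then, for $t\in[0,T]$, $$\|\phi(\cdot)u(t,\cdot)\|_p+\|\phi(\cdot)u_x(t,\cdot)\|_p\le\kappa\Big(\|\phi(\cdot)u_0(\cdot)\|_p+\|\phi(\cdot)u_0'(\cdot)\|_p\Big)$$ for some constant $\kappa>0$ depending on $T$, $A$, $c_0$, $\inf_{\mathbb{R}}v$, $\|e^{-|\cdot|}v(\cdot)\|_1$, $f$, $g$ and $M$.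
   Context: Functions are real-valued, $t$ denotes time and $x$ space; $\|\cdot\|_p$ is the $L^p(\mathbb{R})$ norm. $\Lambda^{-2}=(1-\partial_x^2)^{-1}$: $\Lambda^{-2}h=q\ast h$ and $\partial_x\Lambda^{-2}h=(\partial_x q)\ast h$, where $q(x)=\tfrac12 e^{-|x|}$, $\partial_xq(x)=-\mathrm{sgn}(x)q(x)$ and $\ast$ is convolution in $x$. By local well-posedness theory such solutions also belong to $C^1([0,T];H^{s-1}(\mathbb{R}))$. A weight function is a continuous positive function $\mathbb{R}\to\mathbb{R}$. A weight $v$ is sub-multiplicative if $v(x+y)\le v(x)v(y)$ for all $x,y\in\mathbb{R}$. A function $\phi:\mathbb{R}\to\mathbb{R}$ is $v$-moderate if it is positive and there is a constant $c_0>0$ with $\phi(x+y)\le c_0\,v(x)\,\phi(y)$ for all $x,y\in\mathbb{R}$. An admissible weight function is a locally absolutely continuous function $\phi:\mathbb{R}\to\mathbb{R}$ (absolutely continuous on every compact interval) such that $|\phi'(x)|\le A|\phi(x)|$ for almost every $x$, for some $A>0$, and which is $v$-moderate for some continuous sub-multiplicative weight function $v$ satisfying $\inf_{\mathbb{R}}v>0$ and $e^{-|\cdot|}v(\cdot)\in L^1(\mathbb{R})$. The constant $M$ is the finite quantity $$M=\sup_{t\in[0,T]}\|u(t,\cdot)\|_\infty+\sup_{t\in[0,T]}\|u_x(t,\cdot)\|_\infty+\sup_{t\in[0,T]}\|f(u(t,\cdot))\|_\infty+\sup_{t\in[0,T]}\|f'(u(t,\cdot))\|_\infty+\sup_{t\in[0,T]}\|f''(u(t,\cdot))\|_\infty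 .$$ *)

theory Defs
  imports "HOL-Analysis.Analysis" "HOL-Probability.Essential_Supremum"
begin

section \<open>Lebesgue spaces on the real line\<close>

text \<open>The exponent ranges over extended numbers; the value of the norm is \<open>\<infinity>\<close> outside the space.
  The power of an extended number is only used with a positive real exponent.\<close>

definition ennreal_powr :: "ennreal \<Rightarrow> real \<Rightarrow> ennreal" where
  "ennreal_powr a r = (if a = \<infinity> then \<infinity> else ennreal (enn2real a powr r))"

definition Lp_norm :: "ennreal \<Rightarrow> (real \<Rightarrow> 'b::real_normed_vector) \<Rightarrow> ennreal" where
  "Lp_norm p h =
     (if p = \<infinity> then esssup lborel (\<lambda>x. ennreal (norm (h x)))
      else ennreal_powr (\<integral>\<^sup>+x. ennreal (norm (h x) powr enn2real p) \<partial>lborel) (1 / enn2real p))"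

definition Lp :: "ennreal \<Rightarrow> (real \<Rightarrow> 'b::real_normed_vector) set" where
  "Lp p = {h. h \<in> borel_measurable lborel \<and> Lp_norm p h < \<infinity>}"

section \<open>Sobolev spaces of nonnegative real order\<close>

text \<open>The Fourier transform on \<open>L\<^sup>2\<close> is the \<open>L\<^sup>2\<close>-limit of the truncated Fourier integrals. It is
  only determined almost everywhere, hence a relation.\<close>

definition is_fourier :: "(real \<Rightarrow> real) \<Rightarrow> (real \<Rightarrow> complex) \<Rightarrow> bool" where
  "is_fourier h F \<longleftrightarrow> h \<in> Lp 2 \<and> F \<in> Lp 2 \<and>
     ((\<lambda>R. Lp_norm 2 (\<lambda>\<xi>. F \<xi> - (LINT x:{-R..R}|lborel. complex_of_real (h x) * cis (- \<xi> * x))))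
        \<longlongrightarrow> 0) at_top"

text \<open>All \<open>F\<close> below agree almost everywhere, so the infimum ranges over a single value. It ranges
  over the empty set, and equals \<open>\<infinity>\<close>, if \<open>h\<close> is not in \<open>L\<^sup>2\<close>.\<close>

definition Hs_norm :: "real \<Rightarrow> (real \<Rightarrow> real) \<Rightarrow> ennreal" where
  "Hs_norm s h =
     (INF F\<in>{F. is_fourier h F}. Lp_norm 2 (\<lambda>\<xi>. (1 + \<xi>\<^sup>2) powr (s / 2) *\<^sub>R F \<xi>))"

definition Hs :: "real \<Rightarrow> (real \<Rightarrow> real) set" where
  "Hs s = {h. Hs_norm s h < \<infinity>}"

definition C0_Hs :: "real \<Rightarrow> real \<Rightarrow> (real \<Rightarrow> real \<Rightarrow> real) \<Rightarrow> bool" where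
  "C0_Hs T s u \<longleftrightarrow> (\<forall>t\<in>{0..T}. u t \<in> Hs s \<and>
     ((\<lambda>\<tau>. Hs_norm s (\<lambda>x. u \<tau> x - u t x)) \<longlongrightarrow> 0) (at t within {0..T}))"

definition Hs_time_deriv ::
    "real \<Rightarrow> real \<Rightarrow> (real \<Rightarrow> real \<Rightarrow> real) \<Rightarrow> real \<Rightarrow> (real \<Rightarrow> real) \<Rightarrow> bool" where
  "Hs_time_deriv T s u t w \<longleftrightarrow> w \<in> Hs s \<and>
     ((\<lambda>\<tau>. Hs_norm s (\<lambda>x. (u \<tau> x - u t x) / (\<tau> - t) - w x)) \<longlongrightarrow> 0) (at t within {0..T})"

section \<open>The equation\<close>

definition smooth :: "(real \<Rightarrow> real) \<Rightarrow> bool" where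
  "smooth f \<longleftrightarrow> (\<forall>n x. (deriv ^^ n) f differentiable (at x))"

definition convolution :: "(real \<Rightarrow> real) \<Rightarrow> (real \<Rightarrow> real) \<Rightarrow> real \<Rightarrow> real" where
  "convolution k h x = (\<integral>y. k (x - y) * h y \<partial>lborel)"

definition q_kernel :: "real \<Rightarrow> real" where
  "q_kernel x = exp (- \<bar>x\<bar>) / 2"

text \<open>The operator \<open>\<partial>\<^sub>x (1 - \<partial>\<^sub>x\<^sup>2)\<^sup>-\<^sup>1\<close>, which is convolution with the derivative of the kernel.\<close>

definition dx_inv_Helmholtz :: "(real \<Rightarrow> real) \<Rightarrow> real \<Rightarrow> real" where
  "dx_inv_Helmholtz h = convolution (\<lambda>z. - sgn z * q_kernel z) h"

text \<open>For \<open>s > 3/2\<close> every class in \<open>H\<^sup>s\<close> has exactly one continuous representative, and this one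
  is continuously differentiable: \<open>u t\<close> denotes it, so that \<open>u\<^sub>x\<close> is a classical derivative.
  The equation holds in \<open>H\<^sup>s\<^sup>-\<^sup>1\<close> at every time, \<open>u\<^sub>t\<close> being the derivative of the \<open>H\<^sup>s\<^sup>-\<^sup>1\<close>-valued
  map \<open>u\<close>, one-sided at the end points.\<close>

definition is_solution ::
    "(real \<Rightarrow> real) \<Rightarrow> (real \<Rightarrow> real) \<Rightarrow> real \<Rightarrow> real \<Rightarrow> (real \<Rightarrow> real \<Rightarrow> real) \<Rightarrow> bool" where
  "is_solution f g T s u \<longleftrightarrow>
     C0_Hs T s u \<and>
     (\<forall>t\<in>{0..T}. continuous_on UNIV (u t)) \<and>
     (\<forall>t\<in>{0..T}. \<exists>w. Hs_time_deriv T (s - 1) u t w \<and>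
        (AE x in lborel.
           w x + deriv f (u t x) * deriv (u t) x
             + dx_inv_Helmholtz
                 (\<lambda>y. g (u t y) + deriv (deriv f) (u t y) / 2 * (deriv (u t) y)\<^sup>2) x = 0))"

definition sup_bound ::
    "(real \<Rightarrow> real) \<Rightarrow> real \<Rightarrow> (real \<Rightarrow> real \<Rightarrow> real) \<Rightarrow> ennreal" where
  "sup_bound f T u =
     (SUP t\<in>{0..T}. Lp_norm \<infinity> (u t)) +
     (SUP t\<in>{0..T}. Lp_norm \<infinity> (deriv (u t))) +
     (SUP t\<in>{0..T}. Lp_norm \<infinity> (\<lambda>x. f (u t x))) +
     (SUP t\<in>{0..T}. Lp_norm \<infinity> (\<lambda>x. deriv f (u t x))) +
     (SUP t\<in>{0..T}. Lp_norm \<infinity> (\<lambda>x. deriv (deriv f) (u t x)))"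

section \<open>Weight functions\<close>

definition weight_function :: "(real \<Rightarrow> real) \<Rightarrow> bool" where
  "weight_function v \<longleftrightarrow> continuous_on UNIV v \<and> (\<forall>x. 0 < v x)"

definition submultiplicative :: "(real \<Rightarrow> real) \<Rightarrow> bool" where
  "submultiplicative v \<longleftrightarrow> (\<forall>x y. v (x + y) \<le> v x * v y)"

definition moderate_with :: "(real \<Rightarrow> real) \<Rightarrow> real \<Rightarrow> (real \<Rightarrow> real) \<Rightarrow> bool" where
  "moderate_with v c\<^sub>0 \<phi> \<longleftrightarrow>
     0 < c\<^sub>0 \<and> (\<forall>x. 0 < \<phi> x) \<and> (\<forall>x y. \<phi> (x + y) \<le> c\<^sub>0 * v x * \<phi> y)"

definition absolutely_continuous_on :: "real \<Rightarrow> real \<Rightarrow> (real \<Rightarrow> real) \<Rightarrow> bool" where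
  "absolutely_continuous_on a b \<phi> \<longleftrightarrow>
     (\<forall>\<epsilon>>0. \<exists>\<delta>>0. \<forall>D :: (real \<times> real) set.
        finite D \<and> (\<forall>(x, y)\<in>D. a \<le> x \<and> x \<le> y \<and> y \<le> b) \<and>
        pairwise (\<lambda>I J. {fst I<..<snd I} \<inter> {fst J<..<snd J} = {}) D \<and>
        (\<Sum>(x, y)\<in>D. y - x) < \<delta>
        \<longrightarrow> (\<Sum>(x, y)\<in>D. \<bar>\<phi> y - \<phi> x\<bar>) < \<epsilon>)"

definition locally_absolutely_continuous :: "(real \<Rightarrow> real) \<Rightarrow> bool" where
  "locally_absolutely_continuous \<phi> \<longleftrightarrow> (\<forall>a b. a \<le> b \<longrightarrow> absolutely_continuous_on a b \<phi>)"

text \<open>The constants and the function \<open>v\<close> witnessing admissibility are arguments, because the final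
  estimate depends on them.\<close>

definition admissible_weight ::
    "real \<Rightarrow> (real \<Rightarrow> real) \<Rightarrow> real \<Rightarrow> (real \<Rightarrow> real) \<Rightarrow> bool" where
  "admissible_weight A v c\<^sub>0 \<phi> \<longleftrightarrow>
     locally_absolutely_continuous \<phi> \<and>
     0 < A \<and>
     (AE x in lborel. \<exists>D. (\<phi> has_real_derivative D) (at x) \<and> \<bar>D\<bar> \<le> A * \<bar>\<phi> x\<bar>) \<and>
     weight_function v \<and> submultiplicative v \<and> 0 < (INF x. v x) \<and>
     (\<lambda>x. exp (- \<bar>x\<bar>) * v x) \<in> Lp 1 \<and>
     moderate_with v c\<^sub>0 \<phi>"

end

theory Submission
  imports Defs "HOL-Probability.Characteristic_Functions" "HOL-Real_Asymp.Real_Asymp"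
begin

text \<open>The estimate is proved in Lagrangian coordinates. Sobolev embedding makes \<open>u\<close> and \<open>u\<^sub>x\<close> continuous
  in \<open>t\<close> with respect to the supremum norm, and \<open>u\<^sub>t + f'(u) u\<^sub>x + P = 0\<close> holds pointwise, where
  \<open>P = \<partial>\<^sub>x \<Lambda>\<^sup>-\<^sup>2 F\<close> with \<open>F = g(u) + f''(u) u\<^sub>x\<^sup>2 / 2\<close>. Along the characteristics \<open>\<eta>' = f'(u(t, \<eta>))\<close> the
  function \<open>u\<close> has derivative \<open>-P\<close>, and comparing two neighbouring characteristics bounds \<open>u\<^sub>x\<close> through
  \<open>P\<^sub>x = \<Lambda>\<^sup>-\<^sup>2 F - F\<close>. As \<open>\<bar>F\<bar> \<le> C (\<bar>u\<bar> + \<bar>u\<^sub>x\<bar>)\<close> and characteristics move a bounded distance, the function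
  \<open>V(t, x) = (\<bar>u\<bar> + \<bar>u\<^sub>x\<bar>)(t, \<eta>(t, x))\<close> satisfies \<open>V(t) \<le> C V(0) + C \<integral> J V(\<tau>) d\<tau>\<close> over \<open>[0, t]\<close>, where
  \<open>J h = h + exp(-\<bar>\<sqdot>\<bar>) * h\<close>. Iterating, \<open>V(t) \<le> \<Sum>\<^sub>n C (C T)\<^sup>n / n! J\<^sup>n V(0)\<close>, with no a priori bound on weighted
  norms. Moderateness of \<open>\<phi>\<close> replaces the kernel \<open>exp(-\<bar>\<sqdot>\<bar>)\<close> by the integrable kernel \<open>c\<^sub>0 exp(-\<bar>\<sqdot>\<bar>) v\<close>
  after multiplication by \<open>\<phi>\<close>, so the series is bounded on every \<open>L\<^sup>p\<close>.\<close>

section \<open>The Fourier transform and Sobolev embedding\<close>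

text \<open>An energy estimate would differentiate the equation, test with a weighted power of u_x
  and close with Gronwall. Two obstacles: for s just above 3/2 the second space derivative need not
  be a function, and weighted norms at positive times are not known to be finite. Working pointwise
  along characteristics avoids both: differences replace the missing derivative, and the iteration
  starts from an unweighted sup bound, which only multiplies a remainder of size (C t r)^n / n!. The
  weight enters after the series in the initial datum has been found.

  Lagrangian coordinates cost three factors: the Lipschitz constant E = exp(B^2 T) of the flow and
  its inverse as a Jacobian, exp(2 B T) for the kernel, and for the weight the size of c_0 v on
  displacements up to B T. As v is controlled through an integral, its local bound has to be
  extracted from submultiplicativity. A single number \<Lambda> bounds the series operator on L^1
  and on L^\<infinity>, and Jensen's inequality transfers it to all exponents in between, so the
  final constant is uniform in p.\<close>

lemma enn2real_2: "enn2real 2 = 2" by (metis enn2real_ennreal ennreal_numeral zero_le_numeral)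

lemma Lp_norm_2: "Lp_norm 2 k = ennreal_powr (\<integral>\<^sup>+x. ennreal ((norm (k x))\<^sup>2) \<partial>lborel) (1/2)"
proof -
  have "(\<lambda>x. ennreal (norm (k x) powr 2)) = (\<lambda>x. ennreal ((norm (k x))\<^sup>2))" by (intro ext) (simp add: powr_numeral)
  then show ?thesis unfolding Lp_norm_def by (simp add: enn2real_2)
qed

text \<open>Moves bounds between a norm and the integral under its root, infinite values included,
  so that later estimates can stay with integrals.\<close>

lemma ennreal_powr_le_iff:
  assumes "0 < r" "0 \<le> e"
  shows "ennreal_powr a (1/r) \<le> ennreal e \<longleftrightarrow> a \<le> ennreal (e powr r)"
proof (cases a)
  case (real b)
  have "b powr (1/r) \<le> e \<longleftrightarrow> b \<le> e powr r"
  proof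
    assume "b powr (1/r) \<le> e"
    then have "(b powr (1/r)) powr r \<le> e powr r" using assms by (intro powr_mono2) auto
    then show "b \<le> e powr r" using assms real by (simp add: powr_powr)
  next
    assume "b \<le> e powr r"
    then have "b powr (1/r) \<le> (e powr r) powr (1/r)" using assms real by (intro powr_mono2) auto
    then show "b powr (1/r) \<le> e" using assms by (simp add: powr_powr)
  qed
  then show ?thesis using real assms by (simp add: ennreal_powr_def)
next
  case top
  then show ?thesis by (simp add: ennreal_powr_def top_unique)
qed

lemma Lp_norm_2_le_iff:
  assumes "0 \<le> e"
  shows "Lp_norm 2 k \<le> ennreal e \<longleftrightarrow> (\<integral>\<^sup>+x. ennreal ((norm (k x))\<^sup>2) \<partial>lborel) \<le> ennreal (e\<^sup>2)"
  using ennreal_powr_le_iff[of 2 e] assms by (simp add: Lp_norm_2 powr_numeral)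

text \<open>Cauchy-Schwarz. The type is a division algebra so that one statement serves real
  functions and their complex transforms.\<close>

lemma nn_integral_L2_mult:
  fixes k \<psi> :: "real \<Rightarrow> 'a::{real_normed_div_algebra,second_countable_topology}"
  assumes [measurable]: "k \<in> borel_measurable lborel" "\<psi> \<in> borel_measurable lborel"
    and k: "Lp_norm 2 k \<le> ennreal e" and p: "Lp_norm 2 \<psi> \<le> ennreal b" and e: "0 \<le> e" "0 \<le> b"
  shows "(\<integral>\<^sup>+x. ennreal (norm (k x * \<psi> x)) \<partial>lborel) \<le> ennreal (e * b)"
proof -
  let ?I = "\<integral>\<^sup>+x. ennreal (norm (k x * \<psi> x)) \<partial>lborel"
  have "?I\<^sup>2 = (\<integral>\<^sup>+x. ennreal (norm (k x)) * ennreal (norm (\<psi> x)) \<partial>lborel)\<^sup>2"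
    by (simp add: norm_mult ennreal_mult)
  also have "\<dots> \<le> (\<integral>\<^sup>+x. (ennreal (norm (k x)))\<^sup>2 \<partial>lborel) * (\<integral>\<^sup>+x. (ennreal (norm (\<psi> x)))\<^sup>2 \<partial>lborel)"
    by (intro Cauchy_Schwarz_nn_integral) auto
  also have "\<dots> \<le> ennreal (e\<^sup>2) * ennreal (b\<^sup>2)"
    using k p e by (intro mult_mono) (auto simp: Lp_norm_2_le_iff ennreal_power)
  also have "\<dots> = (ennreal (e * b))\<^sup>2" using e by (simp add: ennreal_power power_mult_distrib flip: ennreal_mult)
  finally have *: "?I\<^sup>2 \<le> (ennreal (e * b))\<^sup>2" .
  show ?thesis
  proof (cases ?I)
    case (real r)
    then have "r\<^sup>2 \<le> (e * b)\<^sup>2" using * e by (simp add: ennreal_power)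
    then have "r \<le> e * b" using e real by (simp add: power2_le_iff_abs_le)
    then show ?thesis using real by (simp add: ennreal_leI)
  next
    case top
    then show ?thesis using * e by (simp add: ennreal_power[of "e * b"] top_unique)
  qed
qed

lemma Lp_2_finiteE:
  assumes "k \<in> Lp 2"
  obtains e where "0 \<le> e" "Lp_norm 2 k \<le> ennreal e" "k \<in> borel_measurable lborel"
proof -
  from assms have "k \<in> borel_measurable lborel" "Lp_norm 2 k < \<infinity>" by (auto simp: Lp_def)
  then show ?thesis using that[of "enn2real (Lp_norm 2 k)"] by (simp add: less_top)
qed

lemma integrable_L2_mult:
  fixes k \<psi> :: "real \<Rightarrow> 'a::{real_normed_div_algebra,second_countable_topology,banach}"
  assumes "k \<in> Lp 2" "\<psi> \<in> Lp 2"
  shows "integrable lborel (\<lambda>x. k x * \<psi> x)"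
proof -
  obtain e b where *: "0 \<le> e" "Lp_norm 2 k \<le> ennreal e" "0 \<le> b" "Lp_norm 2 \<psi> \<le> ennreal b"
    and [measurable]: "k \<in> borel_measurable lborel" "\<psi> \<in> borel_measurable lborel"
    using assms by (metis Lp_2_finiteE)
  show ?thesis
    unfolding integrable_iff_bounded
    using nn_integral_L2_mult[of k \<psi> e b] * by (auto intro: le_less_trans)
qed

lemma Lp_2_iff:
  "k \<in> Lp 2 \<longleftrightarrow> k \<in> borel_measurable lborel \<and> (\<integral>\<^sup>+x. ennreal ((norm (k x))\<^sup>2) \<partial>lborel) < \<infinity>"
  by (auto simp: Lp_def Lp_norm_2 ennreal_powr_def less_top)

lemma Lp_2_of_integrable_square:
  fixes k :: "real \<Rightarrow> 'a::{real_normed_vector,second_countable_topology}"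
  assumes "k \<in> borel_measurable lborel" "integrable lborel (\<lambda>x. (norm (k x))\<^sup>2)"
  shows "k \<in> Lp 2"
  using assms by (auto simp: Lp_2_iff integrable_iff_bounded)

lemma Lp_2_of_real: "h \<in> Lp 2 \<Longrightarrow> (\<lambda>x. complex_of_real (h x)) \<in> Lp 2" by (auto simp: Lp_2_iff)

text \<open>Pairing with the indicator of the interval, itself square integrable, gives local
  integrability; this makes the truncated Fourier integrals converge absolutely.\<close>

lemma set_integrable_L2:
  fixes h :: "real \<Rightarrow> real"
  assumes "h \<in> Lp 2"
  shows "set_integrable lborel {-R..R::real} h"
proof -
  have "(indicator {-R..R} :: real \<Rightarrow> real) \<in> Lp 2"
    by (rule Lp_2_of_integrable_square) (auto simp: power2_eq_square simp flip: indicator_inter_arith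
        intro!: integrable_real_indicator emeasure_bounded_finite)
  from integrable_L2_mult[OF this assms] show ?thesis by (simp add: set_integrable_def)
qed

section \<open>Duality for the Fourier transform on L^2\<close>

definition trunc_fourier :: "(real \<Rightarrow> real) \<Rightarrow> real \<Rightarrow> real \<Rightarrow> complex" where
  "trunc_fourier h R \<xi> = (LINT x:{-R..R}|lborel. complex_of_real (h x) * cis (- \<xi> * x))"

lemma cis_measurable [measurable]: "cis \<in> borel_measurable borel" by (intro borel_measurable_continuous_onI continuous_intros)

lemma trunc_fourier_measurable [measurable]:
  assumes [measurable]: "h \<in> borel_measurable lborel"
  shows "trunc_fourier h R \<in> borel_measurable lborel"
  unfolding trunc_fourier_def set_lebesgue_integral_def
  by (measurable; simp)

lemma norm_trunc_fourier_le:
  assumes "h \<in> Lp 2"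
  shows "norm (trunc_fourier h R \<xi>) \<le> (LINT x:{-R..R}|lborel. \<bar>h x\<bar>)"
  unfolding trunc_fourier_def set_lebesgue_integral_def
proof (rule order_trans[OF integral_norm_bound], rule Bochner_Integration.integral_mono)
  have [measurable]: "h \<in> borel_measurable lborel" using assms by (auto simp: Lp_def)
  have i: "integrable lborel (\<lambda>x. indicator {-R..R} x *\<^sub>R \<bar>h x\<bar>)"
    using set_integrable_abs[OF set_integrable_L2[OF assms, of R]] by (simp add: set_integrable_def)
  show "integrable lborel (\<lambda>x. indicator {-R..R} x *\<^sub>R \<bar>h x\<bar>)" by fact
  show "integrable lborel (\<lambda>x. norm (indicat_real {- R..R} x *\<^sub>R (complex_of_real (h x) * cis (- \<xi> * x))))"
    by (intro integrable_norm, rule Bochner_Integration.integrable_bound[OF i]) (auto simp: norm_mult)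
qed (auto simp: norm_mult)

text \<open>Fubini: the truncation makes the double integrand integrable on the product, which it
  need not be for a general square integrable \<open>h\<close>.\<close>

lemma fourier_trunc_duality:
  assumes h: "h \<in> Lp 2" and psi: "integrable lborel \<psi>"
  shows "(LINT \<xi>|lborel. trunc_fourier h R \<xi> * \<psi> \<xi>)
    = (LINT x|lborel. indicator {-R..R} x *\<^sub>R (complex_of_real (h x) * (LINT \<xi>|lborel. \<psi> \<xi> * cis (- \<xi> * x))))"
proof -
  have [measurable]: "h \<in> borel_measurable lborel" "\<psi> \<in> borel_measurable lborel" using h psi by (auto simp: Lp_def)
  let ?f = "\<lambda>(\<xi>, x). indicat_real {-R..R} x *\<^sub>R (complex_of_real (h x) * cis (- \<xi> * x)) * \<psi> \<xi>"
  have i: "integrable lborel (\<lambda>x. indicator {-R..R} x *\<^sub>R \<bar>h x\<bar>)"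
    using set_integrable_abs[OF set_integrable_L2[OF h, of R]] by (simp add: set_integrable_def)
  have i2: "integrable lborel (\<lambda>x. indicat_real {- R..R} x *\<^sub>R (complex_of_real (h x) * cis (- \<xi> * x)))" for \<xi>
    by (rule Bochner_Integration.integrable_bound[OF i]) (auto simp: norm_mult)
  have *: "integrable (lborel \<Otimes>\<^sub>M lborel) ?f"
  proof (rule lborel_pair.Fubini_integrable)
    show "?f \<in> borel_measurable (lborel \<Otimes>\<^sub>M lborel)" by measurable
    have "(\<lambda>\<xi>. LINT x|lborel. norm (?f (\<xi>, x)))
        = (\<lambda>\<xi>. (LINT x|lborel. indicator {-R..R} x *\<^sub>R \<bar>h x\<bar>) * norm (\<psi> \<xi>))"
      by (subst integral_mult_left_zero[symmetric]) (auto simp: norm_mult mult.assoc simp del: integral_mult_left_zero)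
    then show "integrable lborel (\<lambda>\<xi>. LINT x|lborel. norm (?f (\<xi>, x)))" using psi by simp
    show "AE \<xi> in lborel. integrable lborel (\<lambda>x. ?f (\<xi>, x))" unfolding split_conv by (intro AE_I2 integrable_mult_left i2)
  qed
  have "(LINT \<xi>|lborel. trunc_fourier h R \<xi> * \<psi> \<xi>) = (LINT \<xi>|lborel. LINT x|lborel. ?f (\<xi>, x))"
    unfolding trunc_fourier_def set_lebesgue_integral_def
    by (subst integral_mult_left_zero[symmetric]) simp
  also have "\<dots> = (LINT x|lborel. LINT \<xi>|lborel. ?f (\<xi>, x))"
    using lborel_pair.Fubini_integral[of "\<lambda>\<xi> x. ?f (\<xi>, x)"] * by simp
  also have "\<dots> = (LINT x|lborel. indicator {-R..R} x *\<^sub>R (complex_of_real (h x) * (LINT \<xi>|lborel. \<psi> \<xi> * cis (- \<xi> * x))))"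
  proof (intro Bochner_Integration.integral_cong refl)
    fix x
    have "(LINT \<xi>|lborel. ?f (\<xi>, x)) = (LINT \<xi>|lborel. (indicat_real {-R..R} x *\<^sub>R complex_of_real (h x)) * (\<psi> \<xi> * cis (- \<xi> * x)))"
      by (intro Bochner_Integration.integral_cong) (auto simp: scaleR_conv_of_real)
    then show "(LINT \<xi>|lborel. ?f (\<xi>, x)) = indicator {-R..R} x *\<^sub>R (complex_of_real (h x) * (LINT \<xi>|lborel. \<psi> \<xi> * cis (- \<xi> * x)))"
      by (simp add: scaleR_conv_of_real mult.assoc)
  qed
  finally show ?thesis .
qed

text \<open>The transform is accessible only as an L^2 limit, so the truncated identity is passed to
  the limit: on the left by Cauchy-Schwarz against \<open>\<psi>\<close>, on the right by dominated
  convergence.\<close>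

lemma fourier_duality:
  assumes hF: "is_fourier h F" and psi: "integrable lborel \<psi>" "\<psi> \<in> Lp 2"
    and hat: "(\<lambda>x. LINT \<xi>|lborel. \<psi> \<xi> * cis (- \<xi> * x)) \<in> Lp 2" (is "?hat \<in> _")
  shows "(LINT \<xi>|lborel. F \<xi> * \<psi> \<xi>) = (LINT x|lborel. complex_of_real (h x) * ?hat x)"
proof -
  have h: "h \<in> Lp 2" and F: "F \<in> Lp 2"
    and lim: "((\<lambda>R. Lp_norm 2 (\<lambda>\<xi>. F \<xi> - trunc_fourier h R \<xi>)) \<longlongrightarrow> 0) at_top"
    using hF by (auto simp: is_fourier_def trunc_fourier_def)
  have [measurable]: "h \<in> borel_measurable lborel" "\<psi> \<in> borel_measurable lborel" "F \<in> borel_measurable lborel"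
    "?hat \<in> borel_measurable lborel"
    using h psi F hat by (auto simp: Lp_def)
  obtain b where b: "0 \<le> b" "Lp_norm 2 \<psi> \<le> ennreal b" using psi Lp_2_finiteE by metis
  have iF: "integrable lborel (\<lambda>\<xi>. F \<xi> * \<psi> \<xi>)" by (rule integrable_L2_mult[OF F psi(2)])
  have iT: "integrable lborel (\<lambda>\<xi>. trunc_fourier h R \<xi> * \<psi> \<xi>)" for R
    by (rule Bochner_Integration.integrable_bound[where f="\<lambda>\<xi>. (LINT x:{-R..R}|lborel. \<bar>h x\<bar>) * norm (\<psi> \<xi>)"])
      (use psi in \<open>auto simp: norm_mult abs_mult intro!: mult_mono order_trans[OF norm_trunc_fourier_le[OF h]] AE_I2\<close>)
  have lim1: "((\<lambda>R. LINT \<xi>|lborel. trunc_fourier h R \<xi> * \<psi> \<xi>) \<longlongrightarrow> (LINT \<xi>|lborel. F \<xi> * \<psi> \<xi>)) at_top"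
  proof (rule tendstoI)
    fix e :: real assume e: "0 < e"
    \<comment> \<open>Chosen so that \<open>d * b < e\<close> also when
      \<open>b = 0\<close>.\<close>
    define d where "d = e / (b + 1) / 2"
    have d: "0 < d" using e b by (simp add: d_def)
    have "eventually (\<lambda>R. Lp_norm 2 (\<lambda>\<xi>. F \<xi> - trunc_fourier h R \<xi>) < ennreal d) at_top"
      using order_tendstoD(2)[OF lim] d by simp
    then show "eventually (\<lambda>R. dist (LINT \<xi>|lborel. trunc_fourier h R \<xi> * \<psi> \<xi>) (LINT \<xi>|lborel. F \<xi> * \<psi> \<xi>) < e) at_top"
    proof eventually_elim
      fix R assume R: "Lp_norm 2 (\<lambda>\<xi>. F \<xi> - trunc_fourier h R \<xi>) < ennreal d"
      have "ennreal (norm (LINT \<xi>|lborel. (F \<xi> - trunc_fourier h R \<xi>) * \<psi> \<xi>))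
          \<le> (\<integral>\<^sup>+\<xi>. ennreal (norm ((F \<xi> - trunc_fourier h R \<xi>) * \<psi> \<xi>)) \<partial>lborel)"
        by (rule integral_norm_bound_ennreal)
          (auto simp: left_diff_distrib intro!: iF iT)
      also have "\<dots> \<le> ennreal (d * b)" using R b d by (intro nn_integral_L2_mult) auto
      finally have "norm (LINT \<xi>|lborel. (F \<xi> - trunc_fourier h R \<xi>) * \<psi> \<xi>) \<le> d * b"
        using d b by (simp add: ennreal_le_iff)
      also have "d * b < e" using e b by (simp add: d_def field_simps add_nonneg_pos)
      finally show "dist (LINT \<xi>|lborel. trunc_fourier h R \<xi> * \<psi> \<xi>) (LINT \<xi>|lborel. F \<xi> * \<psi> \<xi>) < e"
        using iF iT by (simp add: left_diff_distrib dist_norm norm_minus_commute)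
    qed
  qed
  have ih: "integrable lborel (\<lambda>x. complex_of_real (h x) * ?hat x)" by (rule integrable_L2_mult[OF Lp_2_of_real[OF h] hat])
  have lim2: "((\<lambda>R. LINT x|lborel. indicator {-R..R} x *\<^sub>R (complex_of_real (h x) * ?hat x)) \<longlongrightarrow> (LINT x|lborel. complex_of_real (h x) * ?hat x)) at_top"
  proof (rule integral_dominated_convergence_at_top[where w="\<lambda>x. norm (complex_of_real (h x) * ?hat x)"])
    show "AE x in lborel. ((\<lambda>R. indicat_real {- R..R} x *\<^sub>R (complex_of_real (h x) * ?hat x)) \<longlongrightarrow> complex_of_real (h x) * ?hat x) at_top"
    proof (intro AE_I2 tendsto_eventually)
      fix x
      show "\<forall>\<^sub>F R in at_top. indicat_real {- R..R} x *\<^sub>R (complex_of_real (h x) * ?hat x) = complex_of_real (h x) * ?hat x"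
        using eventually_ge_at_top[of "\<bar>x\<bar>"] by eventually_elim (auto simp: indicator_def)
    qed
    show "integrable lborel (\<lambda>x. norm (complex_of_real (h x) * ?hat x))" using ih by (rule integrable_norm)
    show "\<forall>\<^sub>F R in at_top. AE x in lborel. norm (indicat_real {- R..R} x *\<^sub>R (complex_of_real (h x) * ?hat x)) \<le> norm (complex_of_real (h x) * ?hat x)"
      by (intro always_eventually allI AE_I2) (auto simp: indicator_def)
  qed measurable
  show ?thesis
    using lim1 lim2 unfolding fourier_trunc_duality[OF h psi(1)]
    by (rule tendsto_unique[OF trivial_limit_at_top_linorder])
qed

section \<open>Gaussian regularisation and Fourier inversion\<close>

lemma integrable_gaussian: "integrable lborel (\<lambda>x::real. exp (- x\<^sup>2 / 2))"
proof -
  have "integrable lborel (\<lambda>x. sqrt (2 * pi) * normal_density 0 1 x)"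
    by (intro integrable_mult_right integrable_normal_density) auto
  then show ?thesis by (simp add: normal_density_def)
qed

lemma gaussian_integral: "(LINT x|lborel. exp (- x\<^sup>2 / 2)) = sqrt (2 * pi)"
proof -
  have "(LINT x|lborel. sqrt (2 * pi) * normal_density 0 1 x) = sqrt (2 * pi)" by (subst integral_mult_right_zero) simp
  then show ?thesis by (simp add: normal_density_def)
qed

text \<open>Read off from the characteristic function of the standard normal law by removing its
  normalisation 1 / sqrt(2 pi).\<close>

lemma gaussian_fourier:
  "(LINT x|lborel. complex_of_real (exp (- x\<^sup>2 / 2)) * cis (t * x)) = complex_of_real (sqrt (2 * pi) * exp (- t\<^sup>2 / 2))"
proof -
  have "complex_of_real (exp (- t\<^sup>2 / 2)) = char std_normal_distribution t" by (simp add: char_std_normal_distribution)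
  also have "\<dots> = (LINT x|lborel. std_normal_density x *\<^sub>R iexp (t * x))" unfolding char_def by (subst integral_density) auto
  also have "\<dots> = (LINT x|lborel. complex_of_real (1 / sqrt (2 * pi)) * (complex_of_real (exp (- x\<^sup>2 / 2)) * cis (t * x)))"
    by (intro Bochner_Integration.integral_cong)
      (auto simp: normal_density_def scaleR_conv_of_real cis_conv_exp)
  also have "\<dots> = complex_of_real (1 / sqrt (2 * pi)) * (LINT x|lborel. complex_of_real (exp (- x\<^sup>2 / 2)) * cis (t * x))"
    by (rule integral_mult_right_zero)
  finally show ?thesis
    by (simp add: field_simps)
qed

lemma gaussian_fourier_scaled:
  assumes "0 < \<epsilon>"
  shows "(LINT \<xi>|lborel. complex_of_real (exp (- (\<epsilon> * \<xi>)\<^sup>2 / 2)) * cis (t * \<xi>))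
    = complex_of_real (sqrt (2 * pi) / \<epsilon> * exp (- (t / \<epsilon>)\<^sup>2 / 2))"
proof -
  have "(LINT x|lborel. complex_of_real (exp (- x\<^sup>2 / 2)) * cis (t / \<epsilon> * x))
     = \<epsilon> *\<^sub>R (LINT \<xi>|lborel. complex_of_real (exp (- (\<epsilon> * \<xi>)\<^sup>2 / 2)) * cis (t * \<xi>))"
    using lborel_integral_real_affine[of \<epsilon> "\<lambda>x. complex_of_real (exp (- x\<^sup>2 / 2)) * cis (t / \<epsilon> * x)" 0] assms
    by simp
  then show ?thesis
    unfolding gaussian_fourier using assms by (simp add: scaleR_conv_of_real field_simps)
qed

lemma gaussian_Lp_2: 
  assumes "0 < \<epsilon>"
  shows "integrable lborel (\<lambda>x. exp (- (\<epsilon> * (x - a))\<^sup>2 / 2))" (is ?A)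
    and "(\<lambda>x. exp (- (\<epsilon> * (x - a))\<^sup>2 / 2)) \<in> Lp 2" (is ?B)
proof -
  have A: "integrable lborel (\<lambda>x. exp (- (\<epsilon> * (x - a))\<^sup>2 / 2))" if "0 < \<epsilon>" for \<epsilon> :: real
    using lborel_integrable_real_affine[OF integrable_gaussian, of \<epsilon> "- \<epsilon> * a"] that
    by (simp add: right_diff_distrib)
  show ?A by (rule A[OF assms])
  show ?B
  proof (rule Lp_2_of_integrable_square)
    \<comment> \<open>The square of a Gaussian is again a Gaussian, with rate multiplied by sqrt 2,
      so square integrability reduces to integrability.\<close>
    have *: "(exp (- (\<epsilon> * (x - a))\<^sup>2 / 2))\<^sup>2 = exp (- (sqrt 2 * \<epsilon> * (x - a))\<^sup>2 / 2)" for x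
      by (simp add: power_mult_distrib flip: exp_of_nat_mult[of 2, simplified])
    show "integrable lborel (\<lambda>x. (norm (exp (- (\<epsilon> * (x - a))\<^sup>2 / 2)))\<^sup>2)"
      using A[of "sqrt 2 * \<epsilon>"] assms unfolding real_norm_def power2_abs * by simp
  qed simp
qed

text \<open>Duality tested with a Gaussian times a character: its transform is a Gaussian of width
  \<epsilon> centred at \<open>x\<close>, so the right side is a smoothed value of \<open>h\<close>
  at \<open>x\<close>.\<close>

lemma gaussian_inversion:
  assumes hF: "is_fourier h F" and e: "0 < \<epsilon>"
  shows "(LINT \<xi>|lborel. F \<xi> * (complex_of_real (exp (- (\<epsilon> * \<xi>)\<^sup>2 / 2)) * cis (x * \<xi>)))
    = complex_of_real (LINT y|lborel. h y * (sqrt (2 * pi) / \<epsilon> * exp (- ((x - y) / \<epsilon>)\<^sup>2 / 2)))"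
proof -
  let ?\<psi> = "\<lambda>\<xi>. complex_of_real (exp (- (\<epsilon> * \<xi>)\<^sup>2 / 2)) * cis (x * \<xi>)"
  let ?g = "\<lambda>y. sqrt (2 * pi) / \<epsilon> * exp (- ((x - y) / \<epsilon>)\<^sup>2 / 2)"
  have g1: "integrable lborel (\<lambda>\<xi>. exp (- (\<epsilon> * \<xi>)\<^sup>2 / 2))"
    and g2: "(\<lambda>\<xi>. exp (- (\<epsilon> * \<xi>)\<^sup>2 / 2)) \<in> Lp 2"
    using gaussian_Lp_2[OF e, of 0] by auto
  have hat: "(LINT \<xi>|lborel. ?\<psi> \<xi> * cis (- \<xi> * y)) = complex_of_real (?g y)" for y
  proof -
    have "?\<psi> \<xi> * cis (- \<xi> * y) = complex_of_real (exp (- (\<epsilon> * \<xi>)\<^sup>2 / 2)) * cis ((x - y) * \<xi>)" for \<xi>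
      by (simp add: mult.assoc cis_mult algebra_simps)
    then show ?thesis by (simp only: gaussian_fourier_scaled[OF e])
  qed
  have 1: "integrable lborel ?\<psi>" by (rule Bochner_Integration.integrable_bound[OF g1]) (auto simp: norm_mult)
  have 2: "?\<psi> \<in> Lp 2" using g2 by (auto simp: Lp_2_iff norm_mult)
  have 3: "(\<lambda>y. LINT \<xi>|lborel. ?\<psi> \<xi> * cis (- \<xi> * y)) \<in> Lp 2"
    unfolding hat
  proof (rule Lp_2_of_real)
    have *: "((x - y) / \<epsilon>)\<^sup>2 = (1 / \<epsilon> * (y - x))\<^sup>2" for y
      by (simp add: power_divide power2_commute)
    have "(\<lambda>y. exp (- ((x - y) / \<epsilon>)\<^sup>2 / 2)) \<in> Lp 2"
      using gaussian_Lp_2(2)[of "1 / \<epsilon>" x] e unfolding * by simp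
    moreover have "(norm (?g y))\<^sup>2 = (sqrt (2 * pi) / \<epsilon>)\<^sup>2 * (norm (exp (- ((x - y) / \<epsilon>)\<^sup>2 / 2)))\<^sup>2" for y
      by (simp only: norm_mult power_mult_distrib real_norm_def power2_abs)
    ultimately show "?g \<in> Lp 2" unfolding Lp_2_iff by (auto simp: ennreal_mult nn_integral_cmult ennreal_mult_less_top)
  qed
  show ?thesis
    using fourier_duality[OF hF 1 2 3] unfolding hat
    by (simp flip: of_real_mult)
qed

text \<open>Boundedness of \<open>h\<close> is not yet available, so the integral is split at
  distance 1 from \<open>x\<close>. On the compact window \<open>h\<close> is bounded, and the
  substitution y = x + z / s allows dominated convergence. Outside it the scaled Gaussian is at most
  s exp(- s^2 / 4) times a fixed square integrable Gaussian, whose pairing with \<open>h\<close> is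
  finite.\<close>

lemma approx_identity_gaussian:
  fixes h :: "real \<Rightarrow> real"
  assumes h: "h \<in> Lp 2" and cont: "continuous_on UNIV h"
  shows "(\<lambda>n. LINT y|lborel. h y * (real (Suc n) * exp (- ((x - y) * real (Suc n))\<^sup>2 / 2))) \<longlonglongrightarrow> sqrt (2 * pi) * h x"
proof -
  have [measurable]: "h \<in> borel_measurable borel" using h by (auto simp: Lp_def)
  define s where "s = (\<lambda>n. real (Suc n))"
  have s: "1 \<le> s n" for n by (simp add: s_def)
  have s0: "0 < s n" for n using s[of n] by linarith
  define G where "G = (\<lambda>n y. h y * (s n * exp (- ((x - y) * s n)\<^sup>2 / 2)))"
  have iG: "integrable lborel (G n)" for n
  proof -
    have *: "((x - y) * s n)\<^sup>2 = (s n * (y - x))\<^sup>2" for y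
      by (simp add: power_mult_distrib power2_commute)
    have "integrable lborel (\<lambda>y. h y * exp (- ((x - y) * s n)\<^sup>2 / 2))"
      unfolding * by (rule integrable_L2_mult[OF h gaussian_Lp_2(2)[OF s0]])
    then show ?thesis
      unfolding G_def by (simp add: mult.left_commute[of _ "s n"])
  qed
  obtain B where B: "\<And>y. y \<in> {x - 1..x + 1} \<Longrightarrow> \<bar>h y\<bar> \<le> B"
    using compact_imp_bounded[OF compact_continuous_image[OF continuous_on_subset[OF cont] compact_Icc[of "x - 1" "x + 1"]]]
    unfolding bounded_iff by force
  have "0 \<le> B" using B[of x] by simp
  let ?near = "\<lambda>y. indicator {x - 1..x + 1} y :: real" and ?far = "\<lambda>y. indicator (- {x - 1..x + 1}) y :: real"
  have near: "(\<lambda>n. LINT y|lborel. ?near y * G n y) \<longlonglongrightarrow> sqrt (2 * pi) * h x"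
  proof -
    have *: "(LINT y|lborel. ?near y * G n y) = (LINT z|lborel. ?near (x + z / s n) * h (x + z / s n) * exp (- z\<^sup>2 / 2))" for n
      using lborel_integral_real_affine[of "1 / s n" "\<lambda>y. ?near y * G n y" x] s0[of n]
      by (simp add: G_def mult_ac divide_simps power_mult_distrib)
    have "(\<lambda>n. LINT z|lborel. ?near (x + z / s n) * h (x + z / s n) * exp (- z\<^sup>2 / 2)) \<longlonglongrightarrow> (LINT z|lborel. h x * exp (- z\<^sup>2 / 2))"
    proof (rule integral_dominated_convergence[where w="\<lambda>z. B * exp (- z\<^sup>2 / 2)"])
      show "integrable lborel (\<lambda>z. B * exp (- z\<^sup>2 / 2))" using integrable_gaussian by simp
      show "AE z in lborel. (\<lambda>n. ?near (x + z / s n) * h (x + z / s n) * exp (- z\<^sup>2 / 2)) \<longlonglongrightarrow> h x * exp (- z\<^sup>2 / 2)"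
      proof (intro AE_I2 tendsto_mult_right)
        fix z
        have lz: "(\<lambda>n. x + z / s n) \<longlonglongrightarrow> x + 0"
          unfolding s_def by (intro tendsto_intros LIMSEQ_Suc lim_const_over_n)
        have "eventually (\<lambda>n. x + z / s n \<in> {x - 1<..<x + 1}) sequentially" using lz by (intro topological_tendstoD[OF lz]) auto
        then have "eventually (\<lambda>n. h (x + z / s n) = ?near (x + z / s n) * h (x + z / s n)) sequentially" by eventually_elim auto
        moreover have "(\<lambda>n. h (x + z / s n)) \<longlonglongrightarrow> h x"
          using lz cont by (intro isCont_tendsto_compose[of _ h]) (auto simp: continuous_on_eq_continuous_at)
        ultimately show "(\<lambda>n. ?near (x + z / s n) * h (x + z / s n)) \<longlonglongrightarrow> h x"
          by (rule Lim_transform_eventually[rotated])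
      qed
      show "AE z in lborel. norm (?near (x + z / s n) * h (x + z / s n) * exp (- z\<^sup>2 / 2)) \<le> B * exp (- z\<^sup>2 / 2)" for n
        using B \<open>0 \<le> B\<close> by (intro AE_I2) (auto simp: abs_mult indicator_def intro!: mult_right_mono)
    qed measurable
    also have "(LINT z|lborel. h x * exp (- z\<^sup>2 / 2)) = sqrt (2 * pi) * h x" using gaussian_integral by simp
    finally show ?thesis unfolding * .
  qed
  have far: "(\<lambda>n. LINT y|lborel. ?far y * G n y) \<longlonglongrightarrow> 0"
  proof (rule Lim_null_comparison)
    let ?w = "\<lambda>y. \<bar>h y * exp (- (1 / sqrt 2 * (y - x))\<^sup>2 / 2)\<bar>"
    have iw: "integrable lborel ?w" by (intro integrable_abs integrable_L2_mult[OF h] gaussian_Lp_2(2)) auto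
    have le: "norm (?far y * G n y) \<le> (s n * exp (- (s n)\<^sup>2 / 4)) * ?w y" for n y
    proof (cases "y \<in> {x - 1..x + 1}")
      case False
      then have 1: "1 \<le> (x - y)\<^sup>2"
        by (metis abs_le_square_iff abs_one atLeastAtMost_iff abs_le_iff diff_le_eq linear minus_diff_eq one_power2 add.commute diff_add_cancel le_diff_eq)
      have 2: "1 \<le> (s n)\<^sup>2" using s[of n] by (simp add: power2_eq_square mult_ge1_I)
      \<comment> \<open>Equivalent to 2 a^2 s^2 \<ge> s^2 + a^2 with a = x - y, valid since both
        squares are at least 1; it separates the exponent into a part in s and a part in y.\<close>
      have "0 \<le> ((x - y)\<^sup>2 - 1) * (s n)\<^sup>2 + ((s n)\<^sup>2 - 1) * (x - y)\<^sup>2"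
        using 1 2 by (intro add_nonneg_nonneg mult_nonneg_nonneg) auto
      then have "exp (- ((x - y) * s n)\<^sup>2 / 2) \<le> exp (- (s n)\<^sup>2 / 4) * exp (- (1 / sqrt 2 * (y - x))\<^sup>2 / 2)"
        unfolding exp_add[symmetric] exp_le_cancel_iff unfolding power_mult_distrib power_divide power2_commute[of y x] by (simp add: algebra_simps)
      then have "\<bar>h y\<bar> * s n * exp (- ((x - y) * s n)\<^sup>2 / 2) \<le> \<bar>h y\<bar> * s n * (exp (- (s n)\<^sup>2 / 4) * exp (- (1 / sqrt 2 * (y - x))\<^sup>2 / 2))"
        using s0[of n] by (intro mult_left_mono) auto
      then show ?thesis using False s0[of n] by (simp add: G_def abs_mult mult_ac)
    qed (use s0[of n] in auto)
    show "\<forall>\<^sub>F n in sequentially. norm (LINT y|lborel. ?far y * G n y) \<le> (s n * exp (- (s n)\<^sup>2 / 4)) * (LINT y|lborel. ?w y)"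
    proof (intro always_eventually allI)
      fix n
      have "norm (LINT y|lborel. ?far y * G n y) \<le> (LINT y|lborel. norm (?far y * G n y))" by (rule integral_norm_bound)
      also have "\<dots> \<le> (LINT y|lborel. (s n * exp (- (s n)\<^sup>2 / 4)) * ?w y)"
        by (intro Bochner_Integration.integral_mono le integrable_mult_right iw integrable_norm)
          (use integrable_mult_indicator[OF _ iG, of "- {x - 1..x + 1}"] in auto)
      finally show "norm (LINT y|lborel. ?far y * G n y) \<le> (s n * exp (- (s n)\<^sup>2 / 4)) * (LINT y|lborel. ?w y)" by simp
    qed
    have "((\<lambda>z::real. z * exp (- z\<^sup>2 / 4)) \<longlongrightarrow> 0) at_top" by real_asymp
    then have "(\<lambda>n. s n * exp (- (s n)\<^sup>2 / 4)) \<longlonglongrightarrow> 0"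
      unfolding s_def
      by (rule filterlim_compose) (intro filterlim_compose[OF filterlim_real_sequentially filterlim_Suc])
    then show "(\<lambda>n. (s n * exp (- (s n)\<^sup>2 / 4)) * (LINT y|lborel. ?w y)) \<longlonglongrightarrow> 0"
      by (intro tendsto_mult_left_zero)
  qed
  have "(LINT y|lborel. G n y) = (LINT y|lborel. ?near y * G n y) + (LINT y|lborel. ?far y * G n y)" for n
  proof -
    have "integrable lborel (\<lambda>y. ?near y * G n y)" "integrable lborel (\<lambda>y. ?far y * G n y)"
      using integrable_mult_indicator[OF _ iG, of "- {x - 1..x + 1}"] integrable_mult_indicator[OF _ iG, of "{x - 1..x + 1}"] by auto
    then show ?thesis
      by (subst Bochner_Integration.integral_add[symmetric]) (auto intro!: Bochner_Integration.integral_cong simp: indicator_def simp del: Bochner_Integration.integral_add)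
  qed
  then show ?thesis using tendsto_add[OF near far] unfolding G_def s_def by simp
qed

text \<open>Let the width tend to 0 in the regularised formula, with |F| as dominating function. The
  factor 2 pi is a product of two factors sqrt(2 pi): one from the transform of the Gaussian, one
  from its mass.\<close>

lemma fourier_inversion:
  assumes hF: "is_fourier h F" and F: "integrable lborel F" and cont: "continuous_on UNIV h"
  shows "complex_of_real (2 * pi * h x) = (LINT \<xi>|lborel. F \<xi> * cis (x * \<xi>))"
proof -
  have h: "h \<in> Lp 2" using hF by (simp add: is_fourier_def)
  define e where "e n = 1 / real (Suc n)" for n
  have e: "0 < e n" for n by (simp add: e_def)
  have [measurable]: "F \<in> borel_measurable lborel" using F by auto
  have 1: "(\<lambda>n. LINT \<xi>|lborel. F \<xi> * (complex_of_real (exp (- (e n * \<xi>)\<^sup>2 / 2)) * cis (x * \<xi>))) \<longlonglongrightarrow> (LINT \<xi>|lborel. F \<xi> * (1 * cis (x * \<xi>)))"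
  proof (rule integral_dominated_convergence[where w="\<lambda>\<xi>. norm (F \<xi>)"])
    have "(\<lambda>n. complex_of_real (exp (- (e n * \<xi>)\<^sup>2 / 2))) \<longlonglongrightarrow> complex_of_real (exp (- (0 * \<xi>)\<^sup>2 / 2))" for \<xi>
      unfolding e_def by (intro tendsto_intros LIMSEQ_Suc lim_const_over_n) auto
    then show "AE \<xi> in lborel. (\<lambda>n. F \<xi> * (complex_of_real (exp (- (e n * \<xi>)\<^sup>2 / 2)) * cis (x * \<xi>))) \<longlonglongrightarrow> F \<xi> * (1 * cis (x * \<xi>))"
      by (intro AE_I2 tendsto_mult tendsto_const) simp
    show "AE \<xi> in lborel. norm (F \<xi> * (complex_of_real (exp (- (e n * \<xi>)\<^sup>2 / 2)) * cis (x * \<xi>))) \<le> norm (F \<xi>)" for n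
      by (intro AE_I2) (auto simp: norm_mult intro!: mult_left_le)
  qed (use F in \<open>auto intro: integrable_norm\<close>)
  have "(\<lambda>n. LINT y|lborel. h y * (sqrt (2 * pi) / e n * exp (- ((x - y) / e n)\<^sup>2 / 2))) \<longlonglongrightarrow> sqrt (2 * pi) * (sqrt (2 * pi) * h x)"
    using tendsto_mult_left[OF approx_identity_gaussian[OF h cont, of x], of "sqrt (2 * pi)"]
    unfolding integral_mult_right_zero[symmetric] e_def by (simp add: mult_ac)
  then have "(\<lambda>n. LINT \<xi>|lborel. F \<xi> * (complex_of_real (exp (- (e n * \<xi>)\<^sup>2 / 2)) * cis (x * \<xi>))) \<longlonglongrightarrow> complex_of_real (2 * pi * h x)"
    unfolding gaussian_inversion[OF hF e] by (intro tendsto_of_real) (simp add: mult.assoc[symmetric])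
  then show ?thesis using LIMSEQ_unique[OF 1] by simp
qed

section \<open>Sobolev embedding\<close>

lemma integrable_bessel_weight:
  assumes "1/2 < \<sigma>"
  shows "integrable lborel (\<lambda>\<xi>::real. (1 + \<xi>\<^sup>2) powr (- \<sigma>))"
proof -
  \<comment> \<open>Outside [-1, 1] the weight is below this power, inside it is at most 1; the
    condition on \<sigma> is the convergence of the tail.\<close>
  let ?p = "\<lambda>\<xi>. indicator {1..} \<xi> * \<xi> powr (- 2 * \<sigma>) :: real"
  have "((\<lambda>x. x powr (- 2 * \<sigma>)) has_integral -(1 powr (- 2 * \<sigma> + 1)) / (- 2 * \<sigma> + 1)) {1..}"
    using assms by (intro has_integral_powr_to_inf) auto
  then have "((\<lambda>x. if x \<in> {1..} then x powr (- 2 * \<sigma>) else 0) has_integral -(1 powr (- 2 * \<sigma> + 1)) / (- 2 * \<sigma> + 1)) UNIV"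
    by (simp only: has_integral_restrict_UNIV)
  moreover have "(\<lambda>x. if x \<in> {1..} then x powr (- 2 * \<sigma>) else 0) = ?p" by (auto simp: indicator_def)
  ultimately have "(?p has_integral -(1 powr (- 2 * \<sigma> + 1)) / (- 2 * \<sigma> + 1)) UNIV" by (simp only:)
  from nn_integral_has_integral_lborel[OF _ _ this]
  have "(\<integral>\<^sup>+x. ennreal (?p x) \<partial>lborel) < \<infinity>" by simp
  then have p: "integrable lborel ?p" by (simp add: integrable_iff_bounded abs_mult)
  have p': "integrable lborel (\<lambda>\<xi>. ?p (- \<xi>))" using lborel_integrable_real_affine[OF p, of "-1" 0] by simp
  have i: "integrable lborel (indicat_real {-1..1::real})" by (intro integrable_real_indicator emeasure_bounded_finite) auto
  show ?thesis
  proof (rule Bochner_Integration.integrable_bound)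
    show "integrable lborel (\<lambda>\<xi>. indicat_real {-1..1} \<xi> + ?p \<xi> + ?p (- \<xi>))"
      by (intro Bochner_Integration.integrable_add i p p')
    show "AE \<xi> in lborel. norm ((1 + \<xi>\<^sup>2) powr (- \<sigma>)) \<le> norm (indicat_real {-1..1} \<xi> + ?p \<xi> + ?p (- \<xi>))"
    proof (intro AE_I2)
      fix \<xi> :: real
      have *: "(1 + \<xi>\<^sup>2) powr (- \<sigma>) \<le> \<bar>\<xi>\<bar> powr (- 2 * \<sigma>)" if "\<xi> \<noteq> 0"
      proof -
        have "(1 + \<xi>\<^sup>2) powr (- \<sigma>) \<le> (\<bar>\<xi>\<bar> powr 2) powr (- \<sigma>)"
          using that assms by (intro powr_mono2') (auto simp: powr_numeral)
        then show ?thesis by (simp only: powr_powr) simp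
      qed
      have **: "(1 + \<xi>\<^sup>2) powr (- \<sigma>) \<le> 1" using powr_mono2'[of "- \<sigma>" 1 "1 + \<xi>\<^sup>2"] assms by simp
      consider "\<xi> \<in> {-1..1}" | "1 < \<xi>" | "\<xi> < -1" by fastforce
      then show "norm ((1 + \<xi>\<^sup>2) powr (- \<sigma>)) \<le> norm (indicat_real {-1..1} \<xi> + ?p \<xi> + ?p (- \<xi>))"
      proof cases
        case 1
        have "0 \<le> ?p \<xi>" "0 \<le> ?p (- \<xi>)" "indicat_real {-1..1} \<xi> = 1" "0 \<le> (1 + \<xi>\<^sup>2) powr (- \<sigma>)"
          using 1 by simp_all
        then show ?thesis using ** unfolding real_norm_def by linarith
      next
        case 2 then show ?thesis using * by auto
      next
        case 3 then show ?thesis using * by auto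
      qed
    qed
  qed simp
qed

abbreviation bessel_weighted :: "real \<Rightarrow> (real \<Rightarrow> complex) \<Rightarrow> real \<Rightarrow> complex" where
  "bessel_weighted s F \<equiv> \<lambda>\<xi>. (1 + \<xi>\<^sup>2) powr (s / 2) *\<^sub>R F \<xi>"

text \<open>Cauchy-Schwarz against (1 + \<xi>^2)^((r - s) / 2), square integrable because s - r
  exceeds 1/2. The case r = 0 controls values of the function, r = 1 its derivative.\<close>

lemma weighted_fourier_L1_bound:
  assumes "1/2 < s - r"
  shows "\<exists>C>0. \<forall>F :: real \<Rightarrow> complex. F \<in> borel_measurable lborel \<longrightarrow>
    (\<integral>\<^sup>+\<xi>. ennreal ((1 + \<xi>\<^sup>2) powr (r / 2) * norm (F \<xi>)) \<partial>lborel)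
      \<le> ennreal C * Lp_norm 2 (bessel_weighted s F)"
proof -
  let ?k = "\<lambda>\<xi>::real. complex_of_real ((1 + \<xi>\<^sup>2) powr ((r - s) / 2))"
  have "(norm (?k \<xi>))\<^sup>2 = (1 + \<xi>\<^sup>2) powr (- (s - r))" for \<xi>
    by (simp add: power2_eq_square flip: powr_add)
  then have "?k \<in> Lp 2" using integrable_bessel_weight[OF assms] by (intro Lp_2_of_integrable_square) auto
  then obtain e where e: "0 \<le> e" "Lp_norm 2 ?k \<le> ennreal e" by (metis Lp_2_finiteE)
  show ?thesis
  \<comment> \<open>A positive constant is needed for its product with an infinite norm to be
    infinite; \<open>e\<close> alone could be 0.\<close>
  proof (intro exI[of _ "e + 1"] conjI allI impI)
    show "0 < e + 1" using e by simp
    fix F :: "real \<Rightarrow> complex" assume [measurable]: "F \<in> borel_measurable lborel"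
    let ?\<psi> = "bessel_weighted s F"
    show "(\<integral>\<^sup>+\<xi>. ennreal ((1 + \<xi>\<^sup>2) powr (r / 2) * norm (F \<xi>)) \<partial>lborel) \<le> ennreal (e + 1) * Lp_norm 2 ?\<psi>"
    proof (cases "Lp_norm 2 ?\<psi>")
      case (real b)
      have "norm (?k \<xi> * ?\<psi> \<xi>) = (1 + \<xi>\<^sup>2) powr (r / 2) * norm (F \<xi>)" for \<xi>
        by (simp add: norm_mult mult.assoc[symmetric] powr_add[symmetric] add_divide_distrib[symmetric])
      then have "(\<integral>\<^sup>+\<xi>. ennreal ((1 + \<xi>\<^sup>2) powr (r / 2) * norm (F \<xi>)) \<partial>lborel) \<le> ennreal (e * b)"
        using nn_integral_L2_mult[of ?k ?\<psi> e b] e real by simp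
      also have "\<dots> \<le> ennreal (e + 1) * ennreal b"
        using e real by (auto simp: ennreal_mult[symmetric] intro!: ennreal_leI mult_right_mono simp del: ennreal_plus)
      finally show ?thesis using real by simp
    next
      case top
      then show ?thesis using e by (simp add: ennreal_mult_top)
    qed
  qed
qed

text \<open>The Sobolev norm is an infimum over transforms, possibly over none. Multiplication by a
  positive real is invertible on extended numbers, so it commutes with this infimum and a bound for
  each transform suffices.\<close>

lemma le_mult_Hs_norm:
  assumes "0 < C" "\<And>F. is_fourier h F \<Longrightarrow> a \<le> ennreal C * Lp_norm 2 (bessel_weighted s F)"
  shows "a \<le> ennreal C * Hs_norm s h"
proof -
  have inv: "ennreal (1 / C) * (ennreal C * y) = y" "ennreal C * (ennreal (1 / C) * y) = y" for y
    using assms(1) by (simp_all add: mult.assoc[symmetric] ennreal_mult[symmetric])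
  have "ennreal (1 / C) * a \<le> Hs_norm s h"
    unfolding Hs_norm_def
    by (intro INF_greatest) (metis assms(2) inv(1) mem_Collect_eq mult_left_mono zero_le)
  then show ?thesis by (metis inv(2) mult_left_mono zero_le)
qed

text \<open>The mean value theorem bounds all difference quotients by the bound \<open>w\<close> for
  the derivatives; dominated convergence does the rest along sequences.\<close>

lemma has_real_derivative_integral:
  fixes f f' :: "real \<Rightarrow> 'a \<Rightarrow> real"
  assumes int: "\<And>y. integrable M (f y)"
    and der: "\<And>y \<xi>. ((\<lambda>y. f y \<xi>) has_real_derivative f' y \<xi>) (at y)"
    and bd: "\<And>y \<xi>. \<bar>f' y \<xi>\<bar> \<le> w \<xi>" and w: "integrable M w"
    and [measurable]: "f' x \<in> borel_measurable M"
  shows "((\<lambda>y. LINT \<xi>|M. f y \<xi>) has_real_derivative (LINT \<xi>|M. f' x \<xi>)) (at x)"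
  unfolding has_field_derivative_iff tendsto_at_iff_sequentially comp_def
proof (intro allI impI)
  fix X :: "nat \<Rightarrow> real" assume X: "\<forall>i. X i \<in> UNIV - {x}" "X \<longlonglongrightarrow> x"
  have [measurable]: "f y \<in> borel_measurable M" for y using int by auto
  have "(\<lambda>i. LINT \<xi>|M. (f (X i) \<xi> - f x \<xi>) / (X i - x)) \<longlonglongrightarrow> (LINT \<xi>|M. f' x \<xi>)"
  proof (rule integral_dominated_convergence[where w=w])
    show "AE \<xi> in M. (\<lambda>i. (f (X i) \<xi> - f x \<xi>) / (X i - x)) \<longlonglongrightarrow> f' x \<xi>"
      using der[of _ x] X unfolding has_field_derivative_iff tendsto_at_iff_sequentially comp_def by auto
    show "AE \<xi> in M. norm ((f (X i) \<xi> - f x \<xi>) / (X i - x)) \<le> w \<xi>" for i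
    proof (intro AE_I2)
      fix \<xi>
      have "norm (f (X i) \<xi> - f x \<xi>) \<le> w \<xi> * norm (X i - x)"
        by (rule field_differentiable_bound[of UNIV "\<lambda>y. f y \<xi>" "\<lambda>y. f' y \<xi>"])
          (use der bd in \<open>auto intro: has_field_derivative_at_within\<close>)
      then show "norm ((f (X i) \<xi> - f x \<xi>) / (X i - x)) \<le> w \<xi>" using X by (auto simp: divide_simps)
    qed
  qed (use w in auto)
  then show "(\<lambda>i. ((LINT \<xi>|M. f (X i) \<xi>) - (LINT \<xi>|M. f x \<xi>)) / (X i - x)) \<longlonglongrightarrow> (LINT \<xi>|M. f' x \<xi>)"
    using int by (simp add: Bochner_Integration.integral_diff)
qed

lemma continuous_on_integral_dominated:
  fixes f :: "real \<Rightarrow> 'a \<Rightarrow> real"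
  assumes "\<And>\<xi>. continuous_on UNIV (\<lambda>y. f y \<xi>)"
    and "\<And>y \<xi>. \<bar>f y \<xi>\<bar> \<le> w \<xi>" and w: "integrable M w"
    and [measurable]: "\<And>y. f y \<in> borel_measurable M"
  shows "continuous_on UNIV (\<lambda>y. LINT \<xi>|M. f y \<xi>)"
  unfolding continuous_on_sequentially comp_def
proof (intro allI ballI impI)
  fix X :: "nat \<Rightarrow> real" and x assume "(\<forall>n. X n \<in> UNIV) \<and> X \<longlonglongrightarrow> x"
  then have X: "X \<longlonglongrightarrow> x" by simp
  show "(\<lambda>n. LINT \<xi>|M. f (X n) \<xi>) \<longlonglongrightarrow> (LINT \<xi>|M. f x \<xi>)"
  proof (rule integral_dominated_convergence[where w=w])
    show "AE \<xi> in M. (\<lambda>i. f (X i) \<xi>) \<longlonglongrightarrow> f x \<xi>"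
      by (intro AE_I2 isCont_tendsto_compose[OF _ X]) (use assms(1) in \<open>simp add: continuous_on_eq_continuous_at\<close>)
  qed (use assms in auto)
qed

text \<open>Inversion bounds \<open>h\<close> by the L^1 norm of its transform. No membership is
  asked of \<open>h\<close>: outside the Sobolev space the right side is infinite.\<close>

lemma sobolev_sup_bound:
  assumes "1/2 < s"
  shows "\<exists>C>0. \<forall>h. continuous_on UNIV h \<longrightarrow> (\<forall>x. ennreal \<bar>h x\<bar> \<le> ennreal C * Hs_norm s h)"
proof -
  from weighted_fourier_L1_bound[of s 0] assms
  obtain C where "0 < C" and C: "\<And>F :: real \<Rightarrow> complex. F \<in> borel_measurable lborel \<Longrightarrow>
    (\<integral>\<^sup>+\<xi>. ennreal (norm (F \<xi>)) \<partial>lborel) \<le> ennreal C * Lp_norm 2 (bessel_weighted s F)"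
    by (auto simp: add_nonneg_eq_0_iff)
  show ?thesis
  proof (intro exI[of _ C] conjI allI impI le_mult_Hs_norm)
    fix h F x assume cont: "continuous_on UNIV h" and hF: "is_fourier h F"
    have [measurable]: "F \<in> borel_measurable lborel" using hF by (auto simp: is_fourier_def Lp_def)
    have "ennreal \<bar>h x\<bar> \<le> (\<integral>\<^sup>+\<xi>. ennreal (norm (F \<xi>)) \<partial>lborel)"
    proof (cases "(\<integral>\<^sup>+\<xi>. ennreal (norm (F \<xi>)) \<partial>lborel) = \<infinity>")
      case False
      then have F: "integrable lborel F" by (simp add: integrable_iff_bounded less_top)
      have "\<bar>h x\<bar> \<le> norm (complex_of_real (2 * pi * h x))"
        using pi_gt3 mult_right_mono[of 1 "2 * pi" "\<bar>h x\<bar>"] by (simp add: abs_mult norm_mult)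
      also have "\<dots> \<le> (LINT \<xi>|lborel. norm (F \<xi> * cis (x * \<xi>)))"
        unfolding fourier_inversion[OF hF F cont] by (rule integral_norm_bound)
      finally have "ennreal \<bar>h x\<bar> \<le> ennreal (LINT \<xi>|lborel. norm (F \<xi>))" by (intro ennreal_leI) (simp add: norm_mult)
      then show ?thesis using F by (subst nn_integral_eq_integral) auto
    qed simp
    also note C[OF \<open>F \<in> _\<close>]
    finally show "ennreal \<bar>h x\<bar> \<le> ennreal C * Lp_norm 2 (bessel_weighted s F)" .
  qed (use \<open>0 < C\<close> in auto)
qed

text \<open>Differentiation under the integral in the inversion formula. Real parts keep the
  integrand real; its derivative is dominated by twice the weighted modulus of \<open>F\<close>, and
  this 2 is absorbed by the factor 2 pi of the inversion.\<close>

lemma fourier_inversion_deriv: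
  assumes hF: "is_fourier h F" and cont: "continuous_on UNIV h"
    and F1: "integrable lborel (\<lambda>\<xi>. sqrt (1 + \<xi>\<^sup>2) * norm (F \<xi>))"
  defines "dh \<equiv> \<lambda>x. (LINT \<xi>|lborel. - \<xi> * (Re (F \<xi>) * sin (x * \<xi>) + Im (F \<xi>) * cos (x * \<xi>))) / (2 * pi)"
  shows "(h has_real_derivative dh x) (at x)" and "continuous_on UNIV dh"
    and "\<bar>dh x\<bar> \<le> (LINT \<xi>|lborel. sqrt (1 + \<xi>\<^sup>2) * norm (F \<xi>))"
proof -
  let ?N = "LINT \<xi>|lborel. sqrt (1 + \<xi>\<^sup>2) * norm (F \<xi>)"
  have [measurable]: "F \<in> borel_measurable lborel" using hF by (auto simp: is_fourier_def Lp_def)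
  have F: "integrable lborel F"
    by (rule Bochner_Integration.integrable_bound[OF F1]) (auto intro!: AE_I2 simp: abs_mult mult_ge1_I mult_le_cancel_right1)
  let ?K = "\<lambda>x \<xi>. Re (F \<xi> * cis (x * \<xi>))"
  let ?D = "\<lambda>x \<xi>. - \<xi> * (Re (F \<xi>) * sin (x * \<xi>) + Im (F \<xi>) * cos (x * \<xi>))"
  let ?w = "\<lambda>\<xi>. 2 * (sqrt (1 + \<xi>\<^sup>2) * norm (F \<xi>))"
  have iFc: "integrable lborel (\<lambda>\<xi>. F \<xi> * cis (x * \<xi>))" for x
    by (rule Bochner_Integration.integrable_bound[OF F]) (auto simp: norm_mult)
  have hK: "h x = (LINT \<xi>|lborel. ?K x \<xi>) / (2 * pi)" for x
  proof -
    have "2 * pi * h x = Re (LINT \<xi>|lborel. F \<xi> * cis (x * \<xi>))"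
      using arg_cong[OF fourier_inversion[OF hF F cont, of x], of Re] by (simp only: Re_complex_of_real)
    then show ?thesis unfolding integral_Re[OF iFc] by (simp add: field_simps)
  qed
  have Dw: "\<bar>?D x \<xi>\<bar> \<le> ?w \<xi>" for x \<xi>
  proof -
    have 1: "\<bar>\<xi>\<bar> \<le> sqrt (1 + \<xi>\<^sup>2)" by (simp add: real_le_rsqrt)
    have "\<bar>Re (F \<xi>) * sin (x * \<xi>)\<bar> \<le> norm (F \<xi>) * 1" "\<bar>Im (F \<xi>) * cos (x * \<xi>)\<bar> \<le> norm (F \<xi>) * 1"
      unfolding abs_mult by (intro mult_mono abs_Re_le_cmod abs_Im_le_cmod abs_sin_le_one abs_cos_le_one; simp)+
    then have 2: "\<bar>Re (F \<xi>) * sin (x * \<xi>) + Im (F \<xi>) * cos (x * \<xi>)\<bar> \<le> 2 * norm (F \<xi>)" by linarith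
    have "\<bar>?D x \<xi>\<bar> = \<bar>\<xi>\<bar> * \<bar>Re (F \<xi>) * sin (x * \<xi>) + Im (F \<xi>) * cos (x * \<xi>)\<bar>"
      by (simp add: abs_mult)
    also have "\<dots> \<le> sqrt (1 + \<xi>\<^sup>2) * (2 * norm (F \<xi>))" by (intro mult_mono 1 2) auto
    finally show ?thesis by simp
  qed
  have w: "integrable lborel ?w" using F1 by simp
  have "((\<lambda>x. LINT \<xi>|lborel. ?K x \<xi>) has_real_derivative (LINT \<xi>|lborel. ?D x \<xi>)) (at x)" for x
  proof (rule has_real_derivative_integral[OF _ _ Dw w])
    show "integrable lborel (?K y)" for y using iFc[of y] by (rule integrable_Re)
    show "((\<lambda>y. ?K y \<xi>) has_real_derivative ?D y \<xi>) (at y)" for y \<xi>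
      by (auto simp: algebra_simps intro!: derivative_eq_intros)
  qed simp
  from DERIV_cdivide[OF this, of "2 * pi"]
  show "(h has_real_derivative dh x) (at x)" unfolding dh_def hK[abs_def] by simp
  have "continuous_on UNIV (\<lambda>x. LINT \<xi>|lborel. ?D x \<xi>)"
    by (rule continuous_on_integral_dominated[OF _ Dw w]) (auto intro!: continuous_intros)
  then show "continuous_on UNIV dh" unfolding dh_def by (intro continuous_intros) auto
  have "\<bar>LINT \<xi>|lborel. ?D x \<xi>\<bar> \<le> (LINT \<xi>|lborel. \<bar>?D x \<xi>\<bar>)" by (rule integral_abs_bound)
  also have "\<dots> \<le> (LINT \<xi>|lborel. ?w \<xi>)"
    by (intro Bochner_Integration.integral_mono w Dw integrable_abs Bochner_Integration.integrable_bound[OF w])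
      (use Dw in \<open>auto intro!: AE_I2 order_trans[OF _ abs_ge_self]\<close>)
  also have "\<dots> = 2 * ?N" by (rule integral_mult_right_zero)
  finally have "\<bar>dh x\<bar> \<le> 2 * ?N / (2 * pi)" unfolding dh_def by (simp add: field_simps)
  also have "\<dots> \<le> ?N"
  proof -
    have "0 \<le> ?N" by (intro Bochner_Integration.integral_nonneg) simp
    moreover have "2 * z / (2 * pi) \<le> z" if "0 \<le> z" for z
      using that pi_gt3 mult_left_mono[of 1 pi z] by (simp add: field_simps)
    ultimately show ?thesis by blast
  qed
  finally show "\<bar>dh x\<bar> \<le> ?N" .
qed

lemma sobolev_C1:
  assumes "3/2 < s"
  shows "\<exists>C>0. \<forall>h. continuous_on UNIV h \<and> h \<in> Hs s \<longrightarrow>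
    (\<forall>x. h differentiable (at x)) \<and> continuous_on UNIV (deriv h) \<and>
    (\<forall>x. ennreal \<bar>deriv h x\<bar> \<le> ennreal C * Hs_norm s h)"
proof -
  have sq: "(1 + \<xi>\<^sup>2) powr (1/2) = sqrt (1 + \<xi>\<^sup>2)" for \<xi> :: real
    by (rule powr_half_sqrt) (simp add: add_nonneg_nonneg)
  from weighted_fourier_L1_bound[of s 1] assms
  obtain C where "0 < C" and C: "\<And>F :: real \<Rightarrow> complex. F \<in> borel_measurable lborel \<Longrightarrow>
    (\<integral>\<^sup>+\<xi>. ennreal (sqrt (1 + \<xi>\<^sup>2) * norm (F \<xi>)) \<partial>lborel) \<le> ennreal C * Lp_norm 2 (bessel_weighted s F)"
    unfolding sq by auto
  show ?thesis
  proof (intro exI[of _ C] conjI allI impI, fact)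
    fix h assume h: "continuous_on UNIV h \<and> h \<in> Hs s"
    then have cont: "continuous_on UNIV h" and "Hs_norm s h < \<infinity>" by (auto simp: Hs_def)
    \<comment> \<open>One transform of finite weighted norm is enough for differentiability; the
      estimate by the infimum has to treat every transform.\<close>
    then obtain F\<^sub>0 where F0: "is_fourier h F\<^sub>0" "Lp_norm 2 (bessel_weighted s F\<^sub>0) < \<infinity>"
      unfolding Hs_norm_def INF_less_iff by auto
    have int: "integrable lborel (\<lambda>\<xi>. sqrt (1 + \<xi>\<^sup>2) * norm (F \<xi>))"
      if "is_fourier h F" "Lp_norm 2 (bessel_weighted s F) < \<infinity>" for F
    proof -
      have [measurable]: "F \<in> borel_measurable lborel" using that by (auto simp: is_fourier_def Lp_def)
      have "(\<integral>\<^sup>+\<xi>. ennreal (sqrt (1 + \<xi>\<^sup>2) * norm (F \<xi>)) \<partial>lborel) < \<infinity>"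
        using C[of F] that by (auto simp: ennreal_mult_less_top elim!: le_less_trans)
      then show ?thesis by (simp add: integrable_iff_bounded abs_mult)
    qed
    note D = fourier_inversion_deriv[OF _ cont int]
    define dh where "dh = (\<lambda>x. (LINT \<xi>|lborel. - \<xi> * (Re (F\<^sub>0 \<xi>) * sin (x * \<xi>) + Im (F\<^sub>0 \<xi>) * cos (x * \<xi>))) / (2 * pi))"
    have d: "(h has_real_derivative dh x) (at x)" for x
      unfolding dh_def by (rule D(1)[OF F0(1) F0])
    then have eq: "deriv h = dh" by (auto intro: DERIV_imp_deriv)
    show "h differentiable (at x)" for x using d real_differentiable_def by blast
    show "continuous_on UNIV (deriv h)" unfolding eq dh_def by (rule D(2)[OF F0(1) F0])
    show "ennreal \<bar>deriv h x\<bar> \<le> ennreal C * Hs_norm s h" for x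
    proof (rule le_mult_Hs_norm[OF \<open>0 < C\<close>])
      fix F assume hF: "is_fourier h F"
      have [measurable]: "F \<in> borel_measurable lborel" using hF by (auto simp: is_fourier_def Lp_def)
      show "ennreal \<bar>deriv h x\<bar> \<le> ennreal C * Lp_norm 2 (bessel_weighted s F)"
      proof (cases "Lp_norm 2 (bessel_weighted s F) = \<infinity>")
        case True
        then show ?thesis using \<open>0 < C\<close> by (simp add: ennreal_mult_top)
      next
        case False
        then have fin: "Lp_norm 2 (bessel_weighted s F) < \<infinity>" by (simp add: less_top)
        have "\<bar>deriv h x\<bar> \<le> (LINT \<xi>|lborel. sqrt (1 + \<xi>\<^sup>2) * norm (F \<xi>))"
          unfolding DERIV_imp_deriv[OF D(1)[OF hF hF fin]] by (rule D(3)[OF hF hF fin])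
        then have "ennreal \<bar>deriv h x\<bar> \<le> (\<integral>\<^sup>+\<xi>. ennreal (sqrt (1 + \<xi>\<^sup>2) * norm (F \<xi>)) \<partial>lborel)"
          using int[OF hF fin] by (subst nn_integral_eq_integral) (auto intro: ennreal_leI)
        also note C[OF \<open>F \<in> _\<close>]
        finally show ?thesis .
      qed
    qed
  qed
qed

section \<open>The Helmholtz operator\<close>

lemma integrable_exp_abs: "integrable lborel (\<lambda>y::real. exp (- \<bar>y\<bar>))"
proof -
  let ?p = "\<lambda>y::real. exp (- y) * indicator {0..} y"
  have "(\<integral>\<^sup>+y. ennreal (exp (- y)) * indicator {0..} y \<partial>lborel) = ennreal (0 - (- exp (- 0)))"
  proof (rule nn_integral_FTC_atLeast)
    show "((\<lambda>y::real. - exp (- y)) \<longlongrightarrow> 0) at_top" by real_asymp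
  qed (auto intro!: derivative_eq_intros)
  then have p: "integrable lborel ?p" by (simp add: integrable_iff_bounded abs_mult ennreal_mult' ennreal_indicator)
  have p': "integrable lborel (\<lambda>y. ?p (- y))" using lborel_integrable_real_affine[OF p, of "-1" 0] by simp
  show ?thesis
    by (rule Bochner_Integration.integrable_bound[OF Bochner_Integration.integrable_add[OF p p']])
      (auto simp: indicator_def)
qed

lemma integrable_exp_abs_shift: "integrable lborel (\<lambda>y::real. exp (- \<bar>x - y\<bar>))"
  using lborel_integrable_real_affine[OF integrable_exp_abs, of "-1" x] by (simp add: algebra_simps)

lemma integral_exp_abs_shift: "(LINT y|lborel. exp (- \<bar>x - y\<bar>)) = (LINT y|lborel. exp (- \<bar>y::real\<bar>))"
  using lborel_integral_real_affine[of "-1" "\<lambda>y. exp (- \<bar>y\<bar>)" x] by (simp add: algebra_simps)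

lemma integrable_exp_kernel:
  fixes K h :: "real \<Rightarrow> real"
  assumes [measurable]: "K \<in> borel_measurable borel" "h \<in> borel_measurable borel"
    and K: "\<And>z. \<bar>K z\<bar> \<le> exp (- \<bar>z\<bar>)" and h: "\<And>y. \<bar>h y\<bar> \<le> H"
  shows "integrable lborel (\<lambda>y. K (x - y) * h y)"
proof (rule Bochner_Integration.integrable_bound[where f="\<lambda>y. exp (- \<bar>x - y\<bar>) * H"])
  show "integrable lborel (\<lambda>y. exp (- \<bar>x - y\<bar>) * H)" using integrable_exp_abs_shift by simp
  show "AE y in lborel. norm (K (x - y) * h y) \<le> norm (exp (- \<bar>x - y\<bar>) * H)"
  proof (intro AE_I2)
    fix y
    have "\<bar>K (x - y)\<bar> * \<bar>h y\<bar> \<le> exp (- \<bar>x - y\<bar>) * \<bar>H\<bar>"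
      by (intro mult_mono K order_trans[OF h abs_ge_self]) auto
    then show "norm (K (x - y) * h y) \<le> norm (exp (- \<bar>x - y\<bar>) * H)" by (simp add: abs_mult)
  qed
qed measurable

text \<open>Sup norm continuity of the convolution. The common bound \<open>H\<close> serves only to
  make the two integrals exist; taking one function to be 0 also yields boundedness.\<close>

lemma convolution_diff_bound:
  fixes K h\<^sub>1 h\<^sub>2 :: "real \<Rightarrow> real"
  assumes [measurable]: "K \<in> borel_measurable borel" "h\<^sub>1 \<in> borel_measurable borel" "h\<^sub>2 \<in> borel_measurable borel"
    and K: "\<And>z. \<bar>K z\<bar> \<le> exp (- \<bar>z\<bar>)" and h: "\<And>y. \<bar>h\<^sub>1 y\<bar> \<le> H" "\<And>y. \<bar>h\<^sub>2 y\<bar> \<le> H"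
    and e: "\<And>y. \<bar>h\<^sub>1 y - h\<^sub>2 y\<bar> \<le> e"
  shows "\<bar>Defs.convolution K h\<^sub>1 x - Defs.convolution K h\<^sub>2 x\<bar> \<le> e * (LINT y|lborel. exp (- \<bar>y::real\<bar>))"
proof -
  have i: "integrable lborel (\<lambda>y. K (x - y) * h\<^sub>1 y)" "integrable lborel (\<lambda>y. K (x - y) * h\<^sub>2 y)"
    by (intro integrable_exp_kernel[where H=H] assms)+
  have "\<bar>Defs.convolution K h\<^sub>1 x - Defs.convolution K h\<^sub>2 x\<bar> = \<bar>LINT y|lborel. K (x - y) * (h\<^sub>1 y - h\<^sub>2 y)\<bar>"
    using i by (simp add: Defs.convolution_def right_diff_distrib)
  also have "\<dots> \<le> (LINT y|lborel. \<bar>K (x - y) * (h\<^sub>1 y - h\<^sub>2 y)\<bar>)" by (rule integral_abs_bound)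
  also have "\<dots> \<le> (LINT y|lborel. exp (- \<bar>x - y\<bar>) * e)"
  proof (rule Bochner_Integration.integral_mono)
    show "integrable lborel (\<lambda>y. \<bar>K (x - y) * (h\<^sub>1 y - h\<^sub>2 y)\<bar>)" using i by (simp add: right_diff_distrib)
    show "integrable lborel (\<lambda>y. exp (- \<bar>x - y\<bar>) * e)" using integrable_exp_abs_shift by simp
    show "\<bar>K (x - y) * (h\<^sub>1 y - h\<^sub>2 y)\<bar> \<le> exp (- \<bar>x - y\<bar>) * e" for y
      unfolding abs_mult by (intro mult_mono K e) auto
  qed
  finally show ?thesis by (simp add: integral_exp_abs_shift mult.commute)
qed

text \<open>The exponential decays to the left and \<open>h\<close> is bounded, so the improper
  integral converges; beyond a fixed base point it is an ordinary indefinite integral of a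
  continuous function.\<close>

lemma half_line_integral_deriv:
  fixes h :: "real \<Rightarrow> real"
  assumes cont: "continuous_on UNIV h" and h: "\<And>y. \<bar>h y\<bar> \<le> H"
  defines "G \<equiv> \<lambda>x. LINT y|lborel. indicator {..<x} y * (exp y * h y)"
  shows "integrable lborel (\<lambda>y. indicator {..<x} y * (exp y * h y))"
    and "(G has_real_derivative exp x * h x) (at x)"
proof -
  have [measurable]: "h \<in> borel_measurable borel" using cont by (rule borel_measurable_continuous_onI)
  show int: "integrable lborel (\<lambda>y. indicator {..<x} y * (exp y * h y))" for x
  proof (rule Bochner_Integration.integrable_bound[where f="\<lambda>y. exp x * (exp (- \<bar>x - y\<bar>) * H)"])
    show "integrable lborel (\<lambda>y. exp x * (exp (- \<bar>x - y\<bar>) * H))" using integrable_exp_abs_shift by simp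
    show "AE y in lborel. norm (indicator {..<x} y * (exp y * h y)) \<le> norm (exp x * (exp (- \<bar>x - y\<bar>) * H))"
    proof (intro AE_I2)
      fix y
      have "exp y * \<bar>h y\<bar> \<le> exp x * (exp (- \<bar>x - y\<bar>) * \<bar>H\<bar>)" if "y < x"
        using that h[of y] unfolding mult.assoc[symmetric] exp_add[symmetric] by (intro mult_mono) auto
      then show "norm (indicator {..<x} y * (exp y * h y)) \<le> norm (exp x * (exp (- \<bar>x - y\<bar>) * H))"
        by (auto simp: indicator_def abs_mult)
    qed
  qed measurable
  let ?f = "\<lambda>y. exp y * h y"
  have cf: "continuous_on A ?f" for A
    by (intro continuous_intros continuous_on_subset[OF cont]) auto
  \<comment> \<open>One unit of room on each side makes \<open>x\<close> an interior point of the
    interval on which the fundamental theorem is applied.\<close>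
  define a where "a = x - 1"
  have eq: "G z = G a + (LBINT y=a..z. ?f y)" if "a \<le> z" for z
  proof -
    have "(LBINT y=a..z. ?f y) = (LINT y|lborel. indicator {..<z} y * ?f y - indicator {..<a} y * ?f y)"
      unfolding interval_integral_Ico[OF that] set_lebesgue_integral_def
      by (intro Bochner_Integration.integral_cong) (use that in \<open>auto simp: indicator_def\<close>)
    also have "\<dots> = G z - G a" unfolding G_def by (intro Bochner_Integration.integral_diff int)
    finally show ?thesis by simp
  qed
  have "((\<lambda>z. LBINT y=a..z. ?f y) has_vector_derivative ?f x) (at x within {a..x + 1})"
    by (rule interval_integral_FTC2) (auto simp: a_def cf)
  then have "((\<lambda>z. LBINT y=a..z. ?f y) has_real_derivative ?f x) (at x)"
    unfolding has_real_derivative_iff_has_vector_derivative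
    using at_within_interior[of x "{a..x + 1}"] by (simp add: a_def)
  then have "((\<lambda>z. G a + (LBINT y=a..z. ?f y)) has_real_derivative ?f x) (at x)" by (auto intro!: derivative_eq_intros)
  then show "(G has_real_derivative exp x * h x) (at x)"
    by (rule has_field_derivative_transform_within_open[of _ _ _ "{a<..}"]) (auto simp: eq[symmetric], auto simp: a_def)
qed

text \<open>\<open>\<partial>\<^sub>x\<^sup>2 \<Lambda>\<^sup>-\<^sup>2 = \<Lambda>\<^sup>-\<^sup>2 - 1\<close>: the kernel is split at its kink into two one-sided exponentials.\<close>

lemma dx_inv_Helmholtz_deriv:
  fixes h :: "real \<Rightarrow> real"
  assumes cont: "continuous_on UNIV h" and h: "\<And>y. \<bar>h y\<bar> \<le> H"
  shows "(dx_inv_Helmholtz h has_real_derivative Defs.convolution q_kernel h x - h x) (at x)"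
proof -
  have [measurable]: "h \<in> borel_measurable borel" using cont by (rule borel_measurable_continuous_onI)
  define G where "G = (\<lambda>x. LINT y|lborel. indicator {..<x} y * (exp y * h y))"
  \<comment> \<open>Reflection turns the right half line into a left one: \<open>R (- x)\<close> is
    the integral of exp(- y) h(y) over y > x, so one derivative lemma covers both halves.\<close>
  define R where "R = (\<lambda>x. LINT y|lborel. indicator {..<x} y * (exp y * h (- y)))"
  have cont': "continuous_on UNIV (\<lambda>y. h (- y))" by (intro continuous_on_compose2[OF cont] continuous_intros) auto
  note dG = half_line_integral_deriv[OF cont h, folded G_def]
  note dR = half_line_integral_deriv[OF cont', of H, OF h, folded R_def]
  have R: "R (- x) = (LINT y|lborel. indicator {x<..} y * (exp (- y) * h y))" for x
    using lborel_integral_real_affine[of "-1" "\<lambda>y. indicator {..<- x} y * (exp y * h (- y))" 0]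
    unfolding R_def by (simp add: indicator_def)
  have iR: "integrable lborel (\<lambda>y. indicator {x<..} y * (exp (- y) * h y))" for x
    using lborel_integrable_real_affine[OF dR(1), of "-1" "- x" 0] by (simp add: indicator_def)
  have P: "dx_inv_Helmholtz h x = exp x * R (- x) / 2 - exp (- x) * G x / 2" for x
  proof -
    have "dx_inv_Helmholtz h x = (LINT y|lborel. exp x / 2 * (indicator {x<..} y * (exp (- y) * h y)) - exp (- x) / 2 * (indicator {..<x} y * (exp y * h y)))"
      unfolding dx_inv_Helmholtz_def Defs.convolution_def
      by (intro Bochner_Integration.integral_cong)
        (auto simp: indicator_def q_kernel_def sgn_real_def exp_diff exp_minus field_simps)
    also have "\<dots> = exp x / 2 * R (- x) - exp (- x) / 2 * G x"
      unfolding R unfolding G_def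
      by (subst Bochner_Integration.integral_diff) (intro integrable_mult_right iR dG(1) integral_mult_right_zero | simp)+
    finally show ?thesis by simp
  qed
  have Q: "Defs.convolution q_kernel h x = exp x * R (- x) / 2 + exp (- x) * G x / 2" for x
  proof -
    have "Defs.convolution q_kernel h x = (LINT y|lborel. exp x / 2 * (indicator {x<..} y * (exp (- y) * h y)) + exp (- x) / 2 * (indicator {..<x} y * (exp y * h y)))"
      unfolding Defs.convolution_def
    \<comment> \<open>At y = x both indicators vanish while \<open>q_kernel 0\<close> is 1/2, so the
      integrands agree only almost everywhere; for the odd kernel above, \<open>sgn 0 = 0\<close>
      made them agree everywhere.\<close>
    proof (rule integral_cong_AE)
      show "AE y in lborel. q_kernel (x - y) * h y = exp x / 2 * (indicator {x<..} y * (exp (- y) * h y)) + exp (- x) / 2 * (indicator {..<x} y * (exp y * h y))"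
        using AE_lborel_singleton[of x]
        by eventually_elim (auto simp: indicator_def q_kernel_def exp_diff exp_minus field_simps)
    qed (auto simp: q_kernel_def)
    also have "\<dots> = exp x / 2 * R (- x) + exp (- x) / 2 * G x"
      unfolding R unfolding G_def
      by (subst Bochner_Integration.integral_add) (intro integrable_mult_right iR dG(1) integral_mult_right_zero | simp)+
    finally show ?thesis by simp
  qed
  have eq: "dx_inv_Helmholtz h = (\<lambda>x. exp x * R (- x) / 2 - exp (- x) * G x / 2)" using P by auto
  have "((\<lambda>x. R (- x)) has_real_derivative - (exp (- x) * h x)) (at x)"
    using DERIV_chain2[of R _ uminus x "-1" UNIV, OF dR(2)[of "- x"]]
    DERIV_minus[OF DERIV_ident, of x UNIV] by simp
  then show ?thesis
    unfolding eq Q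
    by (auto intro!: derivative_eq_intros dG(2) simp: field_simps exp_minus)
qed

lemma q_kernel_measurable [measurable]: "q_kernel \<in> borel_measurable borel" unfolding q_kernel_def by measurable

lemma sgn_q_kernel_measurable [measurable]: "(\<lambda>z. - sgn z * q_kernel z) \<in> borel_measurable borel" by measurable

lemma q_kernel_le: "\<bar>q_kernel z\<bar> \<le> exp (- \<bar>z\<bar>)" "\<bar>- sgn z * q_kernel z\<bar> \<le> exp (- \<bar>z\<bar>)"
  by (auto simp: q_kernel_def abs_mult sgn_real_def)

section \<open>Classical regularity of the solution\<close>

text \<open>Continuous maps from \<open>[0, T]\<close> to the bounded continuous functions with the supremum norm.\<close>

definition time_continuous :: "real \<Rightarrow> (real \<Rightarrow> real \<Rightarrow> real) \<Rightarrow> bool" where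
  "time_continuous T u \<longleftrightarrow> (\<forall>t\<in>{0..T}. continuous_on UNIV (u t)) \<and>
     (\<forall>t\<in>{0..T}. uniform_limit UNIV u (u t) (at t within {0..T})) \<and>
     (\<exists>B. \<forall>t\<in>{0..T}. \<forall>x. \<bar>u t x\<bar> \<le> B)"

lemma time_continuousD:
  assumes "time_continuous T u"
  shows "t \<in> {0..T} \<Longrightarrow> continuous_on UNIV (u t)"
    and "t \<in> {0..T} \<Longrightarrow> uniform_limit UNIV u (u t) (at t within {0..T})"
    and "\<exists>B\<ge>0. \<forall>t\<in>{0..T}. \<forall>x. \<bar>u t x\<bar> \<le> B"
proof -
  obtain B where "\<forall>t\<in>{0..T}. \<forall>x. \<bar>u t x\<bar> \<le> B" using assms by (auto simp: time_continuous_def)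
  then show "\<exists>B\<ge>0. \<forall>t\<in>{0..T}. \<forall>x. \<bar>u t x\<bar> \<le> B"
    by (intro exI[of _ "\<bar>B\<bar>"]) (auto intro: order_trans[OF _ abs_ge_self])
qed (use assms in \<open>auto simp: time_continuous_def\<close>)

text \<open>A bound at each single time suffices: uniform convergence with tolerance 1 extends it to
  a neighbourhood of that time, and finitely many of these cover the compact interval.\<close>

lemma time_continuousI:
  assumes cont: "\<And>t. t \<in> {0..T} \<Longrightarrow> continuous_on UNIV (u t)"
    and lim: "\<And>t. t \<in> {0..T} \<Longrightarrow> uniform_limit UNIV u (u t) (at t within {0..T})"
    and bd: "\<And>t. t \<in> {0..T} \<Longrightarrow> \<exists>B. \<forall>x. \<bar>u t x\<bar> \<le> B"
  shows "time_continuous T u"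
proof -
  from bd have "\<forall>t\<in>{0..T}. \<exists>B. \<forall>x. \<bar>u t x\<bar> \<le> B" by blast
  then obtain B where B: "\<And>t x. t \<in> {0..T} \<Longrightarrow> \<bar>u t x\<bar> \<le> B t" unfolding bchoice_iff by blast
  have "\<forall>t\<in>{0..T}. \<exists>d>0. \<forall>\<tau>\<in>{0..T}. dist \<tau> t < d \<longrightarrow> (\<forall>x. \<bar>u \<tau> x\<bar> \<le> B t + 1)"
  proof
    fix t assume t: "t \<in> {0..T}"
    from uniform_limitD[OF lim[OF t], of 1]
    obtain d where d: "0 < d" "\<And>\<tau> x. \<tau> \<in> {0..T} \<Longrightarrow> \<tau> \<noteq> t \<Longrightarrow> dist \<tau> t < d \<Longrightarrow> dist (u \<tau> x) (u t x) < 1"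
      unfolding eventually_at by auto
    have "\<bar>u \<tau> x\<bar> \<le> B t + 1" if "\<tau> \<in> {0..T}" "dist \<tau> t < d" for \<tau> x
      using d(2)[of \<tau> x] that B[OF t, of x] by (cases "\<tau> = t") (auto simp: dist_real_def)
    then show "\<exists>d>0. \<forall>\<tau>\<in>{0..T}. dist \<tau> t < d \<longrightarrow> (\<forall>x. \<bar>u \<tau> x\<bar> \<le> B t + 1)" using d(1) by blast
  qed
  then obtain d where d: "\<And>t. t \<in> {0..T} \<Longrightarrow> 0 < d t"
    "\<And>t \<tau> x. t \<in> {0..T} \<Longrightarrow> \<tau> \<in> {0..T} \<Longrightarrow> dist \<tau> t < d t \<Longrightarrow> \<bar>u \<tau> x\<bar> \<le> B t + 1"
    unfolding bchoice_iff by blast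
  have "{0..T} \<subseteq> (\<Union>t\<in>{0..T}. ball t (d t))" using d(1) by force
  then obtain D where D: "D \<subseteq> {0..T}" "finite D" "{0..T} \<subseteq> (\<Union>t\<in>D. ball t (d t))"
    using compactE_image[OF compact_Icc, of "{0..T}" "\<lambda>t. ball t (d t)"] by (metis open_ball)
  have "\<bar>u \<tau> x\<bar> \<le> (\<Sum>t\<in>D. \<bar>B t\<bar> + 1)" if \<tau>: "\<tau> \<in> {0..T}" for \<tau> x
  proof -
    obtain t where t: "t \<in> D" "dist \<tau> t < d t" using D(3) \<tau> by (auto simp: dist_commute)
    have "\<bar>u \<tau> x\<bar> \<le> \<bar>B t\<bar> + 1" using d(2)[of t \<tau> x] t D(1) \<tau> by fastforce
    also have "\<dots> \<le> (\<Sum>t\<in>D. \<bar>B t\<bar> + 1)" using t D(2) by (intro member_le_sum) auto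
    finally show ?thesis .
  qed
  then show ?thesis using cont lim unfolding time_continuous_def by blast
qed

lemma time_continuous_joint:
  assumes "time_continuous T u"
  shows "continuous_on ({0..T} \<times> UNIV) (\<lambda>(t, x). u t x)"
  unfolding continuous_on_iff
proof (intro ballI allI impI)
  fix p :: "real \<times> real" and e :: real assume p: "p \<in> {0..T} \<times> UNIV" and e: "0 < e"
  obtain t x where [simp]: "p = (t, x)" by fastforce
  have t: "t \<in> {0..T}" using p by simp
  from uniform_limitD[OF time_continuousD(2)[OF assms t], of "e/2"] e
  obtain d1 where d1: "0 < d1" "\<And>\<tau> x. \<tau> \<in> {0..T} \<Longrightarrow> \<tau> \<noteq> t \<Longrightarrow> dist \<tau> t < d1 \<Longrightarrow> dist (u \<tau> x) (u t x) < e/2"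
    unfolding eventually_at by auto
  have "\<exists>d>0. \<forall>y. dist y x < d \<longrightarrow> dist (u t y) (u t x) < e/2"
    using time_continuousD(1)[OF assms t] e unfolding continuous_on_iff by (meson UNIV_I half_gt_zero)
  then obtain d2 where d2: "0 < d2" "\<And>y. dist y x < d2 \<Longrightarrow> dist (u t y) (u t x) < e/2" by blast
  show "\<exists>d>0. \<forall>p'\<in>{0..T} \<times> UNIV. dist p' p < d \<longrightarrow> dist (case p' of (t, x) \<Rightarrow> u t x) (case p of (t, x) \<Rightarrow> u t x) < e"
  proof (intro exI[of _ "min d1 d2"] conjI ballI impI)
    fix p' assume p': "p' \<in> {0..T} \<times> UNIV" "dist p' p < min d1 d2"
    obtain \<tau> y where [simp]: "p' = (\<tau>, y)" by fastforce
    have "dist \<tau> t < d1" "dist y x < d2" using p' dist_fst_le[of p' p] dist_snd_le[of p' p] by auto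
    then have "dist (u \<tau> y) (u t y) < e/2" "dist (u t y) (u t x) < e/2"
      using d1(2)[of \<tau> y] d2(2)[of y] p' e by (cases "\<tau> = t"; auto)+
    then show "dist (case p' of (t, x) \<Rightarrow> u t x) (case p of (t, x) \<Rightarrow> u t x) < e"
      using dist_triangle[of "u \<tau> y" "u t x" "u t y"] by simp
  qed (use d1 d2 in auto)
qed

lemma time_continuous_along:
  assumes "time_continuous T u" "continuous_on {0..T} \<gamma>"
  shows "continuous_on {0..T} (\<lambda>t. u t (\<gamma> t))"
proof -
  have "continuous_on {0..T} (\<lambda>t. (\<lambda>(t, x). u t x) (t, \<gamma> t))"
    by (rule continuous_on_compose2[OF time_continuous_joint[OF assms(1)]])
      (use assms(2) in \<open>auto intro!: continuous_intros\<close>)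
  then show ?thesis by simp
qed

lemma time_continuous_add:
  assumes "time_continuous T u" "time_continuous T v"
  shows "time_continuous T (\<lambda>t x. u t x + v t x)"
proof (rule time_continuousI)
  fix t assume t: "t \<in> {0..T}"
  obtain B C where "\<forall>t\<in>{0..T}. \<forall>x. \<bar>u t x\<bar> \<le> B" "\<forall>t\<in>{0..T}. \<forall>x. \<bar>v t x\<bar> \<le> C"
    using time_continuousD(3)[OF assms(1)] time_continuousD(3)[OF assms(2)] by blast
  then show "\<exists>B. \<forall>x. \<bar>u t x + v t x\<bar> \<le> B"
    using t by (intro exI[of _ "B + C"] allI order_trans[OF abs_triangle_ineq] add_mono) auto
  show "continuous_on UNIV (\<lambda>x. u t x + v t x)"
    by (intro continuous_on_add time_continuousD(1)[OF assms(1) t] time_continuousD(1)[OF assms(2) t])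
  show "uniform_limit UNIV (\<lambda>t x. u t x + v t x) (\<lambda>x. u t x + v t x) (at t within {0..T})"
    by (intro uniform_limit_add time_continuousD(2)[OF assms(1) t] time_continuousD(2)[OF assms(2) t])
qed

lemma time_continuous_mult:
  assumes "time_continuous T u" "time_continuous T v"
  shows "time_continuous T (\<lambda>t x. u t x * v t x)"
proof (rule time_continuousI)
  fix t assume t: "t \<in> {0..T}"
  obtain B C where BC: "\<forall>t\<in>{0..T}. \<forall>x. \<bar>u t x\<bar> \<le> B" "\<forall>t\<in>{0..T}. \<forall>x. \<bar>v t x\<bar> \<le> C"
    using time_continuousD(3)[OF assms(1)] time_continuousD(3)[OF assms(2)] by blast
  then have "0 \<le> B" using t by (meson abs_ge_zero order_trans)
  then show "\<exists>B. \<forall>x. \<bar>u t x * v t x\<bar> \<le> B"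
    unfolding abs_mult using t BC by (intro exI[of _ "B * C"] allI mult_mono) auto
  show "uniform_limit UNIV (\<lambda>t x. u t x * v t x) (\<lambda>x. u t x * v t x) (at t within {0..T})"
  proof (rule uniform_lim_mult)
    show "bounded (u t ` UNIV)" using t BC(1) by (auto intro!: boundedI[of _ B])
    show "bounded (v t ` UNIV)" using t BC(2) by (auto intro!: boundedI[of _ C])
  qed (intro time_continuousD(2)[OF assms(1) t] time_continuousD(2)[OF assms(2) t])+
  show "continuous_on UNIV (\<lambda>x. u t x * v t x)"
    by (intro continuous_on_mult time_continuousD(1)[OF assms(1) t] time_continuousD(1)[OF assms(2) t])
qed

text \<open>All values of \<open>u\<close> lie in one compact interval, on which \<open>F\<close> is
  bounded and uniformly continuous.\<close>

lemma time_continuous_compose: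
  fixes F :: "real \<Rightarrow> real"
  assumes u: "time_continuous T u" and F: "continuous_on UNIV F"
  shows "time_continuous T (\<lambda>t x. F (u t x))"
proof (rule time_continuousI)
  obtain B where "\<forall>t\<in>{0..T}. \<forall>x. \<bar>u t x\<bar> \<le> B"
    using time_continuousD(3)[OF u] by auto
  then have B: "\<And>t x. t \<in> {0..T} \<Longrightarrow> u t x \<in> {-B..B}" by (auto simp: abs_le_iff minus_le_iff)
  fix t assume t: "t \<in> {0..T}"
  show "continuous_on UNIV (\<lambda>x. F (u t x))" by (rule continuous_on_compose2[OF F time_continuousD(1)[OF u t]]) auto
  have FB: "continuous_on {-B..B} F" using F continuous_on_subset by blast
  from compact_imp_bounded[OF compact_continuous_image[OF FB compact_Icc]]
  obtain C where "\<forall>y\<in>{-B..B}. \<bar>F y\<bar> \<le> C" by (auto simp: bounded_iff)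
  then show "\<exists>B. \<forall>x. \<bar>F (u t x)\<bar> \<le> B" using B[OF t] by blast
  show "uniform_limit UNIV (\<lambda>t x. F (u t x)) (\<lambda>x. F (u t x)) (at t within {0..T})"
  proof (rule uniform_limitI)
    fix e :: real assume "0 < e"
    with compact_uniformly_continuous[OF FB compact_Icc]
    obtain d where d: "0 < d" "\<And>y z. y \<in> {-B..B} \<Longrightarrow> z \<in> {-B..B} \<Longrightarrow> dist z y < d \<Longrightarrow> dist (F z) (F y) < e"
      unfolding uniformly_continuous_on_def by metis
    have "\<forall>\<^sub>F \<tau> in at t within {0..T}. \<tau> \<in> {0..T}" by (auto simp: eventually_at_filter)
    with uniform_limitD[OF time_continuousD(2)[OF u t] d(1)]
    show "\<forall>\<^sub>F \<tau> in at t within {0..T}. \<forall>x\<in>UNIV. dist (F (u \<tau> x)) (F (u t x)) < e"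
      by eventually_elim (use d(2) B t in blast)
  qed
qed

text \<open>Continuity in space is left as a hypothesis because the two kernels obtain it
  differently: the odd one through differentiability, \<open>q_kernel\<close> by moving the
  translation onto the source.\<close>

lemma time_continuous_convolution:
  fixes K :: "real \<Rightarrow> real"
  assumes u: "time_continuous T u" and [measurable]: "K \<in> borel_measurable borel"
    and K: "\<And>z. \<bar>K z\<bar> \<le> exp (- \<bar>z\<bar>)"
    and cont: "\<And>t. t \<in> {0..T} \<Longrightarrow> continuous_on UNIV (Defs.convolution K (u t))"
  shows "time_continuous T (\<lambda>t. Defs.convolution K (u t))"
proof (rule time_continuousI)
  let ?k = "LINT y|lborel. exp (- \<bar>y::real\<bar>)"
  obtain B where "0 \<le> B" and B: "\<And>t x. t \<in> {0..T} \<Longrightarrow> \<bar>u t x\<bar> \<le> B"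
    using time_continuousD(3)[OF u] by auto
  have m: "u t \<in> borel_measurable borel" if "t \<in> {0..T}" for t
    using time_continuousD(1)[OF u that] by (rule borel_measurable_continuous_onI)
  fix t assume t: "t \<in> {0..T}"
  show "continuous_on UNIV (Defs.convolution K (u t))" by (rule cont[OF t])
  have "\<bar>Defs.convolution K (u t) x - Defs.convolution K (\<lambda>_. 0) x\<bar> \<le> B * ?k" for x
    by (rule convolution_diff_bound[where H=B]) (use K B t m \<open>0 \<le> B\<close> in auto)
  then show "\<exists>B. \<forall>x. \<bar>Defs.convolution K (u t) x\<bar> \<le> B" by (auto simp: Defs.convolution_def)
  have k0: "0 \<le> ?k" by (rule Bochner_Integration.integral_nonneg) simp
  show "uniform_limit UNIV (\<lambda>t. Defs.convolution K (u t)) (Defs.convolution K (u t)) (at t within {0..T})"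
  proof (rule uniform_limitI)
    fix e :: real assume e: "0 < e"
    \<comment> \<open>Adding 1 avoids proving that the mass of the kernel is positive.\<close>
    define d where "d = e / (?k + 1)"
    have d: "0 < d" using e k0 unfolding d_def by (intro divide_pos_pos add_nonneg_pos) auto
    have "0 < ?k + 1" using k0 by linarith
    then have *: "d * ?k < e" using e unfolding d_def times_divide_eq_left by (simp add: pos_divide_less_eq)
    have "\<forall>\<^sub>F \<tau> in at t within {0..T}. \<tau> \<in> {0..T}" by (auto simp: eventually_at_filter)
    with uniform_limitD[OF time_continuousD(2)[OF u t] d]
    show "\<forall>\<^sub>F \<tau> in at t within {0..T}. \<forall>x\<in>UNIV. dist (Defs.convolution K (u \<tau>) x) (Defs.convolution K (u t) x) < e"
    proof eventually_elim
      case (elim \<tau>)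
      have "\<bar>Defs.convolution K (u \<tau>) x - Defs.convolution K (u t) x\<bar> \<le> d * ?k" for x
        by (rule convolution_diff_bound[where H=B])
          (use K B t m elim in \<open>auto simp: dist_real_def less_imp_le\<close>)
      then show ?case using * by (auto simp: dist_real_def intro: le_less_trans)
    qed
  qed
qed

section \<open>From the equation in the Sobolev space to pointwise calculus\<close>

lemma smooth_has_derivative:
  assumes "smooth f"
  shows "(((deriv ^^ n) f) has_real_derivative (deriv ^^ Suc n) f x) (at x)"
proof -
  have "(deriv ^^ n) f differentiable (at x)" using assms unfolding smooth_def by blast
  then obtain D where "((deriv ^^ n) f has_real_derivative D) (at x)" by (auto simp: real_differentiable_def)
  then show ?thesis using DERIV_imp_deriv by fastforce
qed

lemma smooth_continuous:
  assumes "smooth f"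
  shows "continuous_on UNIV ((deriv ^^ n) f)"
  using smooth_has_derivative[OF assms] by (meson DERIV_isCont continuous_at_imp_continuous_on)

text \<open>The equation holds almost everywhere only, whereas the sup bound needs continuous
  functions; this lets a continuous representative be substituted.\<close>

lemma is_fourier_AE_cong:
  assumes hF: "is_fourier h F" and [measurable]: "h' \<in> borel_measurable lborel"
    and ae: "AE x in lborel. h x = h' x"
  shows "is_fourier h' F"
proof -
  have "h \<in> Lp 2" using hF by (simp add: is_fourier_def)
  then have [measurable]: "h \<in> borel_measurable lborel" by (simp add: Lp_def)
  have "(\<integral>\<^sup>+x. ennreal ((norm (h x))\<^sup>2) \<partial>lborel) = (\<integral>\<^sup>+x. ennreal ((norm (h' x))\<^sup>2) \<partial>lborel)"
    using ae by (intro nn_integral_cong_AE) auto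
  then have 1: "h' \<in> Lp 2" using \<open>h \<in> Lp 2\<close> by (simp add: Lp_2_iff)
  have "trunc_fourier h R \<xi> = trunc_fourier h' R \<xi>" for R \<xi>
    unfolding trunc_fourier_def set_lebesgue_integral_def
    by (rule integral_cong_AE) (use ae in auto)
  then show ?thesis using hF 1 by (simp add: is_fourier_def trunc_fourier_def)
qed

text \<open>Measurability of \<open>h\<close> comes with any transform it has; if it has none, its
  norm is an infimum over the empty set and the inequality is trivial.\<close>

lemma Hs_norm_AE_mono:
  assumes "h' \<in> borel_measurable lborel" "AE x in lborel. h x = h' x"
  shows "Hs_norm s h' \<le> Hs_norm s h"
  unfolding Hs_norm_def using is_fourier_AE_cong[OF _ assms] by (intro INF_superset_mono) auto

lemma ennreal_mult_less_imp:
  assumes "ennreal \<bar>a\<bar> \<le> ennreal C * b" "b < ennreal (e / C)" "0 < C" "0 < e"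
  shows "\<bar>a\<bar> < e"
proof -
  obtain r where r: "b = ennreal r" "0 \<le> r" using assms(2) by (cases b) auto
  then have "\<bar>a\<bar> \<le> C * r" using assms by (simp add: ennreal_le_iff flip: ennreal_mult)
  also have "C * r < e" using assms r by (simp add: ennreal_less_iff field_simps)
  finally show ?thesis .
qed

locale hs_solution =
  fixes f g :: "real \<Rightarrow> real" and T s :: real and u :: "real \<Rightarrow> real \<Rightarrow> real"
  assumes f: "smooth f" and g: "smooth g" and T: "0 < T" and s: "3/2 < s"
    and sol: "is_solution f g T s u"
begin

definition "source t y = g (u t y) + deriv (deriv f) (u t y) / 2 * (deriv (u t) y)\<^sup>2"

lemma u_cont: "t \<in> {0..T} \<Longrightarrow> continuous_on UNIV (u t)"
  and u_Hs: "t \<in> {0..T} \<Longrightarrow> u t \<in> Hs s"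
  and u_lim: "t \<in> {0..T} \<Longrightarrow> ((\<lambda>\<tau>. Hs_norm s (\<lambda>x. u \<tau> x - u t x)) \<longlongrightarrow> 0) (at t within {0..T})"
  using sol by (auto simp: is_solution_def C0_Hs_def)

lemma u_deriv: "t \<in> {0..T} \<Longrightarrow> (u t has_real_derivative deriv (u t) x) (at x)"
  using sobolev_C1[OF s] u_cont[of t] u_Hs[of t] by (auto simp: DERIV_deriv_iff_real_differentiable)

lemma eventually_in: "\<forall>\<^sub>F \<tau> in at t within {0..T}. \<tau> \<in> {0..T}" by (auto simp: eventually_at_filter)

text \<open>Common part of the arguments for \<open>u\<close> and its space derivative. Finiteness
  of the norm is offered to the difference estimate because the bound for a derivative requires the
  difference to lie in the Sobolev space.\<close>

lemma time_continuous_of_Hs_bound: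
  assumes "0 < C" and cont: "\<And>t. t \<in> {0..T} \<Longrightarrow> continuous_on UNIV (w t)"
    and bd: "\<And>t x. t \<in> {0..T} \<Longrightarrow> ennreal \<bar>w t x\<bar> \<le> ennreal C * Hs_norm s (u t)"
    and diff: "\<And>t \<tau> x. t \<in> {0..T} \<Longrightarrow> \<tau> \<in> {0..T} \<Longrightarrow> Hs_norm s (\<lambda>x. u \<tau> x - u t x) < \<infinity> \<Longrightarrow>
      ennreal \<bar>w \<tau> x - w t x\<bar> \<le> ennreal C * Hs_norm s (\<lambda>x. u \<tau> x - u t x)"
  shows "time_continuous T w"
proof (rule time_continuousI[OF cont])
  fix t assume t: "t \<in> {0..T}"
  have "Hs_norm s (u t) < \<infinity>" using u_Hs[OF t] by (simp add: Hs_def)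
  then have "ennreal \<bar>w t x\<bar> \<le> ennreal (C * enn2real (Hs_norm s (u t)))" for x
    using bd[OF t, of x] \<open>0 < C\<close> by (simp add: ennreal_mult less_top)
  then show "\<exists>B. \<forall>x. \<bar>w t x\<bar> \<le> B"
    using \<open>0 < C\<close> by (intro exI[of _ "C * enn2real (Hs_norm s (u t))"]) (simp add: ennreal_le_iff)
  show "uniform_limit UNIV w (w t) (at t within {0..T})"
  proof (rule uniform_limitI)
    fix e :: real assume e: "0 < e"
    then have "0 < ennreal (e / C)" using \<open>0 < C\<close> by simp
    from order_tendstoD(2)[OF u_lim[OF t] this] eventually_in[of t]
    show "\<forall>\<^sub>F \<tau> in at t within {0..T}. \<forall>x\<in>UNIV. dist (w \<tau> x) (w t x) < e"
    proof eventually_elim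
      case (elim \<tau>)
      then have "Hs_norm s (\<lambda>x. u \<tau> x - u t x) < \<infinity>" by (auto intro: less_le_trans)
      then show ?case
        using ennreal_mult_less_imp[OF diff[OF t elim(2)] elim(1) \<open>0 < C\<close> e] by (auto simp: dist_real_def)
    qed
  qed
qed

lemma time_continuous_u: "time_continuous T u"
proof -
  obtain C where "0 < C" and C: "\<And>h x. continuous_on UNIV h \<Longrightarrow> ennreal \<bar>h x\<bar> \<le> ennreal C * Hs_norm s h"
    using sobolev_sup_bound[of s] s by auto
  show ?thesis
    by (rule time_continuous_of_Hs_bound[OF \<open>0 < C\<close> u_cont C[OF u_cont]])
      (auto intro!: C continuous_intros u_cont)
qed

lemma time_continuous_ux: "time_continuous T (\<lambda>t. deriv (u t))"
proof -
  obtain C where "0 < C" and C: "\<And>h x. continuous_on UNIV h \<Longrightarrow> h \<in> Hs s \<Longrightarrow> ennreal \<bar>deriv h x\<bar> \<le> ennreal C * Hs_norm s h"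
    and C': "\<And>h. continuous_on UNIV h \<Longrightarrow> h \<in> Hs s \<Longrightarrow> continuous_on UNIV (deriv h)"
    using sobolev_C1[OF s] by metis
  show ?thesis
  proof (rule time_continuous_of_Hs_bound[OF \<open>0 < C\<close> C'[OF u_cont u_Hs] C[OF u_cont u_Hs]])
    fix t \<tau> x assume t: "t \<in> {0..T}" "\<tau> \<in> {0..T}" and fin: "Hs_norm s (\<lambda>x. u \<tau> x - u t x) < \<infinity>"
    have "deriv (\<lambda>x. u \<tau> x - u t x) x = deriv (u \<tau>) x - deriv (u t) x" by (intro DERIV_imp_deriv DERIV_diff u_deriv t)
    then show "ennreal \<bar>deriv (u \<tau>) x - deriv (u t) x\<bar> \<le> ennreal C * Hs_norm s (\<lambda>x. u \<tau> x - u t x)"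
      using C[OF continuous_on_diff[OF u_cont[OF t(2)] u_cont[OF t(1)]], of x] fin by (simp add: Hs_def)
  qed
qed

lemma time_continuous_source: "time_continuous T source"
proof -
  have 1: "time_continuous T (\<lambda>t x. g (u t x))"
    using time_continuous_compose[OF time_continuous_u smooth_continuous[OF g, of 0]] by simp
  have 2: "time_continuous T (\<lambda>t x. deriv (deriv f) (u t x) / 2)"
    using time_continuous_compose[OF time_continuous_u, of "\<lambda>y. (deriv ^^ 2) f y / 2"] smooth_continuous[OF f, of 2]
    by (simp add: numeral_2_eq_2 continuous_intros)
  have 3: "time_continuous T (\<lambda>t x. (deriv (u t) x)\<^sup>2)"
    by (rule time_continuous_compose[OF time_continuous_ux]) (intro continuous_intros)
  show ?thesis
    using time_continuous_add[OF 1 time_continuous_mult[OF 2 3]] by (simp add: source_def[abs_def])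
qed

lemma source_bound: "\<exists>H\<ge>0. \<forall>t\<in>{0..T}. \<forall>y. \<bar>source t y\<bar> \<le> H"
  by (rule time_continuousD(3)[OF time_continuous_source])

definition "P t = dx_inv_Helmholtz (source t)"
definition "Px t x = Defs.convolution q_kernel (source t) x - source t x"

lemma P_deriv: "t \<in> {0..T} \<Longrightarrow> (P t has_real_derivative Px t x) (at x)"
  unfolding P_def Px_def using source_bound time_continuousD(1)[OF time_continuous_source]
  by (auto intro!: dx_inv_Helmholtz_deriv)

lemma time_continuous_P: "time_continuous T P"
  unfolding P_def[abs_def] dx_inv_Helmholtz_def
proof (rule time_continuous_convolution[OF time_continuous_source sgn_q_kernel_measurable q_kernel_le(2)])
  fix t assume "t \<in> {0..T}"
  then have "continuous_on UNIV (P t)" using P_deriv by (meson DERIV_isCont continuous_at_imp_continuous_on)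
  then show "continuous_on UNIV (Defs.convolution (\<lambda>z. - sgn z * q_kernel z) (source t))"
    by (simp add: P_def[abs_def] dx_inv_Helmholtz_def[abs_def])
qed

text \<open>The substitution z = x - y moves the dependence on x from the kernel to the continuous
  bounded source, where dominated convergence applies.\<close>

lemma continuous_convolution_q:
  assumes t: "t \<in> {0..T}"
  shows "continuous_on UNIV (Defs.convolution q_kernel (source t))"
proof -
  obtain H where H: "\<And>y. \<bar>source t y\<bar> \<le> H" using source_bound t by blast
  have c: "continuous_on UNIV (source t)" by (rule time_continuousD(1)[OF time_continuous_source t])
  have [measurable]: "source t \<in> borel_measurable borel" using c by (rule borel_measurable_continuous_onI)
  have eq: "Defs.convolution q_kernel (source t) = (\<lambda>x. LINT z|lborel. q_kernel z * source t (x - z))"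
  proof
    fix x
    show "Defs.convolution q_kernel (source t) x = (LINT z|lborel. q_kernel z * source t (x - z))"
      using lborel_integral_real_affine[of "-1" "\<lambda>y. q_kernel (x - y) * source t y" x]
      by (simp add: Defs.convolution_def)
  qed
  show ?thesis unfolding eq
  proof (rule continuous_on_integral_dominated[where w="\<lambda>z. exp (- \<bar>z\<bar>) * H"])
    show "continuous_on UNIV (\<lambda>x. q_kernel z * source t (x - z))" for z
      by (intro continuous_intros continuous_on_compose2[OF c]) auto
    show "\<bar>q_kernel z * source t (x - z)\<bar> \<le> exp (- \<bar>z\<bar>) * H" for x z
      unfolding abs_mult by (intro mult_mono q_kernel_le H) auto
  qed (use integrable_exp_abs in auto)
qed

lemma time_continuous_Px: "time_continuous T Px"
proof -
  have 1: "time_continuous T (\<lambda>t. Defs.convolution q_kernel (source t))"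
    by (rule time_continuous_convolution[OF time_continuous_source q_kernel_measurable q_kernel_le(1) continuous_convolution_q])
  have 2: "time_continuous T (\<lambda>t x. - source t x)"
    by (rule time_continuous_compose[OF time_continuous_source]) (intro continuous_intros)
  show ?thesis using time_continuous_add[OF 1 2] by (simp add: Px_def[abs_def])
qed

text \<open>Prescribed by the equation instead of as a limit: this is the continuous function that
  agrees almost everywhere with the time derivative in the Sobolev space.\<close>

definition "ut t x = - (deriv f (u t x) * deriv (u t) x + P t x)"

lemma ut_cont: "t \<in> {0..T} \<Longrightarrow> continuous_on UNIV (ut t)"
  unfolding ut_def[abs_def]
  using smooth_continuous[OF f, of 1] time_continuousD(1)[OF time_continuous_P] time_continuousD(1)[OF time_continuous_ux]
  by (auto intro!: continuous_intros u_cont intro: continuous_on_compose2)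

text \<open>Since s - 1 exceeds 1/2, convergence of the difference quotients in the Sobolev space of
  order s - 1 is uniform convergence, once the abstract derivative \<open>w\<close> is replaced by
  the continuous \<open>ut t\<close>.\<close>

lemma u_time_derivative:
  assumes t: "t \<in> {0..T}"
  shows "uniform_limit UNIV (\<lambda>\<tau> x. (u \<tau> x - u t x) / (\<tau> - t)) (ut t) (at t within {0..T})"
proof (rule uniform_limitI)
  fix e :: real assume e: "0 < e"
  obtain C where "0 < C" and C: "\<And>h x. continuous_on UNIV h \<Longrightarrow> ennreal \<bar>h x\<bar> \<le> ennreal C * Hs_norm (s - 1) h"
    using sobolev_sup_bound[of "s - 1"] s by auto
  obtain w where lim: "((\<lambda>\<tau>. Hs_norm (s - 1) (\<lambda>x. (u \<tau> x - u t x) / (\<tau> - t) - w x)) \<longlongrightarrow> 0) (at t within {0..T})"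
    and eq: "AE x in lborel. w x + deriv f (u t x) * deriv (u t) x + P t x = 0"
    using sol t unfolding is_solution_def Hs_time_deriv_def P_def source_def[abs_def] by fastforce
  have w: "AE x in lborel. w x = ut t x" using eq by eventually_elim (auto simp: ut_def)
  have "0 < ennreal (e / C)" using e \<open>0 < C\<close> by simp
  from order_tendstoD(2)[OF lim this] eventually_in[of t]
  show "\<forall>\<^sub>F \<tau> in at t within {0..T}. \<forall>x\<in>UNIV. dist ((u \<tau> x - u t x) / (\<tau> - t)) (ut t x) < e"
  proof eventually_elim
    case (elim \<tau>)
    let ?h = "\<lambda>x. (u \<tau> x - u t x) / (\<tau> - t) - ut t x"
    have c: "continuous_on UNIV ?h" unfolding divide_inverse by (intro continuous_intros u_cont ut_cont t elim(2))
    then have [measurable]: "?h \<in> borel_measurable borel" by (rule borel_measurable_continuous_onI)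
    have "Hs_norm (s - 1) ?h \<le> Hs_norm (s - 1) (\<lambda>x. (u \<tau> x - u t x) / (\<tau> - t) - w x)"
      by (rule Hs_norm_AE_mono) (use w in auto)
    then have "Hs_norm (s - 1) ?h < ennreal (e / C)" using elim(1) by (rule le_less_trans)
    then show ?case
      using ennreal_mult_less_imp[OF C[OF c] _ \<open>0 < C\<close> e] by (auto simp: dist_real_def)
  qed
qed

text \<open>The increment is split into a change of time at the moving point and a change of place
  at a fixed time. The first quotient converges because the time derivative is uniform in space; in
  the sum the transport term cancels and \<open>- P\<close> remains.\<close>

lemma u_along_curve:
  assumes t: "t \<in> {0..T}" and \<gamma>: "(\<gamma> has_real_derivative deriv f (u t (\<gamma> t))) (at t within {0..T})"
  shows "((\<lambda>t. u t (\<gamma> t)) has_real_derivative - P t (\<gamma> t)) (at t within {0..T})"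
proof -
  have \<gamma>c: "(\<gamma> \<longlongrightarrow> \<gamma> t) (at t within {0..T})"
    using DERIV_continuous[OF \<gamma>] by (simp add: continuous_within)
  have "((\<lambda>\<tau>. (u \<tau> (\<gamma> \<tau>) - u t (\<gamma> \<tau>)) / (\<tau> - t)) \<longlongrightarrow> ut t (\<gamma> t)) (at t within {0..T})"
  proof (rule Lim_transform)
    show "((\<lambda>\<tau>. ut t (\<gamma> \<tau>)) \<longlongrightarrow> ut t (\<gamma> t)) (at t within {0..T})"
      by (rule isCont_tendsto_compose[OF _ \<gamma>c]) (use ut_cont[OF t] in \<open>simp add: continuous_on_eq_continuous_at\<close>)
    show "((\<lambda>\<tau>. (u \<tau> (\<gamma> \<tau>) - u t (\<gamma> \<tau>)) / (\<tau> - t) - ut t (\<gamma> \<tau>)) \<longlongrightarrow> 0) (at t within {0..T})"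
    proof (rule tendstoI)
      fix e :: real assume "0 < e"
      from uniform_limitD[OF u_time_derivative[OF t] this]
      show "\<forall>\<^sub>F \<tau> in at t within {0..T}. dist ((u \<tau> (\<gamma> \<tau>) - u t (\<gamma> \<tau>)) / (\<tau> - t) - ut t (\<gamma> \<tau>)) 0 < e"
        by eventually_elim (simp add: dist_real_def)
    qed
  qed
  moreover have "((\<lambda>\<tau>. u t (\<gamma> \<tau>)) has_real_derivative deriv (u t) (\<gamma> t) * deriv f (u t (\<gamma> t))) (at t within {0..T})"
    by (rule DERIV_chain2[OF u_deriv[OF t] \<gamma>])
  then have "((\<lambda>\<tau>. (u t (\<gamma> \<tau>) - u t (\<gamma> t)) / (\<tau> - t)) \<longlongrightarrow> deriv (u t) (\<gamma> t) * deriv f (u t (\<gamma> t))) (at t within {0..T})"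
    by (simp add: has_field_derivative_iff)
  ultimately have "((\<lambda>\<tau>. (u \<tau> (\<gamma> \<tau>) - u t (\<gamma> \<tau>)) / (\<tau> - t) + (u t (\<gamma> \<tau>) - u t (\<gamma> t)) / (\<tau> - t))
      \<longlongrightarrow> ut t (\<gamma> t) + deriv (u t) (\<gamma> t) * deriv f (u t (\<gamma> t))) (at t within {0..T})"
    by (rule tendsto_add)
  then show ?thesis
    unfolding has_field_derivative_iff by (simp add: ut_def add_divide_distrib[symmetric] mult.commute)
qed

end

section \<open>The flow of a Lipschitz vector field\<close>

text \<open>Continuity makes the end points null, so the value on closed intervals carries over.
  Open intervals are the sets on which Lebesgue measure is identified below.\<close>

lemma emeasure_interval_measure_Ioo:
  fixes F :: "real \<Rightarrow> real"
  assumes "a \<le> b" and mono: "\<And>x y. x \<le> y \<Longrightarrow> F x \<le> F y" and cont: "continuous_on UNIV F"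
  shows "emeasure (interval_measure F) {a<..<b} = ennreal (F b - F a)"
proof (cases "a < b")
  case True
  have Icc: "emeasure (interval_measure F) {c..d} = ennreal (F d - F c)" if "c \<le> d" for c d
    using emeasure_interval_measure_Icc[of c d F] that mono cont by simp
  have "emeasure (interval_measure F) ({a} \<union> {b}) \<le> emeasure (interval_measure F) {a} + emeasure (interval_measure F) {b}"
    by (rule emeasure_subadditive) auto
  then have "{a} \<union> {b} \<in> null_sets (interval_measure F)" using Icc[of a a] Icc[of b b] by (intro null_setsI) auto
  then have "emeasure (interval_measure F) ({a..b} - ({a} \<union> {b})) = emeasure (interval_measure F) {a..b}"
    by (intro emeasure_Diff_null_set) auto
  also have "{a..b} - ({a} \<union> {b}) = {a<..<b}" by auto
  also have "emeasure (interval_measure F) {a..b} = ennreal (F b - F a)" by (rule Icc[OF assms(1)])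
  finally show ?thesis .
next
  case False
  then show ?thesis using assms(1) by simp
qed

text \<open>The Lebesgue measure is the image under \<open>\<eta>\<close> of the Stieltjes measure \<open>d\<eta>\<close>, and
  \<open>d\<eta> \<le> E dx\<close> because \<open>E x - \<eta> x\<close> is nondecreasing.\<close>

lemma nn_integral_lipschitz_substitution:
  fixes \<eta> :: "real \<Rightarrow> real" and h :: "real \<Rightarrow> ennreal"
  assumes mono: "strict_mono \<eta>" and surj: "\<And>y. \<exists>x. \<eta> x = y" and cont: "continuous_on UNIV \<eta>"
    and lip: "\<And>x y. x \<le> y \<Longrightarrow> \<eta> y - \<eta> x \<le> E * (y - x)"
    and [measurable]: "h \<in> borel_measurable borel"
  shows "(\<integral>\<^sup>+y. h y \<partial>lborel) \<le> ennreal E * (\<integral>\<^sup>+z. h (\<eta> z) \<partial>lborel)"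
proof -
  have [measurable]: "\<eta> \<in> borel_measurable borel" using cont by (rule borel_measurable_continuous_onI)
  have le: "\<eta> x \<le> \<eta> y" if "x \<le> y" for x y using mono that by (simp add: strict_mono_less_eq)
  have E: "0 < E" using lip[of 0 1] mono[THEN strict_monoD, of 0 1] by simp
  let ?\<mu> = "interval_measure \<eta>"
  define F where "F x = E * x - \<eta> x" for x
  have F: "F x \<le> F y" if "x \<le> y" for x y using lip[OF that] by (simp add: F_def algebra_simps)
  have Fc: "continuous_on UNIV F" unfolding F_def by (intro continuous_intros cont)
  let ?\<nu> = "interval_measure F"
  \<comment> \<open>The sum of the Stieltjes measures of \<open>\<eta>\<close> and \<open>F\<close>.
    As \<eta> + F = E x it equals E dx, which gives the comparison of measures without
    differentiating \<open>\<eta>\<close>.\<close>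
  define N where "N = measure_of UNIV (sets borel) (\<lambda>A. emeasure ?\<mu> A + emeasure ?\<nu> A)"
  have N_sets [measurable_cong]: "sets N = sets borel" unfolding N_def using sets.sigma_sets_eq[of borel] by simp
  have N: "emeasure N A = emeasure ?\<mu> A + emeasure ?\<nu> A" if "A \<in> sets borel" for A
    unfolding N_def
  proof (rule emeasure_measure_of_sigma[OF _ _ _ that])
    show "sigma_algebra UNIV (sets (borel :: real measure))" using sets.sigma_algebra_axioms[of borel] by simp
    show "positive (sets borel) (\<lambda>A. emeasure ?\<mu> A + emeasure ?\<nu> A)" by (simp add: positive_def)
    show "countably_additive (sets borel) (\<lambda>A. emeasure ?\<mu> A + emeasure ?\<nu> A)"
    proof (rule countably_additiveI)
      fix A :: "nat \<Rightarrow> real set" assume "range A \<subseteq> sets borel" "disjoint_family A"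
      then show "(\<Sum>i. emeasure ?\<mu> (A i) + emeasure ?\<nu> (A i)) = emeasure ?\<mu> (\<Union>i. A i) + emeasure ?\<nu> (\<Union>i. A i)"
        by (subst suminf_add[symmetric]) (auto simp: suminf_emeasure)
    qed
  qed
  have lN: "lborel = scale_measure (ennreal (1 / E)) N"
  proof (rule lborel_eqI)
    fix l u :: real assume "\<And>b. b \<in> Basis \<Longrightarrow> l \<bullet> b \<le> u \<bullet> b"
    then have "l \<le> u" by simp
    then have "emeasure N {l<..<u} = ennreal (E * (u - l))"
      using le[of l u] F[of l u] emeasure_interval_measure_Ioo[of l u \<eta>, OF _ le cont]
        emeasure_interval_measure_Ioo[of l u F, OF _ F Fc]
      by (simp add: N ennreal_plus[symmetric] del: ennreal_plus) (simp add: F_def algebra_simps)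
    then show "emeasure (scale_measure (ennreal (1 / E)) N) (box l u) = ennreal (\<Prod>b\<in>Basis. (u - l) \<bullet> b)"
      using E \<open>l \<le> u\<close> by (simp add: ennreal_mult[symmetric])
  qed (simp add: N_sets)
  have d: "lborel = distr ?\<mu> borel \<eta>"
  proof (rule lborel_eqI)
    fix l u :: real assume "\<And>b. b \<in> Basis \<Longrightarrow> l \<bullet> b \<le> u \<bullet> b"
    then have "l \<le> u" by simp
    obtain a b where ab: "\<eta> a = l" "\<eta> b = u" using surj by metis
    have "\<eta> -` {l<..<u} = {a<..<b}" using mono by (auto simp: ab[symmetric] strict_mono_less)
    moreover have "a \<le> b" using \<open>l \<le> u\<close> mono by (simp add: ab[symmetric] strict_mono_less_eq)
    ultimately show "emeasure (distr ?\<mu> borel \<eta>) (box l u) = ennreal (\<Prod>b\<in>Basis. (u - l) \<bullet> b)"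
      by (simp add: emeasure_distr emeasure_interval_measure_Ioo le cont ab)
  qed simp
  have "(\<integral>\<^sup>+y. h y \<partial>lborel) = (\<integral>\<^sup>+z. h (\<eta> z) \<partial>?\<mu>)"
    by (subst d) (simp add: nn_integral_distr)
  also have "\<dots> \<le> (\<integral>\<^sup>+z. h (\<eta> z) \<partial>N)"
  proof (rule nn_integral_mono_measure)
    have "emeasure ?\<mu> A \<le> emeasure N A" for A
    proof (cases "A \<in> sets borel")
      case True
      then show ?thesis unfolding N[OF True] by (intro add_increasing2) auto
    next
      case False
      then have "A \<notin> sets ?\<mu>" by simp
      then show ?thesis using emeasure_notin_sets[of A ?\<mu>] by simp
    qed
    moreover have "space ?\<mu> = space N" "sets ?\<mu> = sets N" using N_sets sets_eq_imp_space_eq[OF N_sets] by auto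
    ultimately show "?\<mu> \<le> N" unfolding le_measure_iff le_fun_def by simp
  qed (simp add: N_sets)
  also have "\<dots> = ennreal E * (ennreal (1 / E) * (\<integral>\<^sup>+z. h (\<eta> z) \<partial>N))"
    using E by (simp add: mult.assoc[symmetric] ennreal_mult[symmetric])
  also have "\<dots> = ennreal E * (\<integral>\<^sup>+z. h (\<eta> z) \<partial>lborel)"
    by (subst lN) (simp add: nn_integral_scale_measure)
  finally show ?thesis .
qed

section \<open>Existence, distortion and bijectivity of the flow\<close>

locale lipschitz_field =
  fixes T B L :: real and b :: "real \<Rightarrow> real \<Rightarrow> real"
  assumes T: "0 < T" and L: "0 \<le> L"
    and b_cont: "continuous_on ({0..T} \<times> UNIV) (\<lambda>(t, x). b t x)"
    and b_bound: "t \<in> {0..T} \<Longrightarrow> \<bar>b t x\<bar> \<le> B"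
    and b_lip: "t \<in> {0..T} \<Longrightarrow> \<bar>b t x - b t y\<bar> \<le> L * \<bar>x - y\<bar>"
begin

lemma b_along: 
  assumes "continuous_on {0..T} \<gamma>" shows "continuous_on {0..T} (\<lambda>t. b t (\<gamma> t))"
proof -
  have "continuous_on {0..T} (\<lambda>t. (\<lambda>(t, x). b t x) (t, \<gamma> t))"
    by (rule continuous_on_compose2[OF b_cont]) (use assms in \<open>auto intro!: continuous_intros\<close>)
  then show ?thesis by simp
qed

text \<open>Picard iteration is a contraction by \<open>1/2\<close> for the norm \<open>sup \<bar>exp (- 2 L t) \<gamma> t\<bar>\<close>, so no
  subdivision of the time interval is needed.\<close>

lemma integral_curve_exists:
  "\<exists>\<gamma>. \<gamma> 0 = x \<and> (\<forall>t\<in>{0..T}. (\<gamma> has_real_derivative b t (\<gamma> t)) (at t within {0..T}))"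
proof -
  \<comment> \<open>The weight uses the rate 2 K; as L \<le> K, the integral of L exp(2 K \<tau>)
    over [0, t] is at most half of exp(2 K t).\<close>
  define K where "K = L + 1"
  have K: "0 < K" "L \<le> K" using L by (auto simp: K_def)
  have B0: "0 \<le> B" using b_bound[of 0 0] T by auto
  \<comment> \<open>Bounded continuous functions live on the whole line, so time is clamped to the
    interval.\<close>
  define c where "c t = max 0 (min T t)" for t :: real
  have c: "c t \<in> {0..T}" for t using T by (auto simp: c_def)
  have c_id: "c t = t" if "t \<in> {0..T}" for t using that by (auto simp: c_def)
  have c_cont: "continuous_on A c" for A unfolding c_def by (intro continuous_intros)
  \<comment> \<open>The unknown \<beta> stands for the rescaled curve exp(- 2 K t) \<gamma>(t): the
    contraction in the weighted norm becomes one in the plain sup norm.\<close>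
  define h where "h \<beta> \<tau> = b \<tau> (exp (2 * K * \<tau>) * apply_bcontfun \<beta> \<tau>)" for \<beta> :: "real \<Rightarrow>\<^sub>C real" and \<tau>
  have h_cont: "continuous_on {0..T} (h \<beta>)" for \<beta>
    unfolding h_def
    by (rule b_along, rule continuous_on_mult[OF _ continuous_on_apply_bcontfun]) (intro continuous_intros)
  have h_int: "(h \<beta>) integrable_on {0..t}" if "t \<in> {0..T}" for \<beta> t
    using continuous_on_subset[OF h_cont, of "{0..t}"] that by (intro integrable_continuous_real) auto
  define \<Theta> where "\<Theta> \<beta> t = exp (- 2 * K * c t) * (x + integral {0..c t} (h \<beta>))" for \<beta> t
  have \<Theta>_bcont: "\<Theta> \<beta> \<in> bcontfun" for \<beta>
  proof (rule bcontfun_normI)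
    show "continuous_on UNIV (\<Theta> \<beta>)"
      unfolding \<Theta>_def
      by (intro continuous_intros c_cont continuous_on_compose2[OF indefinite_integral_continuous_1[OF h_int[of T \<beta>]] c_cont])
        (use c T in auto)
    fix t
    have "\<bar>integral {0..c t} (h \<beta>)\<bar> \<le> B * (c t - 0)"
      unfolding real_norm_def[symmetric]
      by (rule integral_bound) (use c[of t] b_bound h_cont continuous_on_subset[OF h_cont[of \<beta>], of "{0..c t}"] in \<open>auto simp: h_def\<close>)
    also have "\<dots> \<le> B * T" using c[of t] B0 by (auto intro: mult_left_mono)
    finally have 1: "\<bar>x + integral {0..c t} (h \<beta>)\<bar> \<le> \<bar>x\<bar> + B * T" by linarith
    have "\<bar>\<Theta> \<beta> t\<bar> \<le> 1 * (\<bar>x\<bar> + B * T)"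
      unfolding \<Theta>_def abs_mult by (rule mult_mono[OF _ 1]) (use c[of t] K in auto)
    then show "norm (\<Theta> \<beta> t) \<le> \<bar>x\<bar> + B * T" by simp
  qed
  have "\<exists>!\<beta>. Bcontfun (\<Theta> \<beta>) = \<beta>"
  proof (rule banach_fix_type[of "1/2"])
    show "\<forall>\<beta>\<^sub>1 \<beta>\<^sub>2. dist (Bcontfun (\<Theta> \<beta>\<^sub>1)) (Bcontfun (\<Theta> \<beta>\<^sub>2)) \<le> 1/2 * dist \<beta>\<^sub>1 \<beta>\<^sub>2"
    proof (intro allI dist_bound)
      fix \<beta>\<^sub>1 \<beta>\<^sub>2 :: "real \<Rightarrow>\<^sub>C real" and t :: real
      let ?D = "dist \<beta>\<^sub>1 \<beta>\<^sub>2"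
      \<comment> \<open>The factor 1/2 of the antiderivative is the contraction constant.\<close>
      have e: "((\<lambda>\<tau>. K * exp (2 * K * \<tau>) * ?D) has_integral (exp (2 * K * c t) / 2 * ?D - exp (2 * K * 0) / 2 * ?D)) {0..c t}"
        by (rule fundamental_theorem_of_calculus)
          (use c[of t] in \<open>auto intro!: derivative_eq_intros simp: has_real_derivative_iff_has_vector_derivative[symmetric]\<close>)
      have "\<bar>h \<beta>\<^sub>1 \<tau> - h \<beta>\<^sub>2 \<tau>\<bar> \<le> K * exp (2 * K * \<tau>) * ?D" if "\<tau> \<in> {0..c t}" for \<tau>
      proof -
        have "\<bar>h \<beta>\<^sub>1 \<tau> - h \<beta>\<^sub>2 \<tau>\<bar> \<le> L * \<bar>exp (2 * K * \<tau>) * \<beta>\<^sub>1 \<tau> - exp (2 * K * \<tau>) * \<beta>\<^sub>2 \<tau>\<bar>"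
          unfolding h_def using that c[of t] by (intro b_lip) auto
        also have "\<dots> = L * exp (2 * K * \<tau>) * dist (\<beta>\<^sub>1 \<tau>) (\<beta>\<^sub>2 \<tau>)"
          by (simp add: dist_real_def abs_mult flip: right_diff_distrib)
        also have "\<dots> \<le> K * exp (2 * K * \<tau>) * ?D" using K L by (intro mult_mono dist_bounded) auto
        finally show ?thesis .
      qed
      then have "norm (integral {0..c t} (\<lambda>\<tau>. h \<beta>\<^sub>1 \<tau> - h \<beta>\<^sub>2 \<tau>)) \<le> integral {0..c t} (\<lambda>\<tau>. K * exp (2 * K * \<tau>) * ?D)"
        by (intro integral_norm_bound_integral has_integral_integrable[OF e] Henstock_Kurzweil_Integration.integrable_diff h_int c) auto
      also have "\<dots> = exp (2 * K * c t) / 2 * ?D - exp (2 * K * 0) / 2 * ?D" using e by (rule integral_unique)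
      also have "\<dots> \<le> exp (2 * K * c t) * (1/2 * ?D)" by simp
      finally have 1: "\<bar>integral {0..c t} (h \<beta>\<^sub>1) - integral {0..c t} (h \<beta>\<^sub>2)\<bar> \<le> exp (2 * K * c t) * (1/2 * ?D)"
        by (subst (asm) Henstock_Kurzweil_Integration.integral_diff) (use h_int c in auto)
      have "\<bar>\<Theta> \<beta>\<^sub>1 t - \<Theta> \<beta>\<^sub>2 t\<bar> = exp (- 2 * K * c t) * \<bar>integral {0..c t} (h \<beta>\<^sub>1) - integral {0..c t} (h \<beta>\<^sub>2)\<bar>"
        unfolding \<Theta>_def right_diff_distrib[symmetric] by (simp add: abs_mult)
      also have "\<dots> \<le> exp (- 2 * K * c t) * (exp (2 * K * c t) * (1/2 * ?D))" by (intro mult_left_mono 1) auto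
      also have "\<dots> = 1/2 * ?D" by (simp add: exp_minus)
      finally show "dist (Bcontfun (\<Theta> \<beta>\<^sub>1) t) (Bcontfun (\<Theta> \<beta>\<^sub>2) t) \<le> 1/2 * ?D"
        by (simp add: Bcontfun_inverse[OF \<Theta>_bcont] dist_real_def)
    qed
  qed auto
  then obtain \<beta> where "Bcontfun (\<Theta> \<beta>) = \<beta>" by blast
  then have \<beta>: "apply_bcontfun \<beta> t = \<Theta> \<beta> t" for t
    by (metis Bcontfun_inverse \<Theta>_bcont)
  define \<gamma> where "\<gamma> t = exp (2 * K * t) * apply_bcontfun \<beta> t" for t
  have \<gamma>: "\<gamma> t = x + integral {0..t} (\<lambda>\<tau>. b \<tau> (\<gamma> \<tau>))" if "t \<in> {0..T}" for t
  proof -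
    have "h \<beta> = (\<lambda>\<tau>. b \<tau> (\<gamma> \<tau>))" by (auto simp: h_def \<gamma>_def)
    moreover have "\<gamma> t = exp (2 * K * t) * (exp (- 2 * K * t) * (x + integral {0..t} (h \<beta>)))"
      unfolding \<gamma>_def \<beta> unfolding \<Theta>_def c_id[OF that] ..
    ultimately show ?thesis by (simp add: mult.assoc[symmetric] exp_minus)
  qed
  have cont: "continuous_on {0..T} (\<lambda>\<tau>. b \<tau> (\<gamma> \<tau>))"
    unfolding \<gamma>_def
    by (rule b_along, rule continuous_on_mult[OF _ continuous_on_apply_bcontfun]) (intro continuous_intros)
  show ?thesis
  proof (intro exI[of _ \<gamma>] conjI ballI)
    show "\<gamma> 0 = x" using \<gamma>[of 0] T by simp
    fix t assume t: "t \<in> {0..T}"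
    have "((\<lambda>t. x + integral {0..t} (\<lambda>\<tau>. b \<tau> (\<gamma> \<tau>))) has_real_derivative b t (\<gamma> t)) (at t within {0..T})"
      using integral_has_real_derivative[OF cont t] by (auto intro!: derivative_eq_intros)
    then show "(\<gamma> has_real_derivative b t (\<gamma> t)) (at t within {0..T})"
      by (rule has_field_derivative_transform_within[of _ _ _ _ 1]) (use t \<gamma> in auto)
  qed
qed

text \<open>The curve is chosen from \<open>x\<close> alone, so varying \<open>t\<close> follows one
  and the same integral curve.\<close>

definition flow :: "real \<Rightarrow> real \<Rightarrow> real" where
  "flow t x = (SOME \<gamma>. \<gamma> 0 = x \<and> (\<forall>t\<in>{0..T}. (\<gamma> has_real_derivative b t (\<gamma> t)) (at t within {0..T}))) t"

lemma flow_spec: "flow 0 x = x \<and> (\<forall>t\<in>{0..T}. ((\<lambda>t. flow t x) has_real_derivative b t (flow t x)) (at t within {0..T}))"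
  unfolding flow_def by (rule someI_ex[OF integral_curve_exists])

lemma flow_0 [simp]: "flow 0 x = x"
  and flow_deriv: "t \<in> {0..T} \<Longrightarrow> ((\<lambda>t. flow t x) has_real_derivative b t (flow t x)) (at t within {0..T})"
  using flow_spec by blast+

lemma flow_cont: "continuous_on {0..T} (\<lambda>t. flow t x)" by (rule DERIV_continuous_on[OF flow_deriv])

lemma flow_displacement:
  assumes t: "t \<in> {0..T}"
  shows "\<bar>flow t x - x\<bar> \<le> B * T"
proof -
  have "norm (flow t x - flow 0 x) \<le> B * norm (t - 0)"
    by (rule field_differentiable_bound[of "{0..T}" "\<lambda>t. flow t x" "\<lambda>t. b t (flow t x)"])
      (use t T flow_deriv b_bound in auto)
  also have "\<dots> \<le> B * T" using t b_bound[OF t, of 0] by (auto intro!: mult_left_mono)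
  finally show ?thesis by simp
qed

text \<open>The squared distance times exp(a t) is nonincreasing for a = - 2 L and nondecreasing for
  a = 2 L; squares avoid differentiating an absolute value. The second bound makes the flow
  injective and controls division by the distance of two characteristics.\<close>

lemma flow_gronwall:
  assumes t: "t \<in> {0..T}"
  shows "\<bar>flow t x - flow t y\<bar> \<le> exp (L * T) * \<bar>x - y\<bar>"
    and "\<bar>x - y\<bar> \<le> exp (L * T) * \<bar>flow t x - flow t y\<bar>"
proof -
  define D where "D t = flow t x - flow t y" for t
  have D0: "D 0 = x - y" by (simp add: D_def)
  have dD: "((\<lambda>t. (D t)\<^sup>2 * exp (a * t)) has_real_derivative
      (2 * D t * (b t (flow t x) - b t (flow t y)) + a * (D t)\<^sup>2) * exp (a * t)) (at t within {0..T})"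
    if "t \<in> {0..T}" for a t
    unfolding D_def using that
    by (auto intro!: derivative_eq_intros flow_deriv simp: algebra_simps power2_eq_square)
  have key: "\<bar>2 * D t * (b t (flow t x) - b t (flow t y))\<bar> \<le> 2 * L * (D t)\<^sup>2" if "t \<in> {0..T}" for t
  proof -
    have "\<bar>D t\<bar> * \<bar>b t (flow t x) - b t (flow t y)\<bar> \<le> \<bar>D t\<bar> * (L * \<bar>D t\<bar>)"
      unfolding D_def by (intro mult_left_mono b_lip that) auto
    also have "\<dots> = L * (D t)\<^sup>2" by (simp add: power2_eq_square)
    finally show ?thesis unfolding abs_mult mult.assoc by simp
  qed
  have sub: "((\<lambda>t. (D t)\<^sup>2 * exp (a * t)) has_derivative (*) ((2 * D r * (b r (flow r x) - b r (flow r y)) + a * (D r)\<^sup>2) * exp (a * r))) (at r within {0..t})"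
    if "r \<in> {0..t}" for a r
    by (rule DERIV_subset[OF dD, of r "{0..t}" a, unfolded has_field_derivative_def]) (use that t in auto)
  have "\<exists>r\<in>{0..t}. (D t)\<^sup>2 * exp (a * t) - (D 0)\<^sup>2 * exp (a * 0) = (2 * D r * (b r (flow r x) - b r (flow r y)) + a * (D r)\<^sup>2) * exp (a * r) * (t - 0)" for a
    by (rule mvt_very_simple) (use t sub in auto)
  then have mvt: "\<exists>r\<in>{0..T}. (D t)\<^sup>2 * exp (a * t) - (x - y)\<^sup>2 = (2 * D r * (b r (flow r x) - b r (flow r y)) + a * (D r)\<^sup>2) * exp (a * r) * t" for a
    using t unfolding D0 by fastforce
  have root: "\<bar>p\<bar> \<le> exp (L * T) * \<bar>q\<bar>" if "p\<^sup>2 \<le> q\<^sup>2 * exp (2 * L * t)" for p q :: real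
  proof -
    have "q\<^sup>2 * exp (2 * L * t) \<le> q\<^sup>2 * exp (2 * L * T)" using t L by (intro mult_left_mono) (auto intro: mult_left_mono)
    also have "\<dots> = (exp (L * T) * \<bar>q\<bar>)\<^sup>2" by (simp add: power_mult_distrib exp_double mult.assoc)
    finally have "p\<^sup>2 \<le> (exp (L * T) * \<bar>q\<bar>)\<^sup>2" using that by simp
    then show ?thesis by (simp add: power2_le_iff_abs_le)
  qed
  obtain r where r: "r \<in> {0..T}" "(D t)\<^sup>2 * exp (- 2 * L * t) - (x - y)\<^sup>2 = (2 * D r * (b r (flow r x) - b r (flow r y)) + - 2 * L * (D r)\<^sup>2) * exp (- 2 * L * r) * t"
    using mvt[of "- 2 * L"] by blast
  have "(D t)\<^sup>2 * exp (- 2 * L * t) - (x - y)\<^sup>2 \<le> 0" unfolding r(2) using key[OF r(1)] t by (intro mult_nonpos_nonneg) auto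
  then show "\<bar>flow t x - flow t y\<bar> \<le> exp (L * T) * \<bar>x - y\<bar>"
    unfolding D_def[symmetric] by (intro root) (simp add: exp_minus field_simps)
  obtain r where r: "r \<in> {0..T}" "(D t)\<^sup>2 * exp (2 * L * t) - (x - y)\<^sup>2 = (2 * D r * (b r (flow r x) - b r (flow r y)) + 2 * L * (D r)\<^sup>2) * exp (2 * L * r) * t"
    using mvt[of "2 * L"] by blast
  have "(D t)\<^sup>2 * exp (2 * L * t) - (x - y)\<^sup>2 \<ge> 0" unfolding r(2) using key[OF r(1)] t by (intro mult_nonneg_nonneg) auto
  then show "\<bar>x - y\<bar> \<le> exp (L * T) * \<bar>flow t x - flow t y\<bar>" unfolding D_def[symmetric] by (intro root) simp
qed

lemma flow_inj: "t \<in> {0..T} \<Longrightarrow> x \<noteq> y \<Longrightarrow> flow t x \<noteq> flow t y"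
  using flow_gronwall(2)[of t x y] by auto

lemma flow_lipschitz: "t \<in> {0..T} \<Longrightarrow> (exp (L * T))-lipschitz_on UNIV (flow t)"
  using flow_gronwall(1) by (intro lipschitz_onI) (auto simp: dist_real_def)

lemma flow_space_cont: "t \<in> {0..T} \<Longrightarrow> continuous_on UNIV (flow t)"
  by (rule lipschitz_on_continuous_on[OF flow_lipschitz])

text \<open>A change of order would force two characteristics to meet at some intermediate time,
  against injectivity.\<close>

lemma flow_strict_mono:
  assumes t: "t \<in> {0..T}" and xy: "x < y"
  shows "flow t x < flow t y"
proof (rule ccontr)
  assume "\<not> flow t x < flow t y"
  moreover have "continuous_on {0..t} (\<lambda>t. flow t y - flow t x)"
    using t by (intro continuous_intros continuous_on_subset[OF flow_cont]) auto
  ultimately have "\<exists>r\<ge>0. r \<le> t \<and> flow r y - flow r x = 0" using t xy by (intro IVT2') auto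
  then show False using flow_inj[of _ x y] t xy by force
qed

text \<open>Points move by at most \<open>B * T\<close>, so the intermediate value theorem applies
  on the interval of this radius around \<open>y\<close>.\<close>

lemma flow_surj:
  assumes t: "t \<in> {0..T}"
  shows "\<exists>x. flow t x = y"
proof -
  have "\<exists>x\<ge>y - B * T. x \<le> y + B * T \<and> flow t x = y"
  proof (rule IVT')
    have B0: "0 \<le> B * T" using flow_displacement[OF t, of 0] by linarith
    show "flow t (y - B * T) \<le> y" "y \<le> flow t (y + B * T)"
      using flow_displacement[OF t, of "y - B * T"] flow_displacement[OF t, of "y + B * T"] by linarith+
    show "y - B * T \<le> y + B * T" using B0 by linarith
    show "continuous_on {y - B * T..y + B * T} (flow t)" by (rule continuous_on_subset[OF flow_space_cont[OF t]]) simp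
  qed
  then show ?thesis by blast
qed

lemma flow_nn_integral:
  assumes t: "t \<in> {0..T}" and "h \<in> borel_measurable borel"
  shows "(\<integral>\<^sup>+y. h y \<partial>lborel) \<le> ennreal (exp (L * T)) * (\<integral>\<^sup>+z. h (flow t z) \<partial>lborel)"
proof (rule nn_integral_lipschitz_substitution)
  show "flow t y - flow t x \<le> exp (L * T) * (y - x)" if "x \<le> y" for x y
    using flow_gronwall(1)[OF t, of y x] that by simp
qed (use assms flow_surj flow_strict_mono flow_space_cont in \<open>auto simp: strict_mono_def\<close>)

end

section \<open>Convolution series and weighted norms\<close>

text \<open>Values in the extended numbers let powers and series be formed before anything is known
  to be finite.\<close>

definition conv_step :: "(real \<Rightarrow> ennreal) \<Rightarrow> (real \<Rightarrow> ennreal) \<Rightarrow> real \<Rightarrow> ennreal" where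
  "conv_step K h x = h x + (\<integral>\<^sup>+y. K (x - y) * h y \<partial>lborel)"

definition conv_series :: "(nat \<Rightarrow> real) \<Rightarrow> (real \<Rightarrow> ennreal) \<Rightarrow> (real \<Rightarrow> ennreal) \<Rightarrow> real \<Rightarrow> ennreal" where
  "conv_series a K h x = (\<Sum>n. ennreal (a n) * (conv_step K ^^ n) h x)"

lemma conv_step_measurable [measurable (raw)]:
  assumes [measurable]: "K \<in> borel_measurable borel" "h \<in> borel_measurable borel"
  shows "conv_step K h \<in> borel_measurable borel"
  unfolding conv_step_def by measurable

lemma conv_step_power_measurable [measurable (raw)]:
  assumes [measurable]: "K \<in> borel_measurable borel" "h \<in> borel_measurable borel"
  shows "(conv_step K ^^ n) h \<in> borel_measurable borel"
  by (induction n) auto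

lemma conv_step_mono: "(\<And>x. h x \<le> h' x) \<Longrightarrow> conv_step K h x \<le> conv_step K h' x"
  unfolding conv_step_def by (intro add_mono nn_integral_mono mult_left_mono) auto

lemma conv_step_power_mono: "(\<And>x. h x \<le> h' x) \<Longrightarrow> (conv_step K ^^ n) h x \<le> (conv_step K ^^ n) h' x"
  by (induction n arbitrary: x) (auto intro: conv_step_mono)

lemma conv_step_linear:
  assumes [measurable]: "K \<in> borel_measurable borel" "h \<in> borel_measurable borel" "h' \<in> borel_measurable borel"
  shows "conv_step K (\<lambda>x. c * h x + c' * h' x) = (\<lambda>x. c * conv_step K h x + c' * conv_step K h' x)"
proof
  fix x
  have "(\<integral>\<^sup>+y. K (x - y) * (c * h y + c' * h' y) \<partial>lborel) = (\<integral>\<^sup>+y. c * (K (x - y) * h y) + c' * (K (x - y) * h' y) \<partial>lborel)"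
    by (intro nn_integral_cong) (simp add: algebra_simps)
  also have "\<dots> = c * (\<integral>\<^sup>+y. K (x - y) * h y \<partial>lborel) + c' * (\<integral>\<^sup>+y. K (x - y) * h' y \<partial>lborel)"
    by (simp add: nn_integral_add nn_integral_cmult)
  finally show "conv_step K (\<lambda>x. c * h x + c' * h' x) x = c * conv_step K h x + c' * conv_step K h' x"
    by (simp add: conv_step_def algebra_simps)
qed

lemma conv_step_power_linear:
  assumes [measurable]: "K \<in> borel_measurable borel" "h \<in> borel_measurable borel" "h' \<in> borel_measurable borel"
  shows "(conv_step K ^^ n) (\<lambda>x. c * h x + c' * h' x) = (\<lambda>x. c * (conv_step K ^^ n) h x + c' * (conv_step K ^^ n) h' x)"
  by (induction n) (auto simp: conv_step_linear)

lemma conv_step_zero: "conv_step K (\<lambda>_. 0) = (\<lambda>_. 0)" by (auto simp: conv_step_def)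

lemma conv_step_sum:
  fixes n :: nat
  assumes [measurable]: "K \<in> borel_measurable borel" "\<And>j. h j \<in> borel_measurable borel"
  shows "conv_step K (\<lambda>x. \<Sum>j<n. c j * h j x) = (\<lambda>x. \<Sum>j<n. c j * conv_step K (h j) x)"
proof (induction n)
  case (Suc n)
  have "conv_step K (\<lambda>x. \<Sum>j<Suc n. c j * h j x) = conv_step K (\<lambda>x. 1 * (\<Sum>j<n. c j * h j x) + c n * h n x)" by simp
  also have "\<dots> = (\<lambda>x. 1 * conv_step K (\<lambda>x. \<Sum>j<n. c j * h j x) x + c n * conv_step K (h n) x)"
    by (rule conv_step_linear) measurable
  finally show ?case by (simp add: Suc.IH)
qed (simp add: conv_step_zero)

lemma nn_integral_reflect_shift:
  fixes K :: "real \<Rightarrow> ennreal"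
  assumes [measurable]: "K \<in> borel_measurable borel"
  shows "(\<integral>\<^sup>+y. K (x - y) \<partial>lborel) = (\<integral>\<^sup>+y. K y \<partial>lborel)"
    and "(\<integral>\<^sup>+x. K (x - y) \<partial>lborel) = (\<integral>\<^sup>+x. K x \<partial>lborel)"
  using nn_integral_real_affine[of K "-1" x] nn_integral_real_affine[of K 1 "- y"] by simp_all

text \<open>Constants are eigenfunctions, with one plus the mass of the kernel as eigenvalue. This
  governs the Picard remainder and the sup norm estimate.\<close>

lemma conv_step_power_const:
  assumes [measurable]: "K \<in> borel_measurable borel"
  shows "(conv_step K ^^ n) (\<lambda>_. c) = (\<lambda>_. (1 + (\<integral>\<^sup>+y. K y \<partial>lborel)) ^ n * c)"
proof (induction n)
  case (Suc n)
  have "conv_step K (\<lambda>_. d) = (\<lambda>_. (1 + (\<integral>\<^sup>+y. K y \<partial>lborel)) * d)" for d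
  proof
    fix x
    have "conv_step K (\<lambda>_. d) x = d + (\<integral>\<^sup>+y. K y \<partial>lborel) * d"
      by (simp add: conv_step_def nn_integral_multc nn_integral_reflect_shift(1)[OF assms])
    then show "conv_step K (\<lambda>_. d) x = (1 + (\<integral>\<^sup>+y. K y \<partial>lborel)) * d" by (simp add: distrib_right)
  qed
  then show ?case by (simp add: Suc.IH mult.assoc)
qed simp

text \<open>By Tonelli each step multiplies the integral by the same number that it multiplies
  constants with: the L^1 counterpart of the preceding lemma.\<close>

lemma conv_step_power_nn_integral:
  assumes [measurable]: "K \<in> borel_measurable borel" "h \<in> borel_measurable borel"
  shows "(\<integral>\<^sup>+x. (conv_step K ^^ n) h x \<partial>lborel) = (1 + (\<integral>\<^sup>+y. K y \<partial>lborel)) ^ n * (\<integral>\<^sup>+x. h x \<partial>lborel)"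
proof (induction n)
  case (Suc n)
  let ?h = "(conv_step K ^^ n) h"
  have [measurable]: "?h \<in> borel_measurable borel" by measurable
  have "(\<integral>\<^sup>+x. \<integral>\<^sup>+y. K (x - y) * ?h y \<partial>lborel \<partial>lborel) = (\<integral>\<^sup>+y. \<integral>\<^sup>+x. K (x - y) * ?h y \<partial>lborel \<partial>lborel)"
    by (rule lborel_pair.Fubini'[symmetric]) measurable
  also have "\<dots> = (\<integral>\<^sup>+y. K y \<partial>lborel) * (\<integral>\<^sup>+y. ?h y \<partial>lborel)"
    by (simp add: nn_integral_multc nn_integral_cmult nn_integral_reflect_shift(2)[OF assms(1)])
  finally have "(\<integral>\<^sup>+x. conv_step K ?h x \<partial>lborel) = (1 + (\<integral>\<^sup>+y. K y \<partial>lborel)) * (\<integral>\<^sup>+y. ?h y \<partial>lborel)"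
    by (simp add: conv_step_def nn_integral_add algebra_simps)
  then show ?case by (simp add: Suc.IH mult.assoc)
qed simp

text \<open>The weight passes through one convolution at a time, each passage replacing one copy of
  the first kernel by the second.\<close>

lemma conv_step_power_weight:
  fixes \<phi> :: "real \<Rightarrow> ennreal"
  assumes [measurable]: "K\<^sub>1 \<in> borel_measurable borel" "h \<in> borel_measurable borel"
    and w: "\<And>x y. \<phi> x * K\<^sub>1 (x - y) \<le> K\<^sub>2 (x - y) * \<phi> y"
  shows "\<phi> x * (conv_step K\<^sub>1 ^^ n) h x \<le> (conv_step K\<^sub>2 ^^ n) (\<lambda>x. \<phi> x * h x) x"
proof (induction n arbitrary: x)
  case (Suc n)
  let ?h = "(conv_step K\<^sub>1 ^^ n) h"
  have "\<phi> x * conv_step K\<^sub>1 ?h x = \<phi> x * ?h x + (\<integral>\<^sup>+y. \<phi> x * (K\<^sub>1 (x - y) * ?h y) \<partial>lborel)"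
    by (simp add: conv_step_def distrib_left nn_integral_cmult)
  also have "\<dots> \<le> conv_step K\<^sub>2 (\<lambda>x. \<phi> x * ?h x) x"
    unfolding conv_step_def
    by (intro add_left_mono nn_integral_mono) (simp add: mult.assoc[symmetric] w mult_right_mono)
  also have "\<dots> \<le> conv_step K\<^sub>2 ((conv_step K\<^sub>2 ^^ n) (\<lambda>x. \<phi> x * h x)) x"
    by (rule conv_step_mono) (rule Suc.IH)
  finally show ?case by simp
qed simp

text \<open>The coefficients of \<open>C exp (C T J)\<close> as a power series in \<open>J\<close>.\<close>

definition exp_coeff :: "real \<Rightarrow> real \<Rightarrow> nat \<Rightarrow> real" where
  "exp_coeff C T n = C * (C * T) ^ n / fact n"

lemma nn_integral_power_Icc:
  assumes "0 \<le> t"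
  shows "(\<integral>\<^sup>+\<tau>. ennreal (\<tau> ^ n) * indicator {0..t} \<tau> \<partial>lborel) = ennreal (t ^ Suc n / real (Suc n))"
proof -
  have d: "((\<lambda>\<tau>. \<tau> ^ Suc n / real (Suc n)) has_real_derivative x ^ n) (at x)" for x
    using DERIV_cdivide[OF DERIV_pow[of "Suc n" x UNIV], of "real (Suc n)"]
    by (simp del: of_nat_Suc power_Suc)
  show ?thesis
    using nn_integral_FTC_Icc[of "\<lambda>\<tau>. \<tau> ^ n" 0 t "\<lambda>\<tau>. \<tau> ^ Suc n / real (Suc n)", OF _ d _ assms] by simp
qed

text \<open>Inserting the n-th bound into the integral inequality raises every power of the operator
  by one, and integrating \<tau>^j in time supplies the next factor of the factorial. The
  coefficients are taken at \<open>t\<close> itself, since they are integrated in the next round;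
  the constant remainder gains C r t / (n + 1).\<close>

lemma picard_iterate_bound:
  fixes V :: "real \<Rightarrow> real \<Rightarrow> ennreal"
  assumes [measurable]: "K \<in> borel_measurable borel" "V\<^sub>0 \<in> borel_measurable borel"
    and r: "1 + (\<integral>\<^sup>+y. K y \<partial>lborel) = ennreal r" "0 \<le> r" and C: "0 \<le> C" and B: "0 \<le> B"
    and bd: "\<And>t x. t \<in> {0..T} \<Longrightarrow> V t x \<le> ennreal B"
    and V: "\<And>t x. t \<in> {0..T} \<Longrightarrow> V t x \<le> ennreal C * V\<^sub>0 x
        + ennreal C * (\<integral>\<^sup>+\<tau>. conv_step K (V \<tau>) x * indicator {0..t} \<tau> \<partial>lborel)"
    and t: "t \<in> {0..T}"
  shows "V t x \<le> (\<Sum>j<n. ennreal (exp_coeff C t j) * (conv_step K ^^ j) V\<^sub>0 x) + ennreal ((C * t * r) ^ n / fact n * B)"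
  using t
proof (induction n arbitrary: t x)
  case 0
  then show ?case using bd by simp
next
  case (Suc n)
  let ?J = "\<lambda>j. (conv_step K ^^ j) V\<^sub>0"
  have step: "conv_step K (V \<tau>) x \<le> (\<Sum>j<n. ennreal (C * C ^ j / fact j) * ?J (Suc j) x * ennreal (\<tau> ^ j))
      + ennreal (r * (C * r) ^ n / fact n * B) * ennreal (\<tau> ^ n)" if \<tau>: "\<tau> \<in> {0..T}" for \<tau>
  proof -
    let ?R = "ennreal ((C * \<tau> * r) ^ n / fact n * B)"
    have "conv_step K (V \<tau>) x \<le> conv_step K (\<lambda>x. 1 * (\<Sum>j<n. ennreal (exp_coeff C \<tau> j) * ?J j x) + ?R * 1) x"
      using Suc.IH[OF \<tau>] by (intro conv_step_mono) simp
    also have "\<dots> = conv_step K (\<lambda>x. \<Sum>j<n. ennreal (exp_coeff C \<tau> j) * ?J j x) x + ?R * conv_step K (\<lambda>_. 1) x"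
      by (subst conv_step_linear) auto
    also have "conv_step K (\<lambda>_. 1) x = ennreal r" using conv_step_power_const[of K 1 1] r by simp
    also have "conv_step K (\<lambda>x. \<Sum>j<n. ennreal (exp_coeff C \<tau> j) * ?J j x) x = (\<Sum>j<n. ennreal (exp_coeff C \<tau> j) * ?J (Suc j) x)"
      by (subst conv_step_sum) auto
    \<comment> \<open>The powers of \<tau> are separated so that the time integral acts on monomials
      only.\<close>
    also have "(\<Sum>j<n. ennreal (exp_coeff C \<tau> j) * ?J (Suc j) x) = (\<Sum>j<n. ennreal (C * C ^ j / fact j) * ?J (Suc j) x * ennreal (\<tau> ^ j))"
    proof (intro sum.cong refl)
      fix j
      have "ennreal (exp_coeff C \<tau> j) = ennreal (C * C ^ j / fact j) * ennreal (\<tau> ^ j)"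
        using \<tau> C by (simp add: exp_coeff_def power_mult_distrib flip: ennreal_mult)
      then show "ennreal (exp_coeff C \<tau> j) * ?J (Suc j) x = ennreal (C * C ^ j / fact j) * ?J (Suc j) x * ennreal (\<tau> ^ j)"
        by (simp only: mult_ac)
    qed
    also have "?R * ennreal r = ennreal (r * (C * r) ^ n / fact n * B) * ennreal (\<tau> ^ n)"
      using \<tau> C r B by (simp add: power_mult_distrib mult_ac flip: ennreal_mult)
    finally show ?thesis .
  qed
  have t: "0 \<le> t" using Suc.prems by simp
  have "(\<integral>\<^sup>+\<tau>. conv_step K (V \<tau>) x * indicator {0..t} \<tau> \<partial>lborel)
      \<le> (\<integral>\<^sup>+\<tau>. (\<Sum>j<n. ennreal (C * C ^ j / fact j) * ?J (Suc j) x * (ennreal (\<tau> ^ j) * indicator {0..t} \<tau>))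
      + ennreal (r * (C * r) ^ n / fact n * B) * (ennreal (\<tau> ^ n) * indicator {0..t} \<tau>) \<partial>lborel)"
  proof (rule nn_integral_mono)
    fix \<tau>
    show "conv_step K (V \<tau>) x * indicator {0..t} \<tau> \<le> (\<Sum>j<n. ennreal (C * C ^ j / fact j) * ?J (Suc j) x * (ennreal (\<tau> ^ j) * indicator {0..t} \<tau>))
      + ennreal (r * (C * r) ^ n / fact n * B) * (ennreal (\<tau> ^ n) * indicator {0..t} \<tau>)"
      using step[of \<tau>] Suc.prems by (cases "\<tau> \<in> {0..t}") auto
  qed
  also have "\<dots> = (\<Sum>j<n. ennreal (C * C ^ j / fact j) * ?J (Suc j) x * ennreal (t ^ Suc j / real (Suc j)))
      + ennreal (r * (C * r) ^ n / fact n * B) * ennreal (t ^ Suc n / real (Suc n))"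
    by (simp add: nn_integral_add nn_integral_sum nn_integral_cmult nn_integral_power_Icc[OF t] del: of_nat_Suc)
  finally have int: "(\<integral>\<^sup>+\<tau>. conv_step K (V \<tau>) x * indicator {0..t} \<tau> \<partial>lborel) \<le> \<dots>" .
  have "V t x \<le> ennreal C * V\<^sub>0 x + ennreal C * ((\<Sum>j<n. ennreal (C * C ^ j / fact j) * ?J (Suc j) x * ennreal (t ^ Suc j / real (Suc j)))
      + ennreal (r * (C * r) ^ n / fact n * B) * ennreal (t ^ Suc n / real (Suc n)))"
    by (rule order_trans[OF V[OF Suc.prems] add_left_mono[OF mult_left_mono[OF int]]]) simp
  also have "\<dots> = ennreal C * V\<^sub>0 x + (\<Sum>j<n. ennreal C * (ennreal (C * C ^ j / fact j) * ?J (Suc j) x * ennreal (t ^ Suc j / real (Suc j))))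
      + ennreal C * (ennreal (r * (C * r) ^ n / fact n * B) * ennreal (t ^ Suc n / real (Suc n)))"
    by (simp only: distrib_left sum_distrib_left add.assoc)
  also have "(\<Sum>j<n. ennreal C * (ennreal (C * C ^ j / fact j) * ?J (Suc j) x * ennreal (t ^ Suc j / real (Suc j)))) = (\<Sum>j<n. ennreal (exp_coeff C t (Suc j)) * ?J (Suc j) x)"
  proof (intro sum.cong refl)
    fix j
    have "ennreal C * ennreal (C * C ^ j / fact j) * ennreal (t ^ Suc j / real (Suc j)) = ennreal (exp_coeff C t (Suc j))"
      using t C by (simp add: exp_coeff_def power_mult_distrib field_simps flip: ennreal_mult)
    then show "ennreal C * (ennreal (C * C ^ j / fact j) * ?J (Suc j) x * ennreal (t ^ Suc j / real (Suc j))) = ennreal (exp_coeff C t (Suc j)) * ?J (Suc j) x"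
      by (metis mult.assoc mult.commute)
  qed
  also have "ennreal C * (ennreal (r * (C * r) ^ n / fact n * B) * ennreal (t ^ Suc n / real (Suc n))) = ennreal ((C * t * r) ^ Suc n / fact (Suc n) * B)"
    using t C r B by (simp add: power_mult_distrib field_simps flip: ennreal_mult)
  also have "ennreal C * V\<^sub>0 x = ennreal (exp_coeff C t 0) * ?J 0 x" by (simp add: exp_coeff_def)
  finally show ?case
    by (simp only: sum.lessThan_Suc_shift)
qed

text \<open>The factorial drives the remainder to 0 at every point, and the coefficients increase
  with time, so they may be taken at \<open>T\<close>.\<close>

lemma conv_series_bound:
  fixes V :: "real \<Rightarrow> real \<Rightarrow> ennreal"
  assumes m: "K \<in> borel_measurable borel" "V\<^sub>0 \<in> borel_measurable borel"
    and r: "1 + (\<integral>\<^sup>+y. K y \<partial>lborel) = ennreal r" "0 \<le> r" and C: "0 \<le> C" and B: "0 \<le> B"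
    and bd: "\<And>t x. t \<in> {0..T} \<Longrightarrow> V t x \<le> ennreal B"
    and V: "\<And>t x. t \<in> {0..T} \<Longrightarrow> V t x \<le> ennreal C * V\<^sub>0 x
        + ennreal C * (\<integral>\<^sup>+\<tau>. conv_step K (V \<tau>) x * indicator {0..t} \<tau> \<partial>lborel)"
    and t: "t \<in> {0..T}"
  shows "V t x \<le> conv_series (exp_coeff C T) K V\<^sub>0 x"
proof (rule LIMSEQ_le_const)
  have "(\<lambda>n. (C * t * r) ^ n /\<^sub>R fact n) \<longlonglongrightarrow> 0" by (rule summable_LIMSEQ_zero[OF summable_exp_generic])
  then have "(\<lambda>n. (C * t * r) ^ n / fact n * B) \<longlonglongrightarrow> 0"
    by (intro tendsto_mult_left_zero) (simp add: divide_inverse mult.commute)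
  then have "(\<lambda>n. ennreal ((C * t * r) ^ n / fact n * B)) \<longlonglongrightarrow> ennreal 0" by (rule tendsto_ennrealI)
  from tendsto_add[OF tendsto_const this]
  show "(\<lambda>n. conv_series (exp_coeff C T) K V\<^sub>0 x + ennreal ((C * t * r) ^ n / fact n * B)) \<longlonglongrightarrow> conv_series (exp_coeff C T) K V\<^sub>0 x"
    by simp
  show "\<exists>N. \<forall>n\<ge>N. V t x \<le> conv_series (exp_coeff C T) K V\<^sub>0 x + ennreal ((C * t * r) ^ n / fact n * B)"
  proof (intro exI allI impI)
    fix n
    have "(\<Sum>j<n. ennreal (exp_coeff C t j) * (conv_step K ^^ j) V\<^sub>0 x) \<le> (\<Sum>j<n. ennreal (exp_coeff C T j) * (conv_step K ^^ j) V\<^sub>0 x)"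
      using t C unfolding exp_coeff_def
      by (intro sum_mono mult_right_mono ennreal_leI divide_right_mono mult_left_mono power_mono) auto
    also have "\<dots> \<le> conv_series (exp_coeff C T) K V\<^sub>0 x" unfolding conv_series_def by (intro sum_le_suminf) auto
    finally show "V t x \<le> conv_series (exp_coeff C T) K V\<^sub>0 x + ennreal ((C * t * r) ^ n / fact n * B)"
      using picard_iterate_bound[where V=V, OF m r C B bd V t, of x n] add_right_mono order_trans by blast
  qed
qed

lemma conv_series_weight:
  fixes \<phi> :: "real \<Rightarrow> ennreal"
  assumes "K\<^sub>1 \<in> borel_measurable borel" "h \<in> borel_measurable borel"
    and "\<And>x y. \<phi> x * K\<^sub>1 (x - y) \<le> K\<^sub>2 (x - y) * \<phi> y"
  shows "\<phi> x * conv_series a K\<^sub>1 h x \<le> conv_series a K\<^sub>2 (\<lambda>x. \<phi> x * h x) x"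
proof -
  have "\<phi> x * conv_series a K\<^sub>1 h x = (\<Sum>n. \<phi> x * (ennreal (a n) * (conv_step K\<^sub>1 ^^ n) h x))"
    by (simp add: conv_series_def)
  also have "\<dots> \<le> conv_series a K\<^sub>2 (\<lambda>x. \<phi> x * h x) x"
    unfolding conv_series_def
  proof (intro suminf_le)
    fix n
    have "ennreal (a n) * (\<phi> x * (conv_step K\<^sub>1 ^^ n) h x) \<le> ennreal (a n) * (conv_step K\<^sub>2 ^^ n) (\<lambda>x. \<phi> x * h x) x"
      by (intro mult_left_mono conv_step_power_weight assms) simp
    then show "\<phi> x * (ennreal (a n) * (conv_step K\<^sub>1 ^^ n) h x) \<le> ennreal (a n) * (conv_step K\<^sub>2 ^^ n) (\<lambda>x. \<phi> x * h x) x"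
      by (subst mult.left_commute)
  qed auto
  finally show ?thesis .
qed

text \<open>The number \<open>r\<close> is the factor by which one step acts on constants and on
  integrals; summing the coefficients against r^n gives \<open>\<Lambda>\<close>, the corresponding
  factor for the whole series.\<close>

locale neumann_kernel =
  fixes K :: "real \<Rightarrow> ennreal" and r C T \<Lambda> :: real
  assumes K [measurable]: "K \<in> borel_measurable borel" and r: "1 + (\<integral>\<^sup>+y. K y \<partial>lborel) = ennreal r" "0 \<le> r"
    and C: "0 < C" and T: "0 \<le> T"
  defines "\<Lambda> \<equiv> C * exp (C * T * r)"
begin

abbreviation S :: "(real \<Rightarrow> ennreal) \<Rightarrow> real \<Rightarrow> ennreal" where "S \<equiv> conv_series (exp_coeff C T) K"

lemma coeff_nonneg: "0 \<le> exp_coeff C T n" using C T by (simp add: exp_coeff_def)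

lemma \<Lambda>_pos: "0 < \<Lambda>" using C by (simp add: \<Lambda>_def)

lemma coeff_sum: "(\<Sum>n. ennreal (exp_coeff C T n) * ((1 + (\<integral>\<^sup>+y. K y \<partial>lborel)) ^ n * c)) = ennreal \<Lambda> * c"
proof -
  have "(\<lambda>n. C * ((C * T * r) ^ n /\<^sub>R fact n)) sums (C * exp (C * T * r))" by (intro sums_mult exp_converges)
  moreover have "C * ((C * T * r) ^ n /\<^sub>R fact n) = exp_coeff C T n * r ^ n" for n
    by (simp add: exp_coeff_def power_mult_distrib field_simps)
  ultimately have s: "(\<lambda>n. exp_coeff C T n * r ^ n) sums \<Lambda>" by (simp add: \<Lambda>_def)
  have "(\<Sum>n. ennreal (exp_coeff C T n) * (ennreal r ^ n * c)) = (\<Sum>n. ennreal (exp_coeff C T n * r ^ n) * c)"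
    using r by (simp add: ennreal_mult coeff_nonneg ennreal_power mult.assoc)
  also have "\<dots> = (\<Sum>n. ennreal (exp_coeff C T n * r ^ n)) * c" by simp
  also have "(\<Sum>n. ennreal (exp_coeff C T n * r ^ n)) = ennreal \<Lambda>" using s r coeff_nonneg by (intro suminf_ennreal_eq) auto
  finally show ?thesis using r by simp
qed

lemma S_const: "S (\<lambda>_. c) x = ennreal \<Lambda> * c" unfolding conv_series_def conv_step_power_const[OF K] by (rule coeff_sum)

lemma S_mono: "(\<And>x. h x \<le> h' x) \<Longrightarrow> S h x \<le> S h' x"
  unfolding conv_series_def by (intro suminf_le mult_left_mono conv_step_power_mono) auto

lemma S_linear:
  assumes [measurable]: "h \<in> borel_measurable borel" "h' \<in> borel_measurable borel"
  shows "S (\<lambda>x. c * h x + c' * h' x) x = c * S h x + c' * S h' x"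
proof -
  have "S (\<lambda>x. c * h x + c' * h' x) x = (\<Sum>n. c * (ennreal (exp_coeff C T n) * (conv_step K ^^ n) h x) + c' * (ennreal (exp_coeff C T n) * (conv_step K ^^ n) h' x))"
    unfolding conv_series_def by (simp add: conv_step_power_linear algebra_simps)
  also have "\<dots> = (\<Sum>n. c * (ennreal (exp_coeff C T n) * (conv_step K ^^ n) h x)) + (\<Sum>n. c' * (ennreal (exp_coeff C T n) * (conv_step K ^^ n) h' x))"
    by (rule suminf_add[symmetric]) auto
  finally show ?thesis unfolding conv_series_def by simp
qed

lemma S_measurable [measurable (raw)]:
  assumes [measurable]: "h \<in> borel_measurable borel"
  shows "S h \<in> borel_measurable borel"
  unfolding conv_series_def by measurable

lemma S_nn_integral:
  assumes [measurable]: "h \<in> borel_measurable borel"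
  shows "(\<integral>\<^sup>+x. S h x \<partial>lborel) = ennreal \<Lambda> * (\<integral>\<^sup>+x. h x \<partial>lborel)"
  unfolding conv_series_def
  by (subst nn_integral_suminf) (auto simp: nn_integral_cmult conv_step_power_nn_integral coeff_sum)

text \<open>Jensen's inequality for the positive operator \<open>S\<close>: the tangent line of \<open>y \<mapsto> y\<^sup>p\<close> at \<open>a\<close>
  lies below the graph, and \<open>S\<close> preserves this inequality; then take \<open>a = Z / \<Lambda>\<close>.\<close>

lemma S_jensen:
  fixes Z\<^sub>0 :: "real \<Rightarrow> real"
  assumes p: "1 \<le> p" and [measurable]: "Z\<^sub>0 \<in> borel_measurable borel" and Z0: "\<And>y. 0 \<le> Z\<^sub>0 y"
    and Z: "ennreal Z \<le> S (\<lambda>y. ennreal (Z\<^sub>0 y)) x" "0 \<le> Z"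
  shows "ennreal (Z powr p) \<le> ennreal (\<Lambda> powr (p - 1)) * S (\<lambda>y. ennreal (Z\<^sub>0 y powr p)) x"
proof (cases "Z = 0")
  case False
  define a where "a = Z / \<Lambda>"
  have a: "0 < a" using False Z(2) \<Lambda>_pos by (simp add: a_def)
  have Z_eq: "Z = a * \<Lambda>" using \<Lambda>_pos by (simp add: a_def)
  have tangent: "p * a powr (p - 1) * y \<le> y powr p + (p - 1) * a powr p" if y: "0 \<le> y" for y
  proof (cases "y = 0")
    case True
    then show ?thesis using p by simp
  next
    case False
    then have y: "0 < y" using y by simp
    \<comment> \<open>Young's inequality for y^p and a^p with weights 1/p and 1 - 1/p; multiplied by
      p it is the tangent line inequality.\<close>
    have "(y powr p) powr (1 / p) * (a powr p) powr (1 - 1 / p) \<le> (1 / p) * y powr p + (1 - 1 / p) * a powr p"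
      using p y a by (intro Youngs_inequality_0) auto
    moreover have "p * (1 / p) = 1" "p * (1 - 1 / p) = p - 1" using p by (simp_all add: right_diff_distrib)
    then have "(y powr p) powr (1 / p) = y" "(a powr p) powr (1 - 1 / p) = a powr (p - 1)"
      using y by (simp_all only: powr_powr powr_one[OF less_imp_le[OF y]])
    ultimately have "p * (y * a powr (p - 1)) \<le> p * ((1 / p) * y powr p + (1 - 1 / p) * a powr p)"
      using p by (intro mult_left_mono) auto
    also have "\<dots> = y powr p + (p - 1) * a powr p" using p by (simp add: algebra_simps)
    finally show ?thesis by (simp add: mult_ac)
  qed
  let ?q = "(p - 1) * a powr p"
  have q0: "0 \<le> ?q" using p by simp
  have "ennreal (p * a powr (p - 1)) * ennreal Z \<le> ennreal (p * a powr (p - 1)) * S (\<lambda>y. ennreal (Z\<^sub>0 y)) x"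
    by (intro mult_left_mono Z) simp
  also have "\<dots> = S (\<lambda>y. ennreal (p * a powr (p - 1)) * ennreal (Z\<^sub>0 y) + 0 * ennreal (Z\<^sub>0 y)) x"
    by (subst S_linear) auto
  also have "\<dots> \<le> S (\<lambda>y. 1 * ennreal (Z\<^sub>0 y powr p) + ennreal ?q * 1) x"
  proof (rule S_mono)
    fix y
    have "ennreal (p * a powr (p - 1) * Z\<^sub>0 y) \<le> ennreal (Z\<^sub>0 y powr p + ?q)" by (intro ennreal_leI tangent Z0)
    then show "ennreal (p * a powr (p - 1)) * ennreal (Z\<^sub>0 y) + 0 * ennreal (Z\<^sub>0 y) \<le> 1 * ennreal (Z\<^sub>0 y powr p) + ennreal ?q * 1"
      using p Z0[of y] q0 by (simp add: ennreal_mult ennreal_plus)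
  qed
  also have "\<dots> = S (\<lambda>y. ennreal (Z\<^sub>0 y powr p)) x + ennreal ?q * ennreal \<Lambda>"
    by (subst S_linear) (auto simp: S_const)
  finally have main: "ennreal (p * a powr (p - 1)) * ennreal Z \<le> S (\<lambda>y. ennreal (Z\<^sub>0 y powr p)) x + ennreal ?q * ennreal \<Lambda>" .
  have ap: "a powr (p - 1) * a = a powr p" using a by (simp add: powr_diff)
  show ?thesis
  proof (cases "S (\<lambda>y. ennreal (Z\<^sub>0 y powr p)) x")
    case (real s)
    have "p * a powr (p - 1) * Z \<le> s + ?q * \<Lambda>"
      using main real p Z(2) q0 \<Lambda>_pos by (simp add: ennreal_mult[symmetric] ennreal_plus[symmetric] del: ennreal_plus)
    \<comment> \<open>With Z = a \<Lambda> the slope term becomes p a^p \<Lambda>, and the constant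
      term of the tangent cancels all but one copy of a^p \<Lambda>.\<close>
    then have "p * (a powr p * \<Lambda>) \<le> s + (p - 1) * (a powr p * \<Lambda>)" unfolding Z_eq ap[symmetric] by (simp add: mult_ac)
    then have "a powr p * \<Lambda> \<le> s" by (simp add: algebra_simps)
    then have "\<Lambda> powr (p - 1) * (a powr p * \<Lambda>) \<le> \<Lambda> powr (p - 1) * s" by (intro mult_left_mono) auto
    moreover have "\<Lambda> powr (p - 1) * (a powr p * \<Lambda>) = Z powr p"
      unfolding Z_eq using a \<Lambda>_pos by (simp add: powr_mult powr_diff)
    ultimately show ?thesis using real by (simp add: ennreal_mult[symmetric] ennreal_leI)
  next
    case top
    then show ?thesis using \<Lambda>_pos by (simp add: ennreal_mult_top)
  qed
qed (use p in simp)

text \<open>Jensen contributes \<Lambda>^(p-1) and integration of the series one more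
  \<open>\<Lambda>\<close>. The total \<Lambda>^p has p-th root \<open>\<Lambda>\<close>, whatever
  the exponent.\<close>

lemma S_Lp:
  fixes Z Z\<^sub>0 :: "real \<Rightarrow> real"
  assumes p: "1 \<le> p" and [measurable]: "Z\<^sub>0 \<in> borel_measurable borel" and Z0: "\<And>y. 0 \<le> Z\<^sub>0 y"
    and Z: "\<And>x. ennreal (Z x) \<le> S (\<lambda>y. ennreal (Z\<^sub>0 y)) x" "\<And>x. 0 \<le> Z x"
  shows "(\<integral>\<^sup>+x. ennreal (Z x powr p) \<partial>lborel) \<le> ennreal (\<Lambda> powr p) * (\<integral>\<^sup>+x. ennreal (Z\<^sub>0 x powr p) \<partial>lborel)"
proof -
  have "(\<integral>\<^sup>+x. ennreal (Z x powr p) \<partial>lborel) \<le> (\<integral>\<^sup>+x. ennreal (\<Lambda> powr (p - 1)) * S (\<lambda>y. ennreal (Z\<^sub>0 y powr p)) x \<partial>lborel)"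
    by (intro nn_integral_mono S_jensen p Z0 Z) auto
  also have "\<dots> = ennreal (\<Lambda> powr (p - 1)) * (ennreal \<Lambda> * (\<integral>\<^sup>+x. ennreal (Z\<^sub>0 x powr p) \<partial>lborel))"
    by (simp add: nn_integral_cmult S_nn_integral)
  also have "\<dots> = ennreal (\<Lambda> powr p) * (\<integral>\<^sup>+x. ennreal (Z\<^sub>0 x powr p) \<partial>lborel)"
    using \<Lambda>_pos by (simp add: mult.assoc[symmetric] powr_diff flip: ennreal_mult)
  finally show ?thesis .
qed

end

section \<open>Norms and weights\<close>

text \<open>For continuous \<open>h\<close> the set where the bound fails is open; being null, it is
  empty. Essential bounds thus become bounds at every point.\<close>

lemma Lp_norm_top_le_iff:
  fixes h :: "real \<Rightarrow> real"
  assumes "continuous_on UNIV h"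
  shows "Lp_norm \<infinity> h \<le> c \<longleftrightarrow> (\<forall>x. ennreal \<bar>h x\<bar> \<le> c)"
proof
  have [measurable]: "h \<in> borel_measurable borel" using assms by (rule borel_measurable_continuous_onI)
  assume "\<forall>x. ennreal \<bar>h x\<bar> \<le> c"
  then show "Lp_norm \<infinity> h \<le> c" unfolding Lp_norm_def by (auto intro!: esssup_I)
next
  assume le: "Lp_norm \<infinity> h \<le> c"
  show "\<forall>x. ennreal \<bar>h x\<bar> \<le> c"
  proof (rule ccontr)
    assume "\<not> ?thesis"
    then obtain x where x: "c < ennreal \<bar>h x\<bar>" by (auto simp: not_le)
    obtain d where d: "c = ennreal d" "0 \<le> d"
      using x by (cases c) auto
    have ae: "AE y in lborel. \<bar>h y\<bar> \<le> d"
      using esssup_AE[of "\<lambda>x. ennreal (norm (h x))" lborel] le d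
      by (auto simp: Lp_norm_def ennreal_le_iff elim!: eventually_mono dest: order_trans)
    let ?S = "{y. d < \<bar>h y\<bar>}"
    have "open ?S" by (intro open_Collect_less continuous_intros assms)
    moreover have "x \<in> ?S" using x d by (simp add: ennreal_less_iff)
    ultimately have "\<not> negligible ?S" by (intro open_not_negligible) auto
    moreover have "?S \<in> null_sets lborel" using ae \<open>open ?S\<close> by (subst AE_iff_null_sets) (auto simp: not_less)
    then have "negligible ?S" unfolding negligible_iff_null_sets by (rule null_sets_completionI)
    ultimately show False by simp
  qed
qed

lemma Lp_norm_finite_exponent_le:
  fixes Z Z\<^sub>0 :: "real \<Rightarrow> real"
  assumes p: "p \<noteq> \<infinity>" "0 < enn2real p" and c: "0 < c"
    and le: "(\<integral>\<^sup>+x. ennreal (\<bar>Z x\<bar> powr enn2real p) \<partial>lborel)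
      \<le> ennreal (c powr enn2real p) * (\<integral>\<^sup>+x. ennreal (\<bar>Z\<^sub>0 x\<bar> powr enn2real p) \<partial>lborel)"
  shows "Lp_norm p Z \<le> ennreal c * Lp_norm p Z\<^sub>0"
proof (cases "\<integral>\<^sup>+x. ennreal (\<bar>Z\<^sub>0 x\<bar> powr enn2real p) \<partial>lborel")
  case (real i)
  then have N0: "Lp_norm p Z\<^sub>0 = ennreal (i powr (1 / enn2real p))" using p by (simp add: Lp_norm_def ennreal_powr_def)
  have "(\<integral>\<^sup>+x. ennreal (\<bar>Z x\<bar> powr enn2real p) \<partial>lborel) \<le> ennreal ((c * i powr (1 / enn2real p)) powr enn2real p)"
    using le real p c by (simp add: powr_mult powr_powr ennreal_mult)
  then have "Lp_norm p Z \<le> ennreal (c * i powr (1 / enn2real p))" using p c by (simp add: Lp_norm_def ennreal_powr_le_iff)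
  then show ?thesis using c by (simp add: N0 ennreal_mult)
next
  case top
  then have "Lp_norm p Z\<^sub>0 = \<infinity>" using p by (simp add: Lp_norm_def ennreal_powr_def)
  then show ?thesis using c by (simp add: ennreal_mult_top)
qed

lemma Lp_norm_mono:
  fixes h k :: "real \<Rightarrow> real"
  assumes "continuous_on UNIV h" "continuous_on UNIV k" "1 \<le> p" and le: "\<And>x. \<bar>h x\<bar> \<le> \<bar>k x\<bar>"
  shows "Lp_norm p h \<le> Lp_norm p k"
proof (cases "p = \<infinity>")
  case True
  have "\<forall>x. ennreal \<bar>k x\<bar> \<le> Lp_norm \<infinity> k" using Lp_norm_top_le_iff[OF assms(2)] by blast
  then have "\<forall>x. ennreal \<bar>h x\<bar> \<le> Lp_norm \<infinity> k" using le ennreal_leI order_trans by blast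
  then show ?thesis using True Lp_norm_top_le_iff[OF assms(1)] by simp
next
  case False
  then have p: "0 < enn2real p" using assms(3) by (cases p) (auto simp flip: ennreal_1)
  have "Lp_norm p h \<le> ennreal 1 * Lp_norm p k"
    using p False by (intro Lp_norm_finite_exponent_le) (auto intro!: nn_integral_mono ennreal_leI powr_mono2 le)
  then show ?thesis by simp
qed

text \<open>A constant independent of \<open>p\<close> is all that matters, so Minkowski's
  inequality is replaced by (a + b)^r \<le> 2^r (a^r + b^r). The 4 is 2 times 2, the second one from
  \<alpha>^r + \<beta>^r \<le> 2 (\<alpha> + \<beta>)^r \<le> 2^r (\<alpha> + \<beta>)^r.\<close>

lemma Lp_norm_sum_le:
  fixes h k :: "real \<Rightarrow> real"
  assumes cont: "continuous_on UNIV h" "continuous_on UNIV k" and "1 \<le> p"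
  shows "Lp_norm p (\<lambda>x. \<bar>h x\<bar> + \<bar>k x\<bar>) \<le> 4 * (Lp_norm p h + Lp_norm p k)"
proof (cases "p = \<infinity>")
  case True
  have "ennreal \<bar>h x\<bar> \<le> Lp_norm \<infinity> h" "ennreal \<bar>k x\<bar> \<le> Lp_norm \<infinity> k" for x
    using Lp_norm_top_le_iff[OF cont(1)] Lp_norm_top_le_iff[OF cont(2)] by blast+
  then have "ennreal \<bar>\<bar>h x\<bar> + \<bar>k x\<bar>\<bar> \<le> 1 * (Lp_norm \<infinity> h + Lp_norm \<infinity> k)" for x
    by (auto intro: add_mono)
  also have "\<dots> \<le> 4 * (Lp_norm \<infinity> h + Lp_norm \<infinity> k)" by (intro mult_right_mono) auto
  finally show ?thesis unfolding True
    by (subst Lp_norm_top_le_iff) (auto intro!: continuous_intros cont)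
next
  case False
  define r where "r = enn2real p"
  have r: "1 \<le> r" using False assms(3) by (cases p) (auto simp: r_def simp flip: ennreal_1)
  have [measurable]: "h \<in> borel_measurable borel" "k \<in> borel_measurable borel"
    using cont by (auto intro: borel_measurable_continuous_onI)
  show ?thesis
  proof (cases "Lp_norm p h + Lp_norm p k")
    case top
    then show ?thesis unfolding top by (simp add: ennreal_mult_top)
  next
    case (real N)
    then obtain \<alpha> \<beta> where ab: "Lp_norm p h = ennreal \<alpha>" "0 \<le> \<alpha>" "Lp_norm p k = ennreal \<beta>" "0 \<le> \<beta>"
      by (cases "Lp_norm p h"; cases "Lp_norm p k") auto
    have int: "(\<integral>\<^sup>+x. ennreal (\<bar>h x\<bar> powr r) \<partial>lborel) \<le> ennreal (\<alpha> powr r)"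
      "(\<integral>\<^sup>+x. ennreal (\<bar>k x\<bar> powr r) \<partial>lborel) \<le> ennreal (\<beta> powr r)"
      using ab False r by (auto simp: Lp_norm_def simp flip: r_def intro!: ennreal_powr_le_iff[THEN iffD1])
    have conv: "(\<bar>a\<bar> + \<bar>b\<bar>) powr r \<le> 2 powr r * (\<bar>a\<bar> powr r + \<bar>b\<bar> powr r)" for a b :: real
    proof -
      have "(\<bar>a\<bar> + \<bar>b\<bar>) powr r \<le> (2 * max \<bar>a\<bar> \<bar>b\<bar>) powr r" using r by (intro powr_mono2) auto
      also have "\<dots> = 2 powr r * (max \<bar>a\<bar> \<bar>b\<bar>) powr r" by (simp add: powr_mult)
      also have "\<dots> \<le> 2 powr r * (\<bar>a\<bar> powr r + \<bar>b\<bar> powr r)" by (intro mult_left_mono) (auto simp: max_def)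
      finally show ?thesis .
    qed
    have "(\<integral>\<^sup>+x. ennreal ((\<bar>h x\<bar> + \<bar>k x\<bar>) powr r) \<partial>lborel)
        \<le> (\<integral>\<^sup>+x. ennreal (2 powr r) * (ennreal (\<bar>h x\<bar> powr r) + ennreal (\<bar>k x\<bar> powr r)) \<partial>lborel)"
      using conv by (intro nn_integral_mono) (simp add: ennreal_leI flip: ennreal_mult ennreal_plus)
    also have "\<dots> = ennreal (2 powr r) * ((\<integral>\<^sup>+x. ennreal (\<bar>h x\<bar> powr r) \<partial>lborel) + (\<integral>\<^sup>+x. ennreal (\<bar>k x\<bar> powr r) \<partial>lborel))"
      by (simp add: nn_integral_cmult nn_integral_add)
    also have "\<dots> \<le> ennreal (2 powr r) * (ennreal (\<alpha> powr r) + ennreal (\<beta> powr r))"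
      by (intro mult_left_mono add_mono int) auto
    also have "\<dots> = ennreal (2 powr r * (\<alpha> powr r + \<beta> powr r))" by (simp flip: ennreal_mult ennreal_plus)
    also have "\<dots> \<le> ennreal ((4 * (\<alpha> + \<beta>)) powr r)"
    proof (rule ennreal_leI)
      have "\<alpha> powr r \<le> (\<alpha> + \<beta>) powr r" "\<beta> powr r \<le> (\<alpha> + \<beta>) powr r"
        using ab r by (auto intro!: powr_mono2)
      moreover have "2 \<le> (2::real) powr r" using powr_mono[of 1 r 2] r by simp
      ultimately have "\<alpha> powr r + \<beta> powr r \<le> 2 powr r * (\<alpha> + \<beta>) powr r"
        using mult_right_mono[of 2 "2 powr r" "(\<alpha> + \<beta>) powr r"] by simp
      then have "2 powr r * (\<alpha> powr r + \<beta> powr r) \<le> 2 powr r * (2 powr r * (\<alpha> + \<beta>) powr r)"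
        by (intro mult_left_mono) auto
      also have "\<dots> = (4 * (\<alpha> + \<beta>)) powr r" by (simp only: mult.assoc[symmetric] powr_mult[symmetric]) simp
      finally show "2 powr r * (\<alpha> powr r + \<beta> powr r) \<le> (4 * (\<alpha> + \<beta>)) powr r" .
    qed
    finally have "(\<integral>\<^sup>+x. ennreal (\<bar>\<bar>h x\<bar> + \<bar>k x\<bar>\<bar> powr r) \<partial>lborel) \<le> ennreal ((4 * (\<alpha> + \<beta>)) powr r)"
      by simp
    then have "Lp_norm p (\<lambda>x. \<bar>h x\<bar> + \<bar>k x\<bar>) \<le> ennreal (4 * (\<alpha> + \<beta>))"
      using False r ab(2,4) ennreal_powr_le_iff[of r "4 * (\<alpha> + \<beta>)"]
      by (simp add: Lp_norm_def flip: r_def del: distrib_left_numeral)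
    also have "\<dots> = 4 * (Lp_norm p h + Lp_norm p k)" using ab by (simp add: ennreal_mult)
    finally show ?thesis .
  qed
qed

lemma locally_absolutely_continuous_imp_continuous:
  assumes "locally_absolutely_continuous \<phi>"
  shows "continuous_on UNIV \<phi>"
  unfolding continuous_on_iff
proof (intro ballI allI impI)
  fix x e :: real assume "0 < e"
  moreover have "absolutely_continuous_on (x - 1) (x + 1) \<phi>" using assms by (simp add: locally_absolutely_continuous_def)
  ultimately obtain d where d: "0 < d" "\<And>D. finite D \<Longrightarrow> (\<forall>(a, b)\<in>D. x - 1 \<le> a \<and> a \<le> b \<and> b \<le> x + 1) \<Longrightarrow>
        pairwise (\<lambda>I J. {fst I<..<snd I} \<inter> {fst J<..<snd J} = {}) D \<Longrightarrow>
        (\<Sum>(a, b)\<in>D. b - a) < d \<Longrightarrow> (\<Sum>(a, b)\<in>D. \<bar>\<phi> b - \<phi> a\<bar>) < e"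
    unfolding absolutely_continuous_on_def by meson
  show "\<exists>d>0. \<forall>y\<in>UNIV. dist y x < d \<longrightarrow> dist (\<phi> y) (\<phi> x) < e"
  proof (intro exI[of _ "min 1 d"] conjI ballI impI)
    fix y assume y: "dist y x < min 1 d"
    \<comment> \<open>A family consisting of one interval reduces absolute continuity to
      continuity.\<close>
    have "(\<Sum>(a, b)\<in>{(min x y, max x y)}. \<bar>\<phi> b - \<phi> a\<bar>) < e" using y by (intro d(2)) (auto simp: dist_real_def)
    then show "dist (\<phi> y) (\<phi> x) < e" by (auto simp: dist_real_def min_def max_def split: if_splits)
  qed (use d in auto)
qed

lemma Lp_norm_1: "Lp_norm 1 h = (\<integral>\<^sup>+x. ennreal (norm (h x)) \<partial>lborel)"
proof (cases "\<integral>\<^sup>+x. ennreal (norm (h x)) \<partial>lborel")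
  case (real r)
  then show ?thesis by (simp add: Lp_norm_def ennreal_powr_def)
next
  case top
  then show ?thesis by (simp add: Lp_norm_def ennreal_powr_def)
qed

text \<open>Integrate \<open>2 \<surd>v(x) \<le> 2 \<surd>(v(y) v(x - y)) \<le> v(y) + v(x - y)\<close> over \<open>0 \<le> y \<le> 1\<close>.\<close>

lemma submultiplicative_growth:
  assumes v: "weight_function v" "submultiplicative v"
    and N: "(\<integral>\<^sup>+x. ennreal (exp (- \<bar>x\<bar>) * v x) \<partial>lborel) = ennreal N" "0 \<le> N"
  shows "v x \<le> (N * exp (1 + \<bar>x\<bar>))\<^sup>2"
proof -
  have pos: "0 < v y" for y using v by (simp add: weight_function_def)
  have [measurable]: "v \<in> borel_measurable borel" using v by (auto simp: weight_function_def intro: borel_measurable_continuous_onI)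
  let ?w = "\<lambda>y. ennreal (exp (- \<bar>y\<bar>) * v y)"
  \<comment> \<open>For 0 \<le> y \<le> 1 both |y| and |x - y| are at most 1 + |x|, so this
    exponential lies below both weights under the integrals.\<close>
  let ?c = "2 * exp (- (1 + \<bar>x\<bar>)) * sqrt (v x)"
  have le: "ennreal ?c * indicator {0..1} y \<le> ?w y + ?w (x - y)" for y
  proof (cases "y \<in> {0..1}")
    case True
    have "v x \<le> v y * v (x - y)" using v(2) unfolding submultiplicative_def by (metis add.commute diff_add_cancel)
    then have "sqrt (v x) \<le> sqrt (v y * v (x - y))" by simp
    also have "\<dots> \<le> (v y + v (x - y)) / 2" using pos by (intro arith_geo_mean_sqrt) (auto intro: less_imp_le)
    finally have "2 * sqrt (v x) \<le> v y + v (x - y)" by simp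
    then have "exp (- (1 + \<bar>x\<bar>)) * (2 * sqrt (v x)) \<le> exp (- (1 + \<bar>x\<bar>)) * (v y + v (x - y))"
      by (intro mult_left_mono) auto
    also have "\<dots> = exp (- (1 + \<bar>x\<bar>)) * v y + exp (- (1 + \<bar>x\<bar>)) * v (x - y)" by (simp add: distrib_left)
    also have "\<dots> \<le> exp (- \<bar>y\<bar>) * v y + exp (- \<bar>x - y\<bar>) * v (x - y)"
      using True pos[of y] pos[of "x - y"] by (intro add_mono mult_right_mono) auto
    finally have "ennreal ?c \<le> ennreal (exp (- \<bar>y\<bar>) * v y + exp (- \<bar>x - y\<bar>) * v (x - y))"
      by (intro ennreal_leI) (simp add: mult_ac)
    then show ?thesis using True pos[of y] pos[of "x - y"] by (simp add: ennreal_plus less_imp_le)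
  qed simp
  have "ennreal ?c = (\<integral>\<^sup>+y. ennreal ?c * indicator {0..1::real} y \<partial>lborel)"
    by (simp add: nn_integral_cmult_indicator)
  also have "\<dots> \<le> (\<integral>\<^sup>+y. ?w y + ?w (x - y) \<partial>lborel)" by (intro nn_integral_mono le)
  also have "\<dots> = (\<integral>\<^sup>+y. ?w y \<partial>lborel) + (\<integral>\<^sup>+y. ?w (x - y) \<partial>lborel)"
    by (rule nn_integral_add) measurable
  also have "(\<integral>\<^sup>+y. ?w (x - y) \<partial>lborel) = (\<integral>\<^sup>+y. ?w y \<partial>lborel)"
    by (rule nn_integral_reflect_shift(1)) measurable
  finally have "ennreal ?c \<le> ennreal (2 * N)" unfolding N(1) using N(2) by (simp flip: ennreal_plus)
  then have "?c \<le> 2 * N" using N(2) by (simp add: ennreal_le_iff)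
  then have "sqrt (v x) \<le> N * exp (1 + \<bar>x\<bar>)" by (simp add: exp_minus exp_diff exp_add field_simps)
  then have "(sqrt (v x))\<^sup>2 \<le> (N * exp (1 + \<bar>x\<bar>))\<^sup>2" using pos[of x] by (intro power_mono) auto
  then show ?thesis using pos[of x] by simp
qed

text \<open>The constant is moved to the side of \<open>f\<close> because \<open>g\<close> carries
  no measurability: it will be a convolution step of the solution as a function of time.\<close>

lemma nn_integral_le_cmult:
  assumes f: "f \<in> borel_measurable M" and c: "0 < c" and le: "\<And>x. f x \<le> ennreal c * g x"
  shows "(\<integral>\<^sup>+x. f x \<partial>M) \<le> ennreal c * (\<integral>\<^sup>+x. g x \<partial>M)"
proof -
  have inv: "ennreal c * (ennreal (1 / c) * y) = y" "ennreal (1 / c) * (ennreal c * y) = y" for y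
    using c by (simp_all add: mult.assoc[symmetric] ennreal_mult[symmetric])
  have "(\<integral>\<^sup>+x. f x \<partial>M) = ennreal c * (\<integral>\<^sup>+x. ennreal (1 / c) * f x \<partial>M)"
    using f by (simp add: nn_integral_cmult inv)
  also have "\<dots> \<le> ennreal c * (\<integral>\<^sup>+x. g x \<partial>M)"
    by (intro mult_left_mono nn_integral_mono) (metis inv(2) le mult_left_mono zero_le, simp)
  finally show ?thesis .
qed

lemma increment_le_nn_integral:
  fixes y d :: "real \<Rightarrow> real"
  assumes der: "\<And>\<tau>. \<tau> \<in> {0..T} \<Longrightarrow> (y has_real_derivative d \<tau>) (at \<tau> within {0..T})"
    and cont: "continuous_on {0..T} d" and t: "t \<in> {0..T}"
  shows "ennreal \<bar>y t - y 0\<bar> \<le> (\<integral>\<^sup>+\<tau>. ennreal \<bar>d \<tau>\<bar> * indicator {0..t} \<tau> \<partial>lborel)"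
proof -
  have sub: "{0..t} \<subseteq> {0..T}" using t by auto
  have "has_bochner_integral lborel (\<lambda>\<tau>. indicator {0..t} \<tau> *\<^sub>R d \<tau>) (y t - y 0)"
  proof (rule has_bochner_integral_FTC_Icc)
    show "(y has_vector_derivative d \<tau>) (at \<tau> within {0..t})" if "0 \<le> \<tau>" "\<tau> \<le> t" for \<tau>
      using DERIV_subset[OF der sub] that t by (simp add: has_real_derivative_iff_has_vector_derivative)
  qed (use t continuous_on_subset[OF cont sub] in auto)
  then have int: "integrable lborel (\<lambda>\<tau>. indicator {0..t} \<tau> *\<^sub>R d \<tau>)" and eq: "(LINT \<tau>|lborel. indicator {0..t} \<tau> *\<^sub>R d \<tau>) = y t - y 0"
    by (auto simp: has_bochner_integral_iff)
  have "ennreal (norm (y t - y 0)) \<le> (\<integral>\<^sup>+\<tau>. ennreal (norm (indicator {0..t} \<tau> *\<^sub>R d \<tau>)) \<partial>lborel)"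
    unfolding eq[symmetric] by (rule integral_norm_bound_ennreal[OF int])
  also have "\<dots> = (\<integral>\<^sup>+\<tau>. ennreal \<bar>d \<tau>\<bar> * indicator {0..t} \<tau> \<partial>lborel)"
    by (intro nn_integral_cong) (auto simp: indicator_def)
  finally show ?thesis by simp
qed

section \<open>The solution in Lagrangian coordinates\<close>

text \<open>\<open>B\<close> will be the quantity M of the statement, and \<open>C\<^sub>g\<close> a
  slope for \<open>g\<close> on [- B, B]. They are parameters so that every constant derived here is
  an expression in numbers and not in the solution.\<close>

locale bounded_hs_solution = hs_solution +
  fixes B C\<^sub>g :: real
  assumes u_bound: "t \<in> {0..T} \<Longrightarrow> \<bar>u t x\<bar> \<le> B"
    and ux_bound: "t \<in> {0..T} \<Longrightarrow> \<bar>deriv (u t) x\<bar> \<le> B"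
    and f'_bound: "t \<in> {0..T} \<Longrightarrow> \<bar>deriv f (u t x)\<bar> \<le> B"
    and f''_bound: "t \<in> {0..T} \<Longrightarrow> \<bar>deriv (deriv f) (u t x)\<bar> \<le> B"
    and g_bound: "\<bar>y\<bar> \<le> B \<Longrightarrow> \<bar>g y\<bar> \<le> C\<^sub>g * \<bar>y\<bar>" and Cg: "0 \<le> C\<^sub>g"
begin

lemma B_nonneg: "0 \<le> B" using u_bound[of 0 0] T by auto

lemma f'_lipschitz:
  assumes t: "t \<in> {0..T}"
  shows "\<bar>deriv f (u t x) - deriv f (u t y)\<bar> \<le> B * B * \<bar>x - y\<bar>"
proof -
  have d: "((\<lambda>x. deriv f (u t x)) has_real_derivative deriv (deriv f) (u t z) * deriv (u t) z) (at z)" for z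
    using smooth_has_derivative[OF f, of 1 "u t z"] by (intro DERIV_chain2[OF _ u_deriv[OF t]]) simp
  have "norm (deriv f (u t x) - deriv f (u t y)) \<le> B * B * norm (x - y)"
  proof (rule field_differentiable_bound[of UNIV "\<lambda>x. deriv f (u t x)" "\<lambda>z. deriv (deriv f) (u t z) * deriv (u t) z"])
    show "norm (deriv (deriv f) (u t z) * deriv (u t) z) \<le> B * B" for z
      unfolding real_norm_def abs_mult using t B_nonneg by (intro mult_mono f''_bound ux_bound) auto
  qed (use d in auto)
  then show ?thesis by simp
qed

sublocale lipschitz_field T B "B * B" "\<lambda>t x. deriv f (u t x)"
proof
  show "continuous_on ({0..T} \<times> UNIV) (\<lambda>(t, x). deriv f (u t x))"
    using smooth_continuous[OF f, of 1]
    by (intro time_continuous_joint time_continuous_compose[OF time_continuous_u]) simp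
qed (use T f'_bound f'_lipschitz B_nonneg in auto)

text \<open>A Lipschitz constant for every flow map and its inverse; the exponent is the Lipschitz
  constant \<open>B * B\<close> of f'(u) times the time span.\<close>

definition "E = exp (B * B * T)"

lemma E_ge_1: "1 \<le> E" using T B_nonneg by (simp add: E_def)

lemma P_flow_cont: "continuous_on {0..T} (\<lambda>\<tau>. P \<tau> (flow \<tau> x))"
  and Px_flow_cont: "continuous_on {0..T} (\<lambda>\<tau>. Px \<tau> (flow \<tau> x))"
  by (rule time_continuous_along[OF time_continuous_P flow_cont] time_continuous_along[OF time_continuous_Px flow_cont])+

lemma u_flow_deriv:
  "t \<in> {0..T} \<Longrightarrow> ((\<lambda>t. u t (flow t x)) has_real_derivative - P t (flow t x)) (at t within {0..T})"
  by (rule u_along_curve[OF _ flow_deriv])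

lemma u_flow_bound:
  assumes t: "t \<in> {0..T}"
  shows "ennreal \<bar>u t (flow t x)\<bar> \<le> ennreal \<bar>u 0 x\<bar> + (\<integral>\<^sup>+\<tau>. ennreal \<bar>P \<tau> (flow \<tau> x)\<bar> * indicator {0..t} \<tau> \<partial>lborel)"
proof -
  have "ennreal \<bar>u t (flow t x)\<bar> \<le> ennreal (\<bar>u 0 x\<bar> + \<bar>u t (flow t x) - u 0 x\<bar>)"
    by (intro ennreal_leI) linarith
  also have "\<dots> = ennreal \<bar>u 0 x\<bar> + ennreal \<bar>u t (flow t x) - u 0 (flow 0 x)\<bar>" by simp
  also have "ennreal \<bar>u t (flow t x) - u 0 (flow 0 x)\<bar> \<le> (\<integral>\<^sup>+\<tau>. ennreal \<bar>- P \<tau> (flow \<tau> x)\<bar> * indicator {0..t} \<tau> \<partial>lborel)"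
    by (rule increment_le_nn_integral[OF u_flow_deriv _ t]) (auto intro!: continuous_intros P_flow_cont)
  finally show ?thesis by (simp add: add_left_mono)
qed

text \<open>No equation for \<open>u\<^sub>x\<close> is available, as \<open>u\<^sub>x\<^sub>x\<close> need not be a function. Instead \<open>u\<close> is compared along
  two neighbouring characteristics, and their distance tends to \<open>0\<close>.\<close>

lemma ux_flow_bound:
  assumes t: "t \<in> {0..T}"
  shows "ennreal \<bar>deriv (u t) (flow t x)\<bar> \<le> ennreal E * ennreal \<bar>deriv (u 0) x\<bar>
    + ennreal (E * E) * (\<integral>\<^sup>+\<tau>. ennreal \<bar>Px \<tau> (flow \<tau> x)\<bar> * indicator {0..t} \<tau> \<partial>lborel)"
proof -
  define z where "z n = x + 1 / real (Suc n)" for n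
  have z_ne: "z n \<noteq> x" for n by (simp add: z_def)
  have z_lim: "z \<longlonglongrightarrow> x" unfolding z_def using tendsto_add[OF tendsto_const LIMSEQ_Suc[OF lim_1_over_n]] by simp
  define \<delta> where "\<delta> n \<tau> = flow \<tau> (z n) - flow \<tau> x" for n \<tau>
  have \<delta>_ne: "\<delta> n \<tau> \<noteq> 0" if "\<tau> \<in> {0..T}" for n \<tau> using flow_inj[OF that z_ne] by (simp add: \<delta>_def)
  have \<delta>_ge: "\<bar>z n - x\<bar> \<le> E * \<bar>\<delta> n \<tau>\<bar>" and \<delta>_le: "\<bar>\<delta> n \<tau>\<bar> \<le> E * \<bar>z n - x\<bar>" if "\<tau> \<in> {0..T}" for n \<tau>
    unfolding \<delta>_def E_def by (rule flow_gronwall[OF that])+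
  have flow_lim: "(\<lambda>n. flow \<tau> (z n)) \<longlonglongrightarrow> flow \<tau> x" if "\<tau> \<in> {0..T}" for \<tau>
    using flow_space_cont[OF that] z_lim
    by (intro isCont_tendsto_compose[of _ "flow \<tau>"]) (auto simp: continuous_on_eq_continuous_at)
  \<comment> \<open>Images of the neighbouring points converge to the image of \<open>x\<close>
    without ever meeting it, so they may be used in a difference quotient there.\<close>
  have quot: "(\<lambda>n. (h (flow \<tau> (z n)) - h (flow \<tau> x)) / \<delta> n \<tau>) \<longlonglongrightarrow> h'"
    if "\<tau> \<in> {0..T}" "(h has_real_derivative h') (at (flow \<tau> x))" for h h' \<tau>
  proof -
    have "((\<lambda>y. (h y - h (flow \<tau> x)) / (y - flow \<tau> x)) \<longlongrightarrow> h') (at (flow \<tau> x))"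
      using that(2) by (simp add: has_field_derivative_iff)
    moreover have "filterlim (\<lambda>n. flow \<tau> (z n)) (at (flow \<tau> x)) sequentially"
      using flow_lim[OF that(1)] flow_inj[OF that(1) z_ne] by (auto simp: filterlim_at)
    ultimately show ?thesis unfolding \<delta>_def by (rule filterlim_compose)
  qed
  \<comment> \<open>All three quotients divide by the distance of the two characteristics at the
    time in question, so their limits are the space derivatives of \<open>u\<close> at time
    \<open>t\<close>, of \<open>u\<close> at time 0 and of \<open>P\<close>.\<close>
  define a where "a n = \<bar>(u t (flow t (z n)) - u t (flow t x)) / \<delta> n t\<bar>" for n
  define b where "b n = \<bar>(u 0 (z n) - u 0 x) / \<delta> n 0\<bar>" for n
  define c where "c n \<tau> = \<bar>(P \<tau> (flow \<tau> (z n)) - P \<tau> (flow \<tau> x)) / \<delta> n \<tau>\<bar>" for n \<tau>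
  have a_lim: "a \<longlonglongrightarrow> \<bar>deriv (u t) (flow t x)\<bar>" unfolding a_def by (intro tendsto_rabs quot t u_deriv)
  have T0: "0 \<in> {0..T}" using T by simp
  have b_lim: "b \<longlonglongrightarrow> \<bar>deriv (u 0) x\<bar>"
    unfolding b_def using quot[OF T0 u_deriv[OF T0]] by (intro tendsto_rabs) simp
  have c_lim: "(\<lambda>n. c n \<tau>) \<longlonglongrightarrow> \<bar>Px \<tau> (flow \<tau> x)\<bar>" if "\<tau> \<in> {0..T}" for \<tau>
    unfolding c_def by (intro tendsto_rabs quot that P_deriv)
  obtain H where H: "0 \<le> H" "\<And>\<tau> y. \<tau> \<in> {0..T} \<Longrightarrow> \<bar>Px \<tau> y\<bar> \<le> H"
    using time_continuousD(3)[OF time_continuous_Px] by blast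
  have c_bound: "\<bar>c n \<tau>\<bar> \<le> H" if "\<tau> \<in> {0..T}" for n \<tau>
  proof -
    have "norm (P \<tau> (flow \<tau> (z n)) - P \<tau> (flow \<tau> x)) \<le> H * norm (flow \<tau> (z n) - flow \<tau> x)"
      by (rule field_differentiable_bound[of UNIV _ "Px \<tau>"]) (use P_deriv[OF that] H(2)[OF that] in auto)
    then show ?thesis using \<delta>_ne[OF that, of n] by (simp add: c_def \<delta>_def divide_le_eq)
  qed
  have c_cont: "continuous_on {0..T} (c n)" for n
    unfolding c_def \<delta>_def
    by (intro continuous_intros P_flow_cont flow_cont) (use flow_inj[OF _ z_ne] in auto)
  let ?I = "indicator {0..t} :: real \<Rightarrow> real"
  have sub: "{0..t} \<subseteq> {0..T}" using t by auto
  have meas: "(\<lambda>\<tau>. ?I \<tau> *\<^sub>R h \<tau>) \<in> borel_measurable borel" if "continuous_on {0..T} h" for h :: "real \<Rightarrow> real"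
    by (rule borel_measurable_continuous_on_indicator[OF _ continuous_on_subset[OF that sub]]) simp
  let ?N = "\<lambda>n. \<integral>\<^sup>+\<tau>. ennreal (?I \<tau> *\<^sub>R c n \<tau>) \<partial>lborel"
  \<comment> \<open>One factor \<open>E\<close> compares the current distance under the integral
    with the initial one, the other compares the initial distance with the final one by which
    \<open>a n\<close> divides. The initial quotient needs only the latter.\<close>
  have ineq: "ennreal (a n) \<le> ennreal E * ennreal (b n) + ennreal (E * E) * ?N n" for n
  proof -
    let ?z = "\<bar>z n - x\<bar>"
    let ?D = "\<lambda>\<tau>. u \<tau> (flow \<tau> (z n)) - u \<tau> (flow \<tau> x)"
    let ?\<Delta> = "\<bar>?D t - ?D 0\<bar>"
    let ?d = "\<lambda>\<tau>. - P \<tau> (flow \<tau> (z n)) - - P \<tau> (flow \<tau> x)"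
    have zx: "0 < ?z" using z_ne[of n] by simp
    have E0: "0 < E" using E_ge_1 by linarith
    have inc: "ennreal ?\<Delta> \<le> (\<integral>\<^sup>+\<tau>. ennreal \<bar>?d \<tau>\<bar> * indicator {0..t} \<tau> \<partial>lborel)"
      by (rule increment_le_nn_integral[OF DERIV_diff[OF u_flow_deriv u_flow_deriv] _ t])
        (auto intro!: continuous_intros P_flow_cont)
    also have "\<dots> \<le> (\<integral>\<^sup>+\<tau>. ennreal (E * ?z) * ennreal (?I \<tau> *\<^sub>R c n \<tau>) \<partial>lborel)"
    proof (rule nn_integral_mono)
      fix \<tau>
      show "ennreal \<bar>?d \<tau>\<bar> * indicator {0..t} \<tau> \<le> ennreal (E * ?z) * ennreal (?I \<tau> *\<^sub>R c n \<tau>)"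
      proof (cases "\<tau> \<in> {0..t}")
        case True
        then have \<tau>: "\<tau> \<in> {0..T}" using sub by blast
        have "\<bar>?d \<tau>\<bar> = \<bar>\<delta> n \<tau>\<bar> * c n \<tau>"
          using \<delta>_ne[OF \<tau>, of n] by (simp add: c_def abs_minus_commute)
        also have "\<dots> \<le> (E * ?z) * c n \<tau>" by (intro mult_right_mono \<delta>_le[OF \<tau>]) (simp add: c_def)
        finally show ?thesis using True E0 by (simp add: c_def ennreal_leI flip: ennreal_mult)
      qed simp
    qed
    also have "\<dots> = ennreal (E * ?z) * ?N n" using meas[OF c_cont] by (intro nn_integral_cmult) simp
    finally have inc: "ennreal ?\<Delta> \<le> ennreal (E * ?z) * ?N n" .
    have \<delta>0: "\<delta> n 0 = z n - x" by (simp add: \<delta>_def)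
    have \<delta>t: "0 < \<bar>\<delta> n t\<bar>" using \<delta>_ne[OF t] by simp
    have "a n * \<bar>\<delta> n t\<bar> = \<bar>?D t\<bar>" using \<delta>t by (simp add: a_def)
    also have "\<dots> \<le> \<bar>?D 0\<bar> + ?\<Delta>" by linarith
    also have "\<bar>?D 0\<bar> = b n * ?z" using zx by (simp add: b_def \<delta>0)
    finally have 1: "a n * \<bar>\<delta> n t\<bar> \<le> b n * ?z + ?\<Delta>" .
    have "a n * ?z \<le> a n * (E * \<bar>\<delta> n t\<bar>)" by (intro mult_left_mono \<delta>_ge t) (simp add: a_def)
    also have "\<dots> = E * (a n * \<bar>\<delta> n t\<bar>)" by simp
    also have "\<dots> \<le> E * (b n * ?z + ?\<Delta>)" using E0 by (intro mult_left_mono 1) auto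
    finally have 2: "a n \<le> E * b n + E / ?z * ?\<Delta>" using zx by (simp add: field_simps)
    have "ennreal (a n) \<le> ennreal (E * b n + E / ?z * ?\<Delta>)" by (rule ennreal_leI[OF 2])
    also have "\<dots> = ennreal E * ennreal (b n) + ennreal (E / ?z) * ennreal ?\<Delta>"
    proof -
      have "0 \<le> b n" by (simp add: b_def)
      then show ?thesis using E0 by (subst ennreal_plus) (auto simp: ennreal_mult[symmetric])
    qed
    also have "\<dots> \<le> ennreal E * ennreal (b n) + ennreal (E / ?z) * (ennreal (E * ?z) * ?N n)"
      by (intro add_left_mono mult_left_mono inc) simp
    also have "ennreal (E / ?z) * (ennreal (E * ?z) * ?N n) = ennreal (E * E) * ?N n"
      using E0 zx by (simp add: mult.assoc[symmetric] flip: ennreal_mult)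
    finally show ?thesis .
  qed
  have "?N \<longlonglongrightarrow> (\<integral>\<^sup>+\<tau>. ennreal \<bar>Px \<tau> (flow \<tau> x)\<bar> * indicator {0..t} \<tau> \<partial>lborel)"
  proof (rule nn_integral_dominated_convergence[where w="\<lambda>\<tau>. ennreal H * indicator {0..t} \<tau>"])
    have "(\<lambda>\<tau>. ennreal (?I \<tau> *\<^sub>R \<bar>Px \<tau> (flow \<tau> x)\<bar>)) \<in> borel_measurable borel"
      by (intro measurable_compose[OF meas measurable_ennreal] continuous_intros Px_flow_cont)
    moreover have "ennreal \<bar>Px \<tau> (flow \<tau> x)\<bar> * indicator {0..t} \<tau> = ennreal (?I \<tau> *\<^sub>R \<bar>Px \<tau> (flow \<tau> x)\<bar>)" for \<tau>
      by (auto simp: indicator_def)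
    ultimately show "(\<lambda>\<tau>. ennreal \<bar>Px \<tau> (flow \<tau> x)\<bar> * indicator {0..t} \<tau>) \<in> borel_measurable lborel"
      by simp
    show "(\<lambda>\<tau>. ennreal (?I \<tau> *\<^sub>R c n \<tau>)) \<in> borel_measurable lborel" for n
      using meas[OF c_cont] by simp
    show "AE \<tau> in lborel. ennreal (?I \<tau> *\<^sub>R c n \<tau>) \<le> ennreal H * indicator {0..t} \<tau>" for n
    proof (intro AE_I2)
      fix \<tau>
      show "ennreal (?I \<tau> *\<^sub>R c n \<tau>) \<le> ennreal H * indicator {0..t} \<tau>"
        using c_bound[of \<tau> n] sub by (cases "\<tau> \<in> {0..t}") (auto intro!: ennreal_leI)
    qed
    show "(\<integral>\<^sup>+\<tau>. ennreal H * indicator {0..t} \<tau> \<partial>lborel) < \<infinity>"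
      using t by (simp add: nn_integral_cmult_indicator ennreal_mult_less_top)
    show "AE \<tau> in lborel. (\<lambda>n. ennreal (?I \<tau> *\<^sub>R c n \<tau>)) \<longlonglongrightarrow> ennreal \<bar>Px \<tau> (flow \<tau> x)\<bar> * indicator {0..t} \<tau>"
    proof (intro AE_I2)
      fix \<tau>
      show "(\<lambda>n. ennreal (?I \<tau> *\<^sub>R c n \<tau>)) \<longlonglongrightarrow> ennreal \<bar>Px \<tau> (flow \<tau> x)\<bar> * indicator {0..t} \<tau>"
        using c_lim[of \<tau>] sub by (cases "\<tau> \<in> {0..t}") (auto intro!: tendsto_ennrealI)
    qed
  qed auto
  then have "(\<lambda>n. ennreal E * ennreal (b n) + ennreal (E * E) * ?N n)
    \<longlonglongrightarrow> ennreal E * ennreal \<bar>deriv (u 0) x\<bar> + ennreal (E * E) * (\<integral>\<^sup>+\<tau>. ennreal \<bar>Px \<tau> (flow \<tau> x)\<bar> * indicator {0..t} \<tau> \<partial>lborel)"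
    by (intro tendsto_add ennreal_tendsto_cmult tendsto_ennrealI b_lim) auto
  moreover have "(\<lambda>n. ennreal (a n)) \<longlonglongrightarrow> ennreal \<bar>deriv (u t) (flow t x)\<bar>"
    by (intro tendsto_ennrealI a_lim)
  ultimately show ?thesis
    using ineq by (intro LIMSEQ_le[of "\<lambda>n. ennreal (a n)"]) auto
qed

section \<open>The Lagrangian integral inequality\<close>

definition "U t x = \<bar>u t x\<bar> + \<bar>deriv (u t) x\<bar>"
definition "V t x = ennreal (U t (flow t x))"
definition "C\<^sub>1 = C\<^sub>g + B * B / 2"
definition "K\<^sub>1 z = ennreal (exp (- \<bar>z\<bar>))" for z :: real
text \<open>\<open>E\<close> is the Jacobian of the change to Lagrangian coordinates, and the
  exponential pays for the displacement of both arguments of the kernel; adding 1 to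
  \<open>C\<^sub>1\<close> ensures positivity.\<close>

definition "C\<^sub>2 = (C\<^sub>1 + 1) * (E * exp (2 * (B * T)))"

lemma U_nonneg: "0 \<le> U t x" by (simp add: U_def)

lemma U_cont: "t \<in> {0..T} \<Longrightarrow> continuous_on UNIV (U t)"
  unfolding U_def[abs_def] using time_continuousD(1)[OF time_continuous_ux]
  by (intro continuous_intros u_cont) auto

lemma K1_measurable [measurable]: "K\<^sub>1 \<in> borel_measurable borel" unfolding K\<^sub>1_def by measurable

lemma C1_nonneg: "0 \<le> C\<^sub>1" using Cg B_nonneg by (simp add: C\<^sub>1_def)

lemma C2_ge: "C\<^sub>1 \<le> C\<^sub>2" "0 < C\<^sub>2"
proof -
  have "1 * 1 \<le> E * exp (2 * (B * T))" using E_ge_1 B_nonneg T by (intro mult_mono) auto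
  then have "(C\<^sub>1 + 1) * 1 \<le> C\<^sub>2" unfolding C\<^sub>2_def using C1_nonneg by (intro mult_left_mono) auto
  then show "C\<^sub>1 \<le> C\<^sub>2" "0 < C\<^sub>2" using C1_nonneg by auto
qed

text \<open>The source is made linear in the solution: \<open>g\<close> by its slope bound, the
  quadratic term by bounding f'' and one of the two factors u_x by \<open>B\<close>.\<close>

lemma source_le:
  assumes t: "t \<in> {0..T}"
  shows "\<bar>source t y\<bar> \<le> C\<^sub>1 * U t y"
proof -
  have "\<bar>g (u t y)\<bar> \<le> C\<^sub>g * \<bar>u t y\<bar>" by (intro g_bound u_bound t)
  moreover have "\<bar>deriv (deriv f) (u t y)\<bar> * (\<bar>deriv (u t) y\<bar> * \<bar>deriv (u t) y\<bar>) \<le> B * (B * \<bar>deriv (u t) y\<bar>)"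
    using B_nonneg by (intro mult_mono f''_bound ux_bound t) auto
  then have "\<bar>deriv (deriv f) (u t y) / 2 * (deriv (u t) y)\<^sup>2\<bar> \<le> B * B / 2 * \<bar>deriv (u t) y\<bar>"
    by (simp add: abs_mult power2_eq_square mult_ac)
  moreover have "0 \<le> C\<^sub>g * \<bar>deriv (u t) y\<bar>" "0 \<le> B * B / 2 * \<bar>u t y\<bar>" using Cg B_nonneg by auto
  ultimately show ?thesis
    unfolding source_def C\<^sub>1_def U_def distrib_left distrib_right by linarith
qed

text \<open>After the substitution y = flow(y'), the kernel at two transported points is compared
  with the kernel at the starting points: the distance has shrunk by at most
  \<open>2 * (B * T)\<close>.\<close>

lemma convolution_le_conv_step:
  assumes \<tau>: "\<tau> \<in> {0..T}" and [measurable]: "K \<in> borel_measurable borel"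
    and K: "\<And>z. \<bar>K z\<bar> \<le> exp (- \<bar>z\<bar>)"
  shows "ennreal \<bar>Defs.convolution K (source \<tau>) (flow \<tau> x)\<bar> \<le> ennreal C\<^sub>2 * (\<integral>\<^sup>+y. K\<^sub>1 (x - y) * V \<tau> y \<partial>lborel)"
proof -
  have [measurable]: "source \<tau> \<in> borel_measurable borel"
    using time_continuousD(1)[OF time_continuous_source \<tau>] by (rule borel_measurable_continuous_onI)
  have [measurable]: "U \<tau> \<in> borel_measurable borel" using U_cont[OF \<tau>] by (rule borel_measurable_continuous_onI)
  have [measurable]: "flow \<tau> \<in> borel_measurable borel" using flow_space_cont[OF \<tau>] by (rule borel_measurable_continuous_onI)
  have [measurable]: "V \<tau> \<in> borel_measurable borel" unfolding V_def by measurable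
  let ?KV = "\<integral>\<^sup>+y. K\<^sub>1 (x - y) * V \<tau> y \<partial>lborel"
  let ?x = "flow \<tau> x"
  obtain H where H: "\<And>y. \<bar>source \<tau> y\<bar> \<le> H" using source_bound \<tau> by blast
  have "ennreal \<bar>Defs.convolution K (source \<tau>) ?x\<bar> \<le> (\<integral>\<^sup>+y. ennreal (norm (K (?x - y) * source \<tau> y)) \<partial>lborel)"
    unfolding Defs.convolution_def real_norm_def[symmetric]
    by (intro integral_norm_bound_ennreal integrable_exp_kernel[where H=H] K H) measurable
  also have "\<dots> \<le> (\<integral>\<^sup>+y. ennreal C\<^sub>1 * (ennreal (exp (- \<bar>?x - y\<bar>)) * ennreal (U \<tau> y)) \<partial>lborel)"
  proof (rule nn_integral_mono)
    fix y
    have "\<bar>K (?x - y)\<bar> * \<bar>source \<tau> y\<bar> \<le> exp (- \<bar>?x - y\<bar>) * (C\<^sub>1 * U \<tau> y)"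
      by (intro mult_mono K source_le \<tau>) auto
    also have "\<dots> = C\<^sub>1 * (exp (- \<bar>?x - y\<bar>) * U \<tau> y)" by simp
    finally have "ennreal (norm (K (?x - y) * source \<tau> y)) \<le> ennreal (C\<^sub>1 * (exp (- \<bar>?x - y\<bar>) * U \<tau> y))"
      unfolding real_norm_def abs_mult by (rule ennreal_leI)
    then show "ennreal (norm (K (?x - y) * source \<tau> y)) \<le> ennreal C\<^sub>1 * (ennreal (exp (- \<bar>?x - y\<bar>)) * ennreal (U \<tau> y))"
      using C1_nonneg U_nonneg by (simp add: ennreal_mult)
  qed
  also have "\<dots> = ennreal C\<^sub>1 * (\<integral>\<^sup>+y. ennreal (exp (- \<bar>?x - y\<bar>)) * ennreal (U \<tau> y) \<partial>lborel)"
    by (intro nn_integral_cmult) measurable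
  also have "\<dots> \<le> ennreal C\<^sub>1 * (ennreal E * (\<integral>\<^sup>+y. ennreal (exp (- \<bar>?x - flow \<tau> y\<bar>)) * ennreal (U \<tau> (flow \<tau> y)) \<partial>lborel))"
    unfolding E_def by (intro mult_left_mono flow_nn_integral \<tau>) auto
  also have "\<dots> \<le> ennreal C\<^sub>1 * (ennreal E * (\<integral>\<^sup>+y. ennreal (exp (2 * (B * T))) * (K\<^sub>1 (x - y) * V \<tau> y) \<partial>lborel))"
  proof (intro mult_left_mono nn_integral_mono)
    fix y
    have "\<bar>x - y\<bar> - 2 * (B * T) \<le> \<bar>?x - flow \<tau> y\<bar>"
      using flow_displacement[OF \<tau>, of x] flow_displacement[OF \<tau>, of y] by linarith
    then have "exp (- \<bar>?x - flow \<tau> y\<bar>) \<le> exp (2 * (B * T)) * exp (- \<bar>x - y\<bar>)" by (simp flip: exp_add)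
    then have "ennreal (exp (- \<bar>?x - flow \<tau> y\<bar>)) \<le> ennreal (exp (2 * (B * T))) * K\<^sub>1 (x - y)"
      unfolding K\<^sub>1_def by (simp add: ennreal_leI flip: ennreal_mult)
    then show "ennreal (exp (- \<bar>?x - flow \<tau> y\<bar>)) * ennreal (U \<tau> (flow \<tau> y)) \<le> ennreal (exp (2 * (B * T))) * (K\<^sub>1 (x - y) * V \<tau> y)"
      unfolding V_def mult.assoc[symmetric] by (intro mult_right_mono) auto
  qed auto
  also have "\<dots> = ennreal C\<^sub>1 * (ennreal E * (ennreal (exp (2 * (B * T))) * ?KV))" by (subst nn_integral_cmult) auto
  also have "\<dots> = ennreal (C\<^sub>1 * (E * exp (2 * (B * T)))) * ?KV" using C1_nonneg E_ge_1 by (simp add: ennreal_mult mult.assoc)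
  also have "\<dots> \<le> ennreal C\<^sub>2 * ?KV" unfolding C\<^sub>2_def using E_ge_1 by (intro mult_right_mono ennreal_leI) auto
  finally show ?thesis .
qed

text \<open>The identity part of \<open>conv_step\<close> is there for \<open>Px\<close>, whose
  local term is the source itself.\<close>

lemma P_le_conv_step:
  assumes \<tau>: "\<tau> \<in> {0..T}"
  shows "ennreal \<bar>P \<tau> (flow \<tau> x)\<bar> \<le> ennreal C\<^sub>2 * conv_step K\<^sub>1 (V \<tau>) x"
    and "ennreal \<bar>Px \<tau> (flow \<tau> x)\<bar> \<le> ennreal C\<^sub>2 * conv_step K\<^sub>1 (V \<tau>) x"
proof -
  have "ennreal \<bar>P \<tau> (flow \<tau> x)\<bar> \<le> ennreal C\<^sub>2 * (\<integral>\<^sup>+y. K\<^sub>1 (x - y) * V \<tau> y \<partial>lborel)"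
    unfolding P_def dx_inv_Helmholtz_def
    by (rule convolution_le_conv_step[OF \<tau> sgn_q_kernel_measurable q_kernel_le(2)])
  also have "\<dots> \<le> ennreal C\<^sub>2 * conv_step K\<^sub>1 (V \<tau>) x" unfolding conv_step_def by (intro mult_left_mono) auto
  finally show "ennreal \<bar>P \<tau> (flow \<tau> x)\<bar> \<le> ennreal C\<^sub>2 * conv_step K\<^sub>1 (V \<tau>) x" .
  have "ennreal \<bar>Px \<tau> (flow \<tau> x)\<bar> \<le> ennreal (\<bar>source \<tau> (flow \<tau> x)\<bar> + \<bar>Defs.convolution q_kernel (source \<tau>) (flow \<tau> x)\<bar>)"
    unfolding Px_def by (intro ennreal_leI) linarith
  also have "\<dots> = ennreal \<bar>source \<tau> (flow \<tau> x)\<bar> + ennreal \<bar>Defs.convolution q_kernel (source \<tau>) (flow \<tau> x)\<bar>"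
    by simp
  also have "\<dots> \<le> ennreal C\<^sub>2 * V \<tau> x + ennreal C\<^sub>2 * (\<integral>\<^sup>+y. K\<^sub>1 (x - y) * V \<tau> y \<partial>lborel)"
  proof (rule add_mono[OF _ convolution_le_conv_step[OF \<tau> q_kernel_measurable q_kernel_le(1)]])
    have "\<bar>source \<tau> (flow \<tau> x)\<bar> \<le> C\<^sub>2 * U \<tau> (flow \<tau> x)"
      by (rule order_trans[OF source_le[OF \<tau>] mult_right_mono[OF C2_ge(1) U_nonneg]])
    then show "ennreal \<bar>source \<tau> (flow \<tau> x)\<bar> \<le> ennreal C\<^sub>2 * V \<tau> x"
      unfolding V_def using C2_ge(2) U_nonneg by (simp add: ennreal_leI flip: ennreal_mult)
  qed
  also have "\<dots> = ennreal C\<^sub>2 * conv_step K\<^sub>1 (V \<tau>) x" unfolding conv_step_def by (simp add: distrib_left)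
  finally show "ennreal \<bar>Px \<tau> (flow \<tau> x)\<bar> \<le> ennreal C\<^sub>2 * conv_step K\<^sub>1 (V \<tau>) x" .
qed

text \<open>\<open>E\<close> multiplies the initial slope and \<open>E * E * C\<^sub>2\<close> the
  time integral of \<open>Px\<close>; the smaller constants of the estimate for \<open>u\<close> are
  raised to these, whence the 2.\<close>

definition "C = E + 2 * (E * E) * C\<^sub>2"

lemma C_pos: "0 < C" unfolding C_def using E_ge_1 C2_ge(2) by (intro add_pos_nonneg) auto

lemma lagrangian_inequality:
  assumes t: "t \<in> {0..T}"
  shows "V t x \<le> ennreal C * V 0 x + ennreal C * (\<integral>\<^sup>+\<tau>. conv_step K\<^sub>1 (V \<tau>) x * indicator {0..t} \<tau> \<partial>lborel)"
proof -
  let ?J = "\<integral>\<^sup>+\<tau>. conv_step K\<^sub>1 (V \<tau>) x * indicator {0..t} \<tau> \<partial>lborel"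
  have sub: "{0..t} \<subseteq> {0..T}" using t by auto
  have le: "(\<integral>\<^sup>+\<tau>. ennreal \<bar>h \<tau> (flow \<tau> x)\<bar> * indicator {0..t} \<tau> \<partial>lborel) \<le> ennreal C\<^sub>2 * ?J"
    if h: "continuous_on {0..T} (\<lambda>\<tau>. h \<tau> (flow \<tau> x))"
      and le: "\<And>\<tau>. \<tau> \<in> {0..T} \<Longrightarrow> ennreal \<bar>h \<tau> (flow \<tau> x)\<bar> \<le> ennreal C\<^sub>2 * conv_step K\<^sub>1 (V \<tau>) x" for h :: "real \<Rightarrow> real \<Rightarrow> real"
  proof (rule nn_integral_le_cmult[OF _ C2_ge(2)])
    have "(\<lambda>\<tau>. indicator {0..t} \<tau> *\<^sub>R \<bar>h \<tau> (flow \<tau> x)\<bar>) \<in> borel_measurable borel"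
      by (rule borel_measurable_continuous_on_indicator) (use sub in \<open>auto intro!: continuous_intros continuous_on_subset[OF h]\<close>)
    then have "(\<lambda>\<tau>. ennreal (indicator {0..t} \<tau> *\<^sub>R \<bar>h \<tau> (flow \<tau> x)\<bar>)) \<in> borel_measurable lborel"
      by simp
    moreover have "ennreal \<bar>h \<tau> (flow \<tau> x)\<bar> * indicator {0..t} \<tau> = ennreal (indicator {0..t} \<tau> *\<^sub>R \<bar>h \<tau> (flow \<tau> x)\<bar>)" for \<tau>
      by (auto simp: indicator_def)
    ultimately show "(\<lambda>\<tau>. ennreal \<bar>h \<tau> (flow \<tau> x)\<bar> * indicator {0..t} \<tau>) \<in> borel_measurable lborel" by simp
    show "ennreal \<bar>h \<tau> (flow \<tau> x)\<bar> * indicator {0..t} \<tau> \<le> ennreal C\<^sub>2 * (conv_step K\<^sub>1 (V \<tau>) x * indicator {0..t} \<tau>)" for \<tau>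
      using le[of \<tau>] sub by (cases "\<tau> \<in> {0..t}") auto
  qed
  have E1: "1 \<le> ennreal E" using E_ge_1 by simp
  have C2': "ennreal C\<^sub>2 \<le> ennreal (E * E) * ennreal C\<^sub>2"
  proof -
    have "1 \<le> E * E" using mult_mono[OF E_ge_1 E_ge_1] E_ge_1 by simp
    then show ?thesis using mult_right_mono[of 1 "ennreal (E * E)" "ennreal C\<^sub>2"] by simp
  qed
  have "V t x = ennreal \<bar>u t (flow t x)\<bar> + ennreal \<bar>deriv (u t) (flow t x)\<bar>" by (simp add: V_def U_def)
  also have "\<dots> \<le> (ennreal \<bar>u 0 x\<bar> + ennreal C\<^sub>2 * ?J) + (ennreal E * ennreal \<bar>deriv (u 0) x\<bar> + ennreal (E * E) * (ennreal C\<^sub>2 * ?J))"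
    by (intro add_mono order_trans[OF u_flow_bound[OF t]] order_trans[OF ux_flow_bound[OF t]]
        add_left_mono mult_left_mono le P_flow_cont Px_flow_cont P_le_conv_step) auto
  also have "\<dots> \<le> (ennreal E * ennreal \<bar>u 0 x\<bar> + ennreal (E * E) * ennreal C\<^sub>2 * ?J) + (ennreal E * ennreal \<bar>deriv (u 0) x\<bar> + ennreal (E * E) * ennreal C\<^sub>2 * ?J)"
    using mult_right_mono[OF E1, of "ennreal \<bar>u 0 x\<bar>"] mult_right_mono[OF C2', of ?J]
    by (intro add_mono) (simp_all add: mult.assoc)
  also have "\<dots> = ennreal E * (ennreal \<bar>u 0 x\<bar> + ennreal \<bar>deriv (u 0) x\<bar>) + (ennreal (E * E) * ennreal C\<^sub>2 * ?J + ennreal (E * E) * ennreal C\<^sub>2 * ?J)"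
    by (simp add: distrib_left add_ac)
  also have "ennreal \<bar>u 0 x\<bar> + ennreal \<bar>deriv (u 0) x\<bar> = V 0 x" by (simp add: V_def U_def)
  also have "ennreal (E * E) * ennreal C\<^sub>2 * ?J + ennreal (E * E) * ennreal C\<^sub>2 * ?J = ennreal (2 * (E * E) * C\<^sub>2) * ?J"
    using E_ge_1 C2_ge(2) by (simp add: distrib_right[symmetric] mult.assoc flip: ennreal_mult ennreal_plus)
  also have "ennreal E * V 0 x + ennreal (2 * (E * E) * C\<^sub>2) * ?J \<le> ennreal C * V 0 x + ennreal C * ?J"
    unfolding C_def using E_ge_1 C2_ge(2) by (intro add_mono mult_right_mono ennreal_leI) auto
  finally show ?thesis .
qed

end

section \<open>The weighted estimate\<close>

context hs_solution
begin

lemma Lp_norm_top_le_SUP: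
  assumes "time_continuous T w" "t \<in> {0..T}"
  shows "ennreal \<bar>w t x\<bar> \<le> (SUP t\<in>{0..T}. Lp_norm \<infinity> (w t))"
proof -
  have "ennreal \<bar>w t x\<bar> \<le> Lp_norm \<infinity> (w t)" using Lp_norm_top_le_iff[OF time_continuousD(1)[OF assms]] by blast
  also have "\<dots> \<le> (SUP t\<in>{0..T}. Lp_norm \<infinity> (w t))" by (rule SUP_upper[OF assms(2)])
  finally show ?thesis .
qed

lemma SUP_Lp_norm_top_finite:
  assumes "time_continuous T w"
  shows "(SUP t\<in>{0..T}. Lp_norm \<infinity> (w t)) < \<infinity>"
proof -
  obtain D where D: "\<And>t x. t \<in> {0..T} \<Longrightarrow> \<bar>w t x\<bar> \<le> D" using time_continuousD(3)[OF assms] by blast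
  have "(SUP t\<in>{0..T}. Lp_norm \<infinity> (w t)) \<le> ennreal D"
  proof (rule SUP_least)
    fix t assume t: "t \<in> {0..T}"
    show "Lp_norm \<infinity> (w t) \<le> ennreal D"
      unfolding Lp_norm_top_le_iff[OF time_continuousD(1)[OF assms t]] using D[OF t] ennreal_leI by blast
  qed
  then show ?thesis by (simp add: le_less_trans)
qed

lemma sup_bound_terms:
  "time_continuous T (\<lambda>t x. f (u t x))" "time_continuous T (\<lambda>t x. deriv f (u t x))" "time_continuous T (\<lambda>t x. deriv (deriv f) (u t x))"
  using smooth_continuous[OF f, of 0] smooth_continuous[OF f, of 1] smooth_continuous[OF f, of 2]
  by (auto intro!: time_continuous_compose[OF time_continuous_u] simp: numeral_2_eq_2)

text \<open>Guards the passage to a real number: \<open>enn2real\<close> would turn an infinite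
  bound into 0.\<close>

lemma sup_bound_finite: "sup_bound f T u < \<infinity>"
  using SUP_Lp_norm_top_finite[OF time_continuous_u] SUP_Lp_norm_top_finite[OF time_continuous_ux]
    SUP_Lp_norm_top_finite[OF sup_bound_terms(1)] SUP_Lp_norm_top_finite[OF sup_bound_terms(2)]
    SUP_Lp_norm_top_finite[OF sup_bound_terms(3)]
  unfolding sup_bound_def by (simp add: ennreal_add_eq_top less_top)

lemma sup_bound_pointwise:
  assumes t: "t \<in> {0..T}"
  defines "B \<equiv> enn2real (sup_bound f T u)"
  shows "\<bar>u t x\<bar> \<le> B" "\<bar>deriv (u t) x\<bar> \<le> B" "\<bar>deriv f (u t x)\<bar> \<le> B" "\<bar>deriv (deriv f) (u t x)\<bar> \<le> B"
proof -
  have sup: "sup_bound f T u = ennreal B" unfolding B_def using sup_bound_finite by (simp add: less_top)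
  have B: "0 \<le> B" by (simp add: B_def)
  have le: "\<bar>a\<bar> \<le> B" if "ennreal \<bar>a\<bar> \<le> sup_bound f T u" for a
    using that B by (simp add: sup ennreal_le_iff)
  show "\<bar>u t x\<bar> \<le> B"
    by (intro le order_trans[OF Lp_norm_top_le_SUP[OF time_continuous_u t]]) (simp add: sup_bound_def add.assoc)
  show "\<bar>deriv (u t) x\<bar> \<le> B" by (intro le order_trans[OF Lp_norm_top_le_SUP[OF time_continuous_ux t]])
      (simp add: sup_bound_def add.assoc add_increasing)
  show "\<bar>deriv f (u t x)\<bar> \<le> B" by (intro le order_trans[OF Lp_norm_top_le_SUP[OF sup_bound_terms(2) t]])
      (simp add: sup_bound_def add.assoc add_increasing)
  show "\<bar>deriv (deriv f) (u t x)\<bar> \<le> B" by (intro le order_trans[OF Lp_norm_top_le_SUP[OF sup_bound_terms(3) t]])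
      (simp add: sup_bound_def add_increasing)
qed

end

locale weighted_hs_solution = bounded_hs_solution +
  fixes A c\<^sub>0 N :: real and v \<phi> :: "real \<Rightarrow> real"
  assumes adm: "admissible_weight A v c\<^sub>0 \<phi>"
    and N: "(\<integral>\<^sup>+x. ennreal (exp (- \<bar>x\<bar>) * v x) \<partial>lborel) = ennreal N" "0 \<le> N"
begin

lemma c0: "0 < c\<^sub>0" and \<phi>_pos: "0 < \<phi> x" and \<phi>_moderate: "\<phi> (x + y) \<le> c\<^sub>0 * v x * \<phi> y"
  using adm by (auto simp: admissible_weight_def moderate_with_def)

lemma v_pos: "0 < v x" and v_cont: "continuous_on UNIV v" using adm by (auto simp: admissible_weight_def weight_function_def)

lemma v_measurable [measurable]: "v \<in> borel_measurable borel" using v_cont by (rule borel_measurable_continuous_onI)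

lemma \<phi>_cont: "continuous_on UNIV \<phi>"
  using adm by (auto simp: admissible_weight_def intro: locally_absolutely_continuous_imp_continuous)

text \<open>The square is the growth bound for \<open>v\<close> at a displacement of at most
  \<open>B * T\<close>, so this is the largest factor by which the weight can grow along a
  characteristic.\<close>

definition "C\<^sub>\<phi> = c\<^sub>0 * (N * exp (1 + B * T))\<^sup>2"
definition "\<Lambda> = C * exp (C * T * (1 + c\<^sub>0 * N))"
text \<open>The kernel exp(-|.|) conjugated by the weight: moderateness bounds \<phi>(x) / \<phi>(y)
  by c_0 v(x - y).\<close>

definition "K\<^sub>2 z = ennreal c\<^sub>0 * ennreal (exp (- \<bar>z\<bar>) * v z)"

lemma \<phi>_flow:
  assumes t: "t \<in> {0..T}"
  shows "\<phi> (flow t x) \<le> C\<^sub>\<phi> * \<phi> x"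
proof -
  have "v (flow t x - x) \<le> (N * exp (1 + \<bar>flow t x - x\<bar>))\<^sup>2"
    using adm N by (intro submultiplicative_growth) (auto simp: admissible_weight_def)
  also have "\<dots> \<le> (N * exp (1 + B * T))\<^sup>2" using flow_displacement[OF t, of x] N(2) by (intro power_mono mult_left_mono) auto
  finally have "c\<^sub>0 * v (flow t x - x) * \<phi> x \<le> c\<^sub>0 * (N * exp (1 + B * T))\<^sup>2 * \<phi> x"
    using c0 \<phi>_pos[of x] by (intro mult_right_mono mult_left_mono) auto
  then show ?thesis
    using \<phi>_moderate[of "flow t x - x" x] by (simp add: C\<^sub>\<phi>_def)
qed

lemma C_\<phi>_pos: "0 < C\<^sub>\<phi>"
proof -
  have "0 < C\<^sub>\<phi> * \<phi> 0" using \<phi>_flow[of 0 0] \<phi>_pos[of 0] T by simp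
  then show ?thesis using \<phi>_pos[of 0] by (simp add: zero_less_mult_iff)
qed

lemma K2_measurable [measurable]: "K\<^sub>2 \<in> borel_measurable borel" unfolding K\<^sub>2_def by measurable

lemma K2_mass: "1 + (\<integral>\<^sup>+y. K\<^sub>2 y \<partial>lborel) = ennreal (1 + c\<^sub>0 * N)"
  unfolding K\<^sub>2_def using c0 N by (simp add: nn_integral_cmult ennreal_mult)

sublocale neumann_kernel K\<^sub>2 "1 + c\<^sub>0 * N" C T \<Lambda>
  by unfold_locales (use K2_mass c0 N T C_pos in \<open>auto simp: \<Lambda>_def\<close>)

definition "W t x = \<phi> x * U t x"

lemma W_nonneg: "0 \<le> W t x" using \<phi>_pos[of x] U_nonneg by (simp add: W_def)

lemma W_cont: "t \<in> {0..T} \<Longrightarrow> continuous_on UNIV (W t)"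
  unfolding W_def[abs_def] by (intro continuous_intros \<phi>_cont U_cont)

lemma W_flow_le: "t \<in> {0..T} \<Longrightarrow> W t (flow t x) \<le> C\<^sub>\<phi> * (\<phi> x * U t (flow t x))"
  using mult_right_mono[OF \<phi>_flow U_nonneg] by (simp add: W_def mult.assoc)

text \<open>Iteration takes place with \<open>K\<^sub>1\<close>, for which the crude bound 2 B on
  \<open>V\<close> is enough. Multiplication of the finished series by \<phi>(x) then exchanges
  \<open>K\<^sub>1\<close> for \<open>K\<^sub>2\<close>.\<close>

lemma weighted_series_bound:
  assumes t: "t \<in> {0..T}"
  shows "ennreal (\<phi> x * U t (flow t x)) \<le> S (\<lambda>y. ennreal (W 0 y)) x"
proof -
  let ?k = "LINT y|lborel. exp (- \<bar>y::real\<bar>)"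
  have T0: "0 \<in> {0..T}" using T by simp
  have V0: "V 0 = (\<lambda>x. ennreal (U 0 x))" by (auto simp: V_def)
  have [measurable]: "V 0 \<in> borel_measurable borel" unfolding V0 using borel_measurable_continuous_onI[OF U_cont[OF T0]] by measurable
  have k0: "0 \<le> ?k" by (rule Bochner_Integration.integral_nonneg) simp
  have k: "1 + (\<integral>\<^sup>+y. K\<^sub>1 y \<partial>lborel) = ennreal (1 + ?k)"
    unfolding K\<^sub>1_def using k0 by (subst nn_integral_eq_integral[OF integrable_exp_abs]) auto
  have "V t x \<le> conv_series (exp_coeff C T) K\<^sub>1 (V 0) x"
  proof (rule conv_series_bound[OF K1_measurable _ k _ _ _ _ lagrangian_inequality t])
    fix t x assume t: "t \<in> {0..T}"
    show "V t x \<le> ennreal (2 * B)"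
      unfolding V_def U_def using u_bound[OF t, of "flow t x"] ux_bound[OF t, of "flow t x"] by (intro ennreal_leI) linarith
  qed (use k0 C_pos B_nonneg in auto)
  then have "ennreal (\<phi> x) * V t x \<le> ennreal (\<phi> x) * conv_series (exp_coeff C T) K\<^sub>1 (V 0) x"
    by (rule mult_left_mono) simp
  also have "\<dots> \<le> S (\<lambda>x. ennreal (\<phi> x) * V 0 x) x"
  proof (rule conv_series_weight)
    fix x y
    have "exp (- \<bar>x - y\<bar>) * \<phi> x \<le> exp (- \<bar>x - y\<bar>) * (c\<^sub>0 * v (x - y) * \<phi> y)"
      using \<phi>_moderate[of "x - y" y] by (intro mult_left_mono) auto
    then have "ennreal (\<phi> x * exp (- \<bar>x - y\<bar>)) \<le> ennreal (c\<^sub>0 * (exp (- \<bar>x - y\<bar>) * v (x - y)) * \<phi> y)"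
      by (intro ennreal_leI) (simp add: mult_ac)
    then show "ennreal (\<phi> x) * K\<^sub>1 (x - y) \<le> K\<^sub>2 (x - y) * ennreal (\<phi> y)"
      unfolding K\<^sub>1_def K\<^sub>2_def using c0 \<phi>_pos[of x] \<phi>_pos[of y] v_pos[of "x - y"] by (simp add: ennreal_mult)
  qed measurable
  also have "(\<lambda>x. ennreal (\<phi> x) * V 0 x) = (\<lambda>x. ennreal (W 0 x))"
    using \<phi>_pos U_nonneg by (auto simp: V0 W_def ennreal_mult less_imp_le)
  finally show ?thesis
    using \<phi>_pos[of x] U_nonneg by (simp add: V_def ennreal_mult)
qed

text \<open>Return from characteristics to space: for p = \<infinity> every point lies on a
  characteristic, for finite p the flow changes integrals by at most \<open>E\<close>. In both cases
  the weight moves at the price \<open>C\<^sub>\<phi>\<close>, and the series contributes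
  \<open>\<Lambda>\<close>.\<close>

lemma weighted_norm_bound:
  assumes t: "t \<in> {0..T}" and p: "1 \<le> p"
  shows "Lp_norm p (W t) \<le> ennreal (E * C\<^sub>\<phi> * \<Lambda>) * Lp_norm p (W 0)"
proof (cases "p = \<infinity>")
  case True
  have T0: "0 \<in> {0..T}" using T by simp
  have W0: "ennreal (W 0 y) \<le> Lp_norm \<infinity> (W 0)" for y
    using Lp_norm_top_le_iff[OF W_cont[OF T0], of "Lp_norm \<infinity> (W 0)"] W_nonneg by simp
  have "ennreal \<bar>W t y\<bar> \<le> ennreal (E * C\<^sub>\<phi> * \<Lambda>) * Lp_norm \<infinity> (W 0)" for y
  proof -
    obtain x where x: "flow t x = y" using flow_surj[OF t] by blast
    have "ennreal \<bar>W t y\<bar> \<le> ennreal (C\<^sub>\<phi> * (\<phi> x * U t (flow t x)))"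
      using W_flow_le[OF t, of x] W_nonneg by (intro ennreal_leI) (simp add: x)
    also have "\<dots> = ennreal C\<^sub>\<phi> * ennreal (\<phi> x * U t (flow t x))"
      using C_\<phi>_pos \<phi>_pos[of x] U_nonneg by (simp add: ennreal_mult)
    also have "\<dots> \<le> ennreal C\<^sub>\<phi> * (ennreal \<Lambda> * Lp_norm \<infinity> (W 0))"
    proof (rule mult_left_mono)
      have "S (\<lambda>y. ennreal (W 0 y)) x \<le> S (\<lambda>_. Lp_norm \<infinity> (W 0)) x" by (intro S_mono W0)
      then show "ennreal (\<phi> x * U t (flow t x)) \<le> ennreal \<Lambda> * Lp_norm \<infinity> (W 0)"
        using weighted_series_bound[OF t, of x] unfolding S_const by (rule order_trans[rotated])
    qed simp
    also have "\<dots> = ennreal (C\<^sub>\<phi> * \<Lambda>) * Lp_norm \<infinity> (W 0)"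
      using C_\<phi>_pos \<Lambda>_pos by (simp add: ennreal_mult mult.assoc)
    \<comment> \<open>The factor E \<ge> 1 is inserted to have one constant for all
      exponents.\<close>
    also have "\<dots> \<le> ennreal (E * C\<^sub>\<phi> * \<Lambda>) * Lp_norm \<infinity> (W 0)"
      using C_\<phi>_pos \<Lambda>_pos E_ge_1 mult_right_mono[OF E_ge_1, of "C\<^sub>\<phi> * \<Lambda>"]
      by (intro mult_right_mono ennreal_leI) (auto simp: mult.assoc)
    finally show ?thesis .
  qed
  then show ?thesis unfolding True Lp_norm_top_le_iff[OF W_cont[OF t]] by blast
next
  case False
  define r where "r = enn2real p"
  have r: "1 \<le> r" using False p by (cases p) (auto simp: r_def simp flip: ennreal_1)
  have T0: "0 \<in> {0..T}" using T by simp
  have [measurable]: "W t \<in> borel_measurable borel" "W 0 \<in> borel_measurable borel"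
    using W_cont[OF t] W_cont[OF T0] by (auto intro: borel_measurable_continuous_onI)
  let ?Z = "\<lambda>x. \<phi> x * U t (flow t x)"
  have "continuous_on UNIV ?Z" by (intro continuous_intros \<phi>_cont continuous_on_compose2[OF U_cont[OF t] flow_space_cont[OF t]]) auto
  then have [measurable]: "?Z \<in> borel_measurable borel" by (rule borel_measurable_continuous_onI)
  have Z_nonneg: "0 \<le> ?Z x" for x using \<phi>_pos[of x] U_nonneg by simp
  have "(\<integral>\<^sup>+y. ennreal (W t y powr r) \<partial>lborel) \<le> ennreal E * (\<integral>\<^sup>+x. ennreal (W t (flow t x) powr r) \<partial>lborel)"
    unfolding E_def by (rule flow_nn_integral[OF t]) measurable
  also have "\<dots> \<le> ennreal E * (\<integral>\<^sup>+x. ennreal (C\<^sub>\<phi> powr r) * ennreal (?Z x powr r) \<partial>lborel)"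
  proof (intro mult_left_mono nn_integral_mono)
    fix x
    have "W t (flow t x) powr r \<le> (C\<^sub>\<phi> * ?Z x) powr r" using r W_nonneg by (intro powr_mono2 W_flow_le t) auto
    also have "\<dots> = C\<^sub>\<phi> powr r * ?Z x powr r" using C_\<phi>_pos Z_nonneg by (intro powr_mult)
    finally show "ennreal (W t (flow t x) powr r) \<le> ennreal (C\<^sub>\<phi> powr r) * ennreal (?Z x powr r)"
      by (simp add: ennreal_leI flip: ennreal_mult)
  qed simp
  also have "\<dots> = ennreal E * (ennreal (C\<^sub>\<phi> powr r) * (\<integral>\<^sup>+x. ennreal (?Z x powr r) \<partial>lborel))"
    by (subst nn_integral_cmult) auto
  also have "\<dots> \<le> ennreal (E powr r) * (ennreal (C\<^sub>\<phi> powr r) * (ennreal (\<Lambda> powr r) * (\<integral>\<^sup>+x. ennreal (W 0 x powr r) \<partial>lborel)))"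
  proof (intro mult_mono mult_left_mono)
    \<comment> \<open>As E and r are at least 1, the Jacobian is below E^r, so that taking the r-th
      root costs at most \<open>E\<close> for every exponent.\<close>
    show "ennreal E \<le> ennreal (E powr r)" using powr_mono[OF r E_ge_1] E_ge_1 by (intro ennreal_leI) simp
    show "(\<integral>\<^sup>+x. ennreal (?Z x powr r) \<partial>lborel) \<le> ennreal (\<Lambda> powr r) * (\<integral>\<^sup>+x. ennreal (W 0 x powr r) \<partial>lborel)"
      by (rule S_Lp[OF r _ W_nonneg weighted_series_bound[OF t] Z_nonneg]) measurable
  qed auto
  also have "\<dots> = ennreal ((E * C\<^sub>\<phi> * \<Lambda>) powr r) * (\<integral>\<^sup>+x. ennreal (W 0 x powr r) \<partial>lborel)"
    using C_\<phi>_pos \<Lambda>_pos E_ge_1 by (simp add: powr_mult ennreal_mult mult.assoc)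
  finally show ?thesis
    using False r C_\<phi>_pos \<Lambda>_pos E_ge_1 W_nonneg
    by (intro Lp_norm_finite_exponent_le) (auto simp flip: r_def)
qed

text \<open>The 8 is 2 times 4: two norms on the left are each bounded by that of
  \<open>W t\<close>, and the norm of \<open>W 0\<close> is split by
  \<open>Lp_norm_sum_le\<close>.\<close>

definition "\<kappa> = 8 * (E * C\<^sub>\<phi> * \<Lambda>)"

lemma weighted_persistence:
  assumes t: "t \<in> {0..T}" and p: "1 \<le> p"
  shows "Lp_norm p (\<lambda>x. \<phi> x * u t x) + Lp_norm p (\<lambda>x. \<phi> x * deriv (u t) x)
    \<le> ennreal \<kappa> * (Lp_norm p (\<lambda>x. \<phi> x * u 0 x) + Lp_norm p (\<lambda>x. \<phi> x * deriv (u 0) x))"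
proof -
  have T0: "0 \<in> {0..T}" using T by simp
  have cont: "continuous_on UNIV (\<lambda>x. \<phi> x * u t x)" "continuous_on UNIV (\<lambda>x. \<phi> x * deriv (u t) x)" if "t \<in> {0..T}" for t
    using that by (intro continuous_on_mult \<phi>_cont u_cont time_continuousD(1)[OF time_continuous_ux]; assumption)+
  have abs_W: "\<bar>W t x\<bar> = \<phi> x * \<bar>u t x\<bar> + \<phi> x * \<bar>deriv (u t) x\<bar>" for t x
    using W_nonneg[of t x] by (simp add: W_def U_def distrib_left)
  have "Lp_norm p (\<lambda>x. \<phi> x * u t x) \<le> Lp_norm p (W t)" "Lp_norm p (\<lambda>x. \<phi> x * deriv (u t) x) \<le> Lp_norm p (W t)"
    by (intro Lp_norm_mono cont W_cont t p; use \<phi>_pos in \<open>simp add: abs_W abs_mult less_imp_le\<close>)+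
  then have "Lp_norm p (\<lambda>x. \<phi> x * u t x) + Lp_norm p (\<lambda>x. \<phi> x * deriv (u t) x) \<le> 2 * Lp_norm p (W t)"
    by (metis add_mono mult_2)
  also have "\<dots> \<le> 2 * (ennreal (E * C\<^sub>\<phi> * \<Lambda>) * Lp_norm p (W 0))"
    by (intro mult_left_mono weighted_norm_bound t p) simp
  also have "W 0 = (\<lambda>x. \<bar>\<phi> x * u 0 x\<bar> + \<bar>\<phi> x * deriv (u 0) x\<bar>)"
    using abs_W[of 0] W_nonneg \<phi>_pos by (auto simp: abs_mult less_imp_le)
  also have "2 * (ennreal (E * C\<^sub>\<phi> * \<Lambda>) * Lp_norm p (\<lambda>x. \<bar>\<phi> x * u 0 x\<bar> + \<bar>\<phi> x * deriv (u 0) x\<bar>))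
      \<le> 2 * (ennreal (E * C\<^sub>\<phi> * \<Lambda>) * (4 * (Lp_norm p (\<lambda>x. \<phi> x * u 0 x) + Lp_norm p (\<lambda>x. \<phi> x * deriv (u 0) x))))"
    by (intro mult_left_mono Lp_norm_sum_le cont T0 p) auto
  also have "\<dots> = 2 * ennreal (E * C\<^sub>\<phi> * \<Lambda>) * 4 * (Lp_norm p (\<lambda>x. \<phi> x * u 0 x) + Lp_norm p (\<lambda>x. \<phi> x * deriv (u 0) x))"
    by (simp only: mult.assoc)
  also have "2 * ennreal (E * C\<^sub>\<phi> * \<Lambda>) * 4 = ennreal \<kappa>"
  proof -
    have "2 * ennreal (E * C\<^sub>\<phi> * \<Lambda>) * 4 = 2 * 4 * ennreal (E * C\<^sub>\<phi> * \<Lambda>)" by (simp only: mult_ac)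
    then show ?thesis unfolding \<kappa>_def by (simp add: ennreal_mult')
  qed
  finally show ?thesis .
qed

end

section \<open>The constant and the final estimate\<close>

lemma smooth_vanishing_linear_bound:
  assumes g: "smooth g" and g0: "g 0 = 0"
  shows "\<exists>K\<ge>0. \<forall>y. \<bar>y\<bar> \<le> B \<longrightarrow> \<bar>g y\<bar> \<le> K * \<bar>y\<bar>"
proof -
  have "continuous_on {-B..B} (deriv g)" using continuous_on_subset[OF smooth_continuous[OF g, of 1]] by simp
  then have "bounded (deriv g ` {-B..B})" by (intro compact_imp_bounded compact_continuous_image) auto
  then obtain K where K: "\<And>z. z \<in> {-B..B} \<Longrightarrow> \<bar>deriv g z\<bar> \<le> K" by (force simp: bounded_iff)
  show ?thesis
  proof (intro exI[of _ "\<bar>K\<bar>"] conjI allI impI)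
    fix y assume y: "\<bar>y\<bar> \<le> B"
    have "norm (g y - g 0) \<le> \<bar>K\<bar> * norm (y - 0)"
    proof (rule field_differentiable_bound[of "{-B..B}" g "deriv g"])
      show "(g has_field_derivative deriv g z) (at z within {-B..B})" for z
        using smooth_has_derivative[OF g, of 0 z] by (auto intro: has_field_derivative_at_within)
    qed (use y K in \<open>auto intro: order_trans[OF _ abs_ge_self]\<close>)
    then show "\<bar>g y\<bar> \<le> \<bar>K\<bar> * \<bar>y\<bar>" by (simp add: g0)
  qed simp
qed

text \<open>The dependence of the constant is expressed by quantifier order: the numbers it may
  depend on are fixed outside, and the solution, the weight and the exponent vary only after
  \<open>\<kappa>\<close> has been chosen.\<close>

theorem theorem2p4:
  fixes f g :: "real \<Rightarrow> real" and T A c\<^sub>0 m :: real and N M :: ennreal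
  assumes "smooth f" and "smooth g"
    and "f 0 = 0" and "\<And>x. 0 \<le> deriv (deriv f) x"
    and "\<And>x. 0 \<le> g x" and "\<And>x. g x = 0 \<longleftrightarrow> x = 0"
    and "0 < T"
  shows "\<exists>\<kappa>::real. 0 < \<kappa> \<and>
    (\<forall>(s::real) (u :: real \<Rightarrow> real \<Rightarrow> real) (u\<^sub>0 :: real \<Rightarrow> real)
      (\<phi> :: real \<Rightarrow> real) (v :: real \<Rightarrow> real) (p::ennreal).
      3 / 2 < s \<and> is_solution f g T s u \<and> (\<forall>x. u 0 x = u\<^sub>0 x) \<and>
      admissible_weight A v c\<^sub>0 \<phi> \<and>
      (INF x. v x) = m \<and> Lp_norm 1 (\<lambda>x. exp (- \<bar>x\<bar>) * v x) = N \<and> sup_bound f T u = M \<and>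
      2 \<le> p \<and> (\<lambda>x. \<phi> x * u\<^sub>0 x) \<in> Lp p \<and> (\<lambda>x. \<phi> x * deriv u\<^sub>0 x) \<in> Lp p \<longrightarrow>
      (\<forall>t\<in>{0..T}.
         Lp_norm p (\<lambda>x. \<phi> x * u t x) + Lp_norm p (\<lambda>x. \<phi> x * deriv (u t) x)
         \<le> ennreal \<kappa> *
            (Lp_norm p (\<lambda>x. \<phi> x * u\<^sub>0 x) + Lp_norm p (\<lambda>x. \<phi> x * deriv u\<^sub>0 x))))"
proof -
  have "g 0 = 0" using assms(6)[of 0] by simp
  then obtain C\<^sub>g where Cg: "0 \<le> C\<^sub>g" "\<And>y. \<bar>y\<bar> \<le> enn2real M \<Longrightarrow> \<bar>g y\<bar> \<le> C\<^sub>g * \<bar>y\<bar>"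
    using smooth_vanishing_linear_bound[OF assms(2)] by blast
  \<comment> \<open>Outside its locale the constant is a function of the displayed numbers, so it
    can be formed before any solution or weight is given.\<close>
  define k where "k = weighted_hs_solution.\<kappa> T (enn2real M) C\<^sub>g c\<^sub>0 (enn2real N)"
  show ?thesis
  \<comment> \<open>The sign of \<open>k\<close> is controlled only when a solution and an
    admissible weight exist; the maximum with 1 is positive in any case.\<close>
  proof (intro exI[of _ "max 1 k"] conjI allI impI ballI)
    fix s :: real and u :: "real \<Rightarrow> real \<Rightarrow> real" and u\<^sub>0 \<phi> v :: "real \<Rightarrow> real" and p :: ennreal and t :: real
    assume *: "3 / 2 < s \<and> is_solution f g T s u \<and> (\<forall>x. u 0 x = u\<^sub>0 x) \<and>
      admissible_weight A v c\<^sub>0 \<phi> \<and>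
      (INF x. v x) = m \<and> Lp_norm 1 (\<lambda>x. exp (- \<bar>x\<bar>) * v x) = N \<and> sup_bound f T u = M \<and>
      2 \<le> p \<and> (\<lambda>x. \<phi> x * u\<^sub>0 x) \<in> Lp p \<and> (\<lambda>x. \<phi> x * deriv u\<^sub>0 x) \<in> Lp p" and t: "t \<in> {0..T}"
    then have u0: "u\<^sub>0 = u 0" and adm: "admissible_weight A v c\<^sub>0 \<phi>"
      and M: "M = sup_bound f T u" and N: "N = Lp_norm 1 (\<lambda>x. exp (- \<bar>x\<bar>) * v x)" by auto
    have "(1::ennreal) \<le> 2" by simp
    then have p: "1 \<le> p" using * by (blast intro: order_trans)
    interpret hs_solution f g T s u
      by unfold_locales (use assms * in auto)
    have v: "0 < v x" for x using adm by (simp add: admissible_weight_def weight_function_def)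
    have "N < \<infinity>" using adm by (auto simp: N admissible_weight_def Lp_def)
    then have N': "(\<integral>\<^sup>+x. ennreal (exp (- \<bar>x\<bar>) * v x) \<partial>lborel) = ennreal (enn2real N)"
      using v by (simp add: N Lp_norm_1 less_top abs_mult less_imp_le)
    interpret weighted_hs_solution f g T s u "enn2real M" C\<^sub>g A c\<^sub>0 "enn2real N" v \<phi>
      by unfold_locales (use sup_bound_pointwise Cg adm N' in \<open>auto simp: M\<close>)
    have "ennreal \<kappa> \<le> ennreal (max 1 k)" unfolding k_def by (intro ennreal_leI) simp
    with weighted_persistence[OF t p]
    show "Lp_norm p (\<lambda>x. \<phi> x * u t x) + Lp_norm p (\<lambda>x. \<phi> x * deriv (u t) x)
         \<le> ennreal (max 1 k) * (Lp_norm p (\<lambda>x. \<phi> x * u\<^sub>0 x) + Lp_norm p (\<lambda>x. \<phi> x * deriv u\<^sub>0 x))"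
      unfolding u0 by (meson mult_right_mono order_trans zero_le)
  qed simp
qed

end
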